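(* Let $G$ be a nonabelian nested $p$-group with chain of centers $G=X_0>X_1>\dots>X_n\ge 1$. Then: (1) $|G:X_1|$ is a perfect square; (2) if $G'\le X_i$ for some $i\in\{1,\dots,n\}$, then $|G:X_j|$ is a perfect square for all $1\le j\le i$; (3) if $N$ is a normal subgroup of $G$ with $[X_1,G]\le N<NG'=X_1$, then $G/N$ is semi-extraspecial; (4) if $n\ge 2$ and $X_2<X_2G'$, then $|G:X_1|=|X_2G':X_2|^2=|G':[X_1,G]|^2$, $X_2\cap G'=[X_1,G]$, and there is a normal subgroup $A$ of $G$ with $X_2\le A<X_1$ such that $G/A$ is ultraspecial.
   Context: $p$ is a prime; all groups are finite. For $\chi\in\mathrm{Irr}(G)$, $Z(\chi)=\{g\in G: |\chi(g)|=\chi(1)\}$. $G$ is nested if for all $\chi,\psi\in\mathrm{Irr}(G)$ either $Z(\chi)\le Z(\psi)$ or $Z(\psi)\le Z(\chi)$; then the distinct subgroups $Z(\chi)$ form a chain $G=X_0>X_1>\dots>X_n\ge1$, the chain of centers. A $p$-group $G$ is semi-extraspecial if for every subgroup $N$ of index $p$ in $Z(G)$ the quotient $G/N$ is extraspecial; $G$ is ultraspecial if it is semi-extraspecial and $|G:Z(G)|=|Z(G)|^2$. *)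

theory Defs
  imports "HOL-Algebra.Algebra" "Jordan_Normal_Form.Matrix"
begin

definition p_group :: "nat \<Rightarrow> ('a, 'b) monoid_scheme \<Rightarrow> bool" where
  "p_group p G \<longleftrightarrow> group G \<and> finite (carrier G) \<and> (\<exists>k. order G = p ^ k)"

definition grp_center :: "('a, 'b) monoid_scheme \<Rightarrow> 'a set" where
  "grp_center G = {z \<in> carrier G. \<forall>g \<in> carrier G. z \<otimes>\<^bsub>G\<^esub> g = g \<otimes>\<^bsub>G\<^esub> z}"

definition comm_subgroup :: "('a, 'b) monoid_scheme \<Rightarrow> 'a set \<Rightarrow> 'a set \<Rightarrow> 'a set" where
  "comm_subgroup G A B = generate G
     {inv\<^bsub>G\<^esub> a \<otimes>\<^bsub>G\<^esub> inv\<^bsub>G\<^esub> b \<otimes>\<^bsub>G\<^esub> a \<otimes>\<^bsub>G\<^esub> b | a b. a \<in> A \<and> b \<in> B}"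

abbreviation derived_subgroup :: "('a, 'b) monoid_scheme \<Rightarrow> 'a set" where
  "derived_subgroup G \<equiv> comm_subgroup G (carrier G) (carrier G)"

definition maximal_subgroup :: "'a set \<Rightarrow> ('a, 'b) monoid_scheme \<Rightarrow> bool" where
  "maximal_subgroup H G \<longleftrightarrow> subgroup H G \<and> H \<noteq> carrier G \<and>
     (\<forall>K. subgroup K G \<and> H \<subseteq> K \<longrightarrow> K = H \<or> K = carrier G)"

definition frattini :: "('a, 'b) monoid_scheme \<Rightarrow> 'a set" where
  "frattini G = carrier G \<inter> \<Inter> {H. maximal_subgroup H G}"

definition extraspecial :: "nat \<Rightarrow> ('a, 'b) monoid_scheme \<Rightarrow> bool" where
  "extraspecial p G \<longleftrightarrow> p_group p G \<and> grp_center G = derived_subgroup G \<and>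
     frattini G = grp_center G \<and> card (grp_center G) = p"

definition semi_extraspecial :: "nat \<Rightarrow> ('a, 'b) monoid_scheme \<Rightarrow> bool" where
  "semi_extraspecial p G \<longleftrightarrow> p_group p G \<and>
     (\<forall>N. subgroup N G \<and> N \<subseteq> grp_center G \<and> card (grp_center G) = p * card N
          \<longrightarrow> extraspecial p (G Mod N))"

definition ultraspecial :: "nat \<Rightarrow> ('a, 'b) monoid_scheme \<Rightarrow> bool" where
  "ultraspecial p G \<longleftrightarrow> semi_extraspecial p G \<and>
     card (carrier G) div card (grp_center G) = card (grp_center G) ^ 2"

definition mat_trace :: "'c::comm_ring_1 mat \<Rightarrow> 'c" where
  "mat_trace A = (\<Sum>i<dim_row A. A $$ (i, i))"

definition representation :: "('a, 'b) monoid_scheme \<Rightarrow> nat \<Rightarrow> ('a \<Rightarrow> complex mat) \<Rightarrow> bool" where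
  "representation G d \<rho> \<longleftrightarrow>
     (\<forall>g \<in> carrier G. \<rho> g \<in> carrier_mat d d) \<and>
     \<rho> \<one>\<^bsub>G\<^esub> = 1\<^sub>m d \<and>
     (\<forall>g \<in> carrier G. \<forall>h \<in> carrier G. \<rho> (g \<otimes>\<^bsub>G\<^esub> h) = \<rho> g * \<rho> h)"

definition invariant_subspace :: "('a, 'b) monoid_scheme \<Rightarrow> nat \<Rightarrow> ('a \<Rightarrow> complex mat) \<Rightarrow> complex vec set \<Rightarrow> bool" where
  "invariant_subspace G d \<rho> W \<longleftrightarrow> W \<subseteq> carrier_vec d \<and> 0\<^sub>v d \<in> W \<and>
     (\<forall>v \<in> W. \<forall>w \<in> W. v + w \<in> W) \<and> (\<forall>c. \<forall>v \<in> W. c \<cdot>\<^sub>v v \<in> W) \<and>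
     (\<forall>g \<in> carrier G. \<forall>v \<in> W. \<rho> g *\<^sub>v v \<in> W)"

definition irreducible_rep :: "('a, 'b) monoid_scheme \<Rightarrow> nat \<Rightarrow> ('a \<Rightarrow> complex mat) \<Rightarrow> bool" where
  "irreducible_rep G d \<rho> \<longleftrightarrow> d > 0 \<and> representation G d \<rho> \<and>
     (\<forall>W. invariant_subspace G d \<rho> W \<longrightarrow> W = {0\<^sub>v d} \<or> W = carrier_vec d)"

definition Irr :: "('a, 'b) monoid_scheme \<Rightarrow> ('a \<Rightarrow> complex) set" where
  "Irr G = {\<chi>. \<exists>d \<rho>. irreducible_rep G d \<rho> \<and>
              \<chi> = (\<lambda>g. if g \<in> carrier G then mat_trace (\<rho> g) else 0)}"

definition char_center :: "('a, 'b) monoid_scheme \<Rightarrow> ('a \<Rightarrow> complex) \<Rightarrow> 'a set" where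
  "char_center G \<chi> = {g \<in> carrier G. complex_of_real (cmod (\<chi> g)) = \<chi> \<one>\<^bsub>G\<^esub>}"

definition nested :: "('a, 'b) monoid_scheme \<Rightarrow> bool" where
  "nested G \<longleftrightarrow> (\<forall>\<chi> \<in> Irr G. \<forall>\<psi> \<in> Irr G.
     char_center G \<chi> \<subseteq> char_center G \<psi> \<or> char_center G \<psi> \<subseteq> char_center G \<chi>)"

definition chain_of_centers :: "('a, 'b) monoid_scheme \<Rightarrow> (nat \<Rightarrow> 'a set) \<Rightarrow> nat \<Rightarrow> bool" where
  "chain_of_centers G C n \<longleftrightarrow> C 0 = carrier G \<and> (\<forall>i < n. C (Suc i) \<subset> C i) \<and>
     C ` {..n} = char_center G ` Irr G"

definition sg_index :: "'a set \<Rightarrow> 'a set \<Rightarrow> nat" where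
  "sg_index H K = card H div card K"

definition is_square :: "nat \<Rightarrow> bool" where
  "is_square m \<longleftrightarrow> (\<exists>k. m = k ^ 2)"

end

theory Submission
  imports Defs "HOL-Number_Theory.Number_Theory"
    "Jordan_Normal_Form.Schur_Decomposition" "Jordan_Normal_Form.Spectral_Radius"
begin

text \<open>Representation theory enters only through two facts: an irreducible character \<open>\<chi>\<close> with
  kernel \<open>K\<close> has center \<open>Z(\<chi>) = {g. [g, G] \<le> K}\<close>, on which it acts by a linear character with
  kernel \<open>K\<close>; and irreducible characters separate normal subgroups from elements. Hence, for a
  chain of centers \<open>X\<^sub>0 > \<dots> > X\<^sub>n\<close> and \<open>N \<lhd> G\<close> with \<open>[X\<^sub>i, G] \<not>\<le> N\<close>, the center of
  \<open>G / N\<close> lies in \<open>X\<^bsub>i+1\<^esub> / N\<close>. As nontrivial \<open>p\<close>-groups have nontrivial centers,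
  \<open>[X\<^sub>i, G] \<le> X\<^bsub>i+1\<^esub>\<close>, and \<open>X\<^sub>i / X\<^bsub>i+1\<^esub>\<close> has exponent \<open>p\<close>.

  If \<open>G' \<le> Z(\<chi>)\<close>, the linear character of \<open>\<chi>\<close> turns commutators into an alternating pairing with
  radical \<open>Z(\<chi>)\<close>. A maximal isotropic set is its own annihilator \<open>A\<close>, and counting gives
  \<open>|A|\<^sup>2 = |G| |Z(\<chi>)|\<close>; so \<open>|G : Z(\<chi>)|\<close> is a square.

  For the last part let \<open>Y = X\<^sub>2G'\<close>. The centralizer \<open>R\<close> of \<open>Y\<close> modulo the kernel of a character
  with center \<open>X\<^sub>2\<close> satisfies \<open>|G : R| = |Y : X\<^sub>2|\<close> and, by the Hall--Witt identity,
  \<open>[R, R] \<le> X\<^sub>2\<close>; so \<open>R\<close> is isotropic for a pairing with radical \<open>X\<^sub>1\<close>, whence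
  \<open>|G : X\<^sub>1| \<le> |Y : X\<^sub>2|\<^sup>2 \<le> |G' : [X\<^sub>1, G]|\<^sup>2\<close>. Conversely
  \<open>|G' : [X\<^sub>1, G]|\<^sup>2 \<le> |G : X\<^sub>1|\<close> (Macdonald): otherwise the Pfaffian of the pencil of
  commutator forms on \<open>G / X\<^sub>1\<close> has more variables than its degree, hence a nontrivial zero
  modulo \<open>p\<close>, although all nonzero forms of the pencil are nondegenerate. The quotient by a
  complement \<open>A / X\<^sub>2\<close> of \<open>Y / X\<^sub>2\<close> in \<open>X\<^sub>1 / X\<^sub>2\<close> is ultraspecial.\<close>

section \<open>Pfaffians modulo a prime\<close>

text \<open>The factor 2 in the bound for the order of \<open>G' / [X_1, G]\<close> decides the last
  part. The determinant of the pencil has as its degree the full dimension of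
  \<open>G / X_1\<close>, so the same zero count would bound the dimension of
  \<open>G' / [X_1, G]\<close> only by that of \<open>G / X_1\<close>. The Pfaffian has half this
  degree. Nondegeneracy is turned into a nonzero Pfaffian directly, without comparing the
  determinant with the square of the Pfaffian. Forms over the field with \<open>p\<close> elements
  are integer valued functions up to congruence. Antisymmetry over the integers forces a zero
  diagonal, so \<open>p = 2\<close> is no exception. On the side of characters, neither complete
  reducibility nor the orthogonality of irreducible characters is used. Two facts stand in for them:
  a representation that moves an element has an irreducible constituent moving it, and a character
  value of maximal modulus comes from a scalar matrix. Both rest on a single observation: a complex
  matrix of finite order has no nontrivial Jordan block.\<close>

definition del :: "nat \<Rightarrow> 'a list \<Rightarrow> 'a list" where
  "del j xs = take j xs @ drop (Suc j) xs"

lemma length_del [simp]: "j < length xs \<Longrightarrow> length (del j xs) = length xs - 1"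
  by (auto simp: del_def)

lemma length_del_le: "length (del j xs) \<le> length xs"
  by (auto simp: del_def)

lemma nth_del: "j < length xs \<Longrightarrow> k < length xs - 1 \<Longrightarrow> del j xs ! k = xs ! (if k < j then k else Suc k)"
  by (auto simp: del_def nth_append)

lemma del_Cons [simp]: "del 0 (x # xs) = xs" "del (Suc j) (x # xs) = x # del j xs"
  by (auto simp: del_def)

lemma del_append: "del (length vs + i) (vs @ ws) = vs @ del i ws"
  by (auto simp: del_def)

lemma del_del: "k < i \<Longrightarrow> i < length xs \<Longrightarrow> del k (del i xs) = del (i - 1) (del k xs)"
  by (rule nth_equalityI) (auto simp: nth_del)

text \<open>The Pfaffian of the matrix of \<open>B\<close> on a list of indices, expanded along its
  first row. Each step uses up two indices and one factor \<open>B\<close>, so a list of odd length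
  gives 0.\<close>

function pf :: "('v \<Rightarrow> 'v \<Rightarrow> int) \<Rightarrow> 'v list \<Rightarrow> int" where
  "pf B [] = 1"
| "pf B (x # xs) = (\<Sum>j<length xs. (-1) ^ j * B x (xs ! j) * pf B (del j xs))"
  by pat_completeness auto
termination by (relation "measure (length \<circ> snd)") (auto simp: less_Suc_eq_le length_del_le)

declare pf.simps(2) [simp del]

lemma sum_lessThan_add:
  fixes f :: "nat \<Rightarrow> int"
  shows "(\<Sum>j<u + k. f j) = (\<Sum>j<u. f j) + (\<Sum>i<k. f (u + i))"
  by (induction k) auto

text \<open>Expanding along both rows pairs \<open>a\<close> and \<open>b\<close> with each other or
  with two entries of \<open>ys\<close>. Every pair of entries occurs twice, with the roles of
  \<open>a\<close> and \<open>b\<close> exchanged and opposite signs.\<close>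

lemma pf_swap_head:
  assumes anti: "\<And>x y. B x y = - B y x"
  shows "pf B (a # b # ys) = - pf B (b # a # ys)"
proof (cases "ys = []")
  case True
  then show ?thesis using anti[of a b] by (simp add: pf.simps)
next
  case False
  define l where "l = length ys"
  have l: "l > 0" using False by (simp add: l_def)
  define P where "P k i = pf B (del k (del i ys))" for k i
  \<comment> \<open>The terms in which the partner of \<open>a\<close> stands behind that of
    \<open>b\<close> in \<open>ys\<close>. The terms in the other order add up to
    \<open>- E b a\<close>, so the difference changes sign when \<open>a\<close> and
    \<open>b\<close> are exchanged.\<close>
  define E where "E a b = (\<Sum>i<l. \<Sum>k<i. (-1) ^ (i + k) * B a (ys ! i) * B b (ys ! k) * P k i)" for a b
  have D: "pf B (a # b # ys) = B a b * pf B ys - (E a b - E b a)" for a b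
  proof -
    define g where "g i k = (-1) ^ (i + k) * B a (ys ! i) * B b (del i ys ! k) * P k i" for i k
    have "pf B (a # b # ys) = B a b * pf B ys + (\<Sum>i<l. - ((-1) ^ i * B a (ys ! i) * pf B (b # del i ys)))"
      unfolding pf.simps(2)[of B a "b # ys"] l_def list.size add_0_right add_Suc_right sum.lessThan_Suc_shift
      by (simp del: pf.simps)
    also have "(\<Sum>i<l. - ((-1) ^ i * B a (ys ! i) * pf B (b # del i ys))) = (\<Sum>i<l. - (\<Sum>k<l - 1. g i k))"
      by (intro sum.cong refl)
         (simp add: l_def g_def P_def pf.simps sum_distrib_left power_add mult_ac)
    also have "\<dots> = - (\<Sum>i<l. (\<Sum>k<i. g i k) + (\<Sum>k\<in>{i..<l - 1}. g i k))"
    proof -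
      have eq: "(\<Sum>k<l - 1. g i k) = (\<Sum>k<i. g i k) + (\<Sum>k\<in>{i..<l - 1}. g i k)" if i: "i \<in> {..<l}" for i
      proof -
        have "{..<l - 1} = {..<i} \<union> {i..<l - 1}" using i by auto
        then show ?thesis using i by (simp add: sum.union_disjoint[symmetric] ivl_disj_int)
      qed
      show ?thesis
        by (simp only: sum_negf, rule arg_cong[where f = uminus], rule sum.cong[OF refl], rule eq)
    qed
    also have "\<dots> = - ((\<Sum>i<l. \<Sum>k<i. g i k) + (\<Sum>i<l. \<Sum>k\<in>{i..<l - 1}. g i k))"
      by (simp add: sum.distrib)
    also have "(\<Sum>i<l. \<Sum>k<i. g i k) = E a b"
      unfolding E_def by (intro sum.cong refl) (simp add: g_def nth_del l_def)
    \<comment> \<open>Here \<open>k\<close> counts positions in \<open>del i ys\<close>, where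
      everything behind \<open>i\<close> has moved down by one. Returning to positions in
      \<open>ys\<close> shifts the parity, which is the source of the minus sign.\<close>
    also have "(\<Sum>i<l. \<Sum>k\<in>{i..<l - 1}. g i k) = (\<Sum>i<l. \<Sum>k\<in>{Suc i..l - 1}. g i (k - 1))"
    proof (rule sum.cong[OF refl])
      fix i assume "i \<in> {..<l}"
      show "(\<Sum>k\<in>{i..<l - 1}. g i k) = (\<Sum>k\<in>{Suc i..l - 1}. g i (k - 1))"
        by (rule sum.reindex_bij_witness[of _ "\<lambda>k. k - 1" Suc]) auto
    qed
    also have "\<dots> = (\<Sum>i<l. \<Sum>k\<in>{Suc i..l - 1}. - ((-1) ^ (k + i) * B b (ys ! k) * B a (ys ! i) * P i k))"
    proof (intro sum.cong refl)
      fix i k assume ik: "i \<in> {..<l}" "k \<in> {Suc i..l - 1}"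
      have dd: "del i (del k ys) = del (k - 1) (del i ys)"
        by (rule del_del) (use ik l_def in auto)
      have "(-1::int) ^ (i + (k - 1)) = - ((-1) ^ (k + i))"
      proof -
        have "k + i = Suc (i + (k - 1))" using ik by auto
        then show ?thesis by (simp only: power_Suc)
      qed
      moreover have "del i ys ! (k - 1) = ys ! k"
        using ik by (subst nth_del) (auto simp: l_def)
      ultimately show "g i (k - 1) = - ((-1) ^ (k + i) * B b (ys ! k) * B a (ys ! i) * P i k)"
        unfolding g_def P_def dd by simp
    qed
    also have "\<dots> = (\<Sum>i<l - 1. \<Sum>k\<in>{Suc i..l - 1}. - ((-1) ^ (k + i) * B b (ys ! k) * B a (ys ! i) * P i k))"
    proof -
      have "{..<l} = insert (l - 1) {..<l - 1}" using l by auto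
      then show ?thesis using l by simp
    qed
    also have "\<dots> = (\<Sum>k\<le>l - 1. \<Sum>i<k. - ((-1) ^ (k + i) * B b (ys ! k) * B a (ys ! i) * P i k))"
      by (rule sum.nested_swap'[symmetric])
    also have "\<dots> = - E b a"
    proof -
      have "{..l - 1} = {..<l}" using l by auto
      then show ?thesis by (simp add: E_def sum_negf)
    qed
    finally show ?thesis by simp
  qed
  show ?thesis using D[of a b] D[of b a] anti[of a b] by simp
qed

text \<open>Induction on the prefix, expanding along its first element. If neither \<open>a\<close>
  nor \<open>b\<close> is the partner, both survive as neighbours and the induction hypothesis
  applies. The two terms where one of them is the partner have opposite signs and change
  places.\<close>

lemma pf_swap:
  assumes anti: "\<And>x y. B x y = - B y x"
  shows "pf B (us @ a # b # ys) = - pf B (us @ b # a # ys)"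
proof (induction "length us" arbitrary: us ys rule: less_induct)
  case less
  show ?case
  proof (cases us)
    case Nil
    then show ?thesis using pf_swap_head[OF anti] by simp
  next
    case (Cons x vs)
    define u where "u = length vs"
    define t where "t = length ys"
    have expand: "pf B (us @ a # b # ys) =
        (\<Sum>j<u. (-1) ^ j * B x (vs ! j) * pf B (del j vs @ a # b # ys))
        + ((-1) ^ u * B x a * pf B (vs @ b # ys) + (- ((-1) ^ u * B x b * pf B (vs @ a # ys))
        + (\<Sum>i<t. (-1) ^ (u + Suc (Suc i)) * B x (ys ! i) * pf B (vs @ a # b # del i ys))))" for a b
    proof -
      have da: "del (length vs) (vs @ a # b # ys) = vs @ b # ys"
        "del (Suc (length vs)) (vs @ a # b # ys) = vs @ a # ys"
        "del (Suc (Suc (length vs + i))) (vs @ a # b # ys) = vs @ a # b # del i ys" for i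
        using del_append[of vs 0 "a # b # ys"] del_append[of vs "Suc 0" "a # b # ys"]
          del_append[of vs "Suc (Suc i)" "a # b # ys"] by simp_all
      have len: "length (vs @ a # b # ys) = u + Suc (Suc t)" by (simp add: u_def t_def)
      have "pf B (us @ a # b # ys) = (\<Sum>j<u + Suc (Suc t). (-1) ^ j * B x ((vs @ a # b # ys) ! j) * pf B (del j (vs @ a # b # ys)))"
        unfolding len[symmetric] using Cons by (simp add: pf.simps(2))
      also have "\<dots> = (\<Sum>j<u. (-1) ^ j * B x ((vs @ a # b # ys) ! j) * pf B (del j (vs @ a # b # ys)))
         + (\<Sum>i<Suc (Suc t). (-1) ^ (u + i) * B x ((vs @ a # b # ys) ! (u + i)) * pf B (del (u + i) (vs @ a # b # ys)))"
        by (rule sum_lessThan_add)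
      also have "(\<Sum>j<u. (-1) ^ j * B x ((vs @ a # b # ys) ! j) * pf B (del j (vs @ a # b # ys)))
        = (\<Sum>j<u. (-1) ^ j * B x (vs ! j) * pf B (del j vs @ a # b # ys))"
        by (intro sum.cong refl) (auto simp: u_def nth_append del_def)
      also have "(\<Sum>i<Suc (Suc t). (-1) ^ (u + i) * B x ((vs @ a # b # ys) ! (u + i)) * pf B (del (u + i) (vs @ a # b # ys)))
        = ((-1) ^ u * B x a * pf B (vs @ b # ys) + (- ((-1) ^ u * B x b * pf B (vs @ a # ys))
        + (\<Sum>i<t. (-1) ^ (u + Suc (Suc i)) * B x (ys ! i) * pf B (vs @ a # b # del i ys))))"
        unfolding sum.lessThan_Suc_shift
        by (simp add: u_def nth_append da)
      finally show ?thesis .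
    qed
    have 1: "(\<Sum>j<u. (-1) ^ j * B x (vs ! j) * pf B (del j vs @ a # b # ys)) =
       - (\<Sum>j<u. (-1) ^ j * B x (vs ! j) * pf B (del j vs @ b # a # ys))"
      unfolding sum_negf[symmetric]
    proof (intro sum.cong refl)
      fix j assume "j \<in> {..<u}"
      then have "length (del j vs) < length us" using Cons by (auto simp: u_def)
      from less[OF this, of ys]
      show "(-1) ^ j * B x (vs ! j) * pf B (del j vs @ a # b # ys) = - ((-1) ^ j * B x (vs ! j) * pf B (del j vs @ b # a # ys))"
        by simp
    qed
    have 2: "(\<Sum>i<t. (-1) ^ (u + Suc (Suc i)) * B x (ys ! i) * pf B (vs @ a # b # del i ys)) =
      - (\<Sum>i<t. (-1) ^ (u + Suc (Suc i)) * B x (ys ! i) * pf B (vs @ b # a # del i ys))"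
      unfolding sum_negf[symmetric]
    proof (intro sum.cong refl)
      fix i
      have "length vs < length us" using Cons by simp
      from less[OF this, of "del i ys"]
      show "(-1) ^ (u + Suc (Suc i)) * B x (ys ! i) * pf B (vs @ a # b # del i ys) =
        - ((-1) ^ (u + Suc (Suc i)) * B x (ys ! i) * pf B (vs @ b # a # del i ys))"
        by simp
    qed
    show ?thesis unfolding expand[of a b] expand[of b a] 1 2 by simp
  qed
qed

text \<open>Absolute values absorb the sign of the permutation; later only divisibility by
  \<open>p\<close> matters.\<close>

lemma abs_pf_move:
  assumes anti: "\<And>x y. B x y = - B y x"
  shows "\<bar>pf B (ws @ us @ x # ys)\<bar> = \<bar>pf B (ws @ x # us @ ys)\<bar>"
proof (induction us arbitrary: ws)
  case (Cons u us)
  have "\<bar>pf B (ws @ (u # us) @ x # ys)\<bar> = \<bar>pf B (ws @ u # x # us @ ys)\<bar>"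
    using Cons[of "ws @ [u]"] by simp
  also have "\<dots> = \<bar>pf B (ws @ x # u # us @ ys)\<bar>"
    using pf_swap[where B = B and us = ws and a = u and b = x, OF anti] by simp
  finally show ?case by simp
qed simp

lemma abs_pf_mset:
  assumes anti: "\<And>x y. B x y = - B y x"
  shows "mset xs = mset ys \<Longrightarrow> \<bar>pf B (ws @ xs)\<bar> = \<bar>pf B (ws @ ys)\<bar>"
proof (induction xs arbitrary: ys ws)
  case (Cons x xs)
  then have "x \<in> set ys" by (metis list.set_intros(1) set_mset_mset)
  then obtain us vs where ys: "ys = us @ x # vs" by (meson split_list)
  have "mset xs = mset (us @ vs)" using Cons.prems ys by simp
  from Cons.IH[OF this, of "ws @ [x]"] show ?case
    using abs_pf_move[where B = B and ws = ws and us = us and x = x and ys = vs, OF anti] ys by simp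
qed simp

text \<open>With the two equal indices moved to the front, the swap makes the Pfaffian its own
  negative, which over the integers means 0.\<close>

lemma pf_repeated:
  assumes anti: "\<And>x y. B x y = - B y x" and "i \<in> set J"
  shows "pf B (i # J) = 0"
proof -
  obtain us vs where J: "J = us @ i # vs" using assms(2) by (meson split_list)
  have "pf B (i # i # us @ vs) = 0"
    using pf_swap_head[of B i i "us @ vs", OF anti] by simp
  then show ?thesis using abs_pf_move[where B = B and ws = "[i]" and us = us and x = i and ys = vs, OF anti] J by simp
qed

text \<open>Take a longest list of distinct indices whose Pfaffian is not divisible by
  \<open>p\<close>. If it misses an index \<open>a\<close>, nondegeneracy applied to a vector of
  sub-Pfaffians supplies one more index \<open>v\<close> such that prepending both \<open>v\<close>
  and \<open>a\<close> keeps the Pfaffian nonzero modulo \<open>p\<close>, against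
  maximality.\<close>

lemma pf_nondegenerate:
  fixes B :: "nat \<Rightarrow> nat \<Rightarrow> int" and p :: int
  assumes anti: "\<And>x y. B x y = - B y x" and p: "\<not> p dvd 1"
    and nd: "\<And>x. \<exists>i<n. \<not> p dvd x i \<Longrightarrow> \<exists>j<n. \<not> p dvd (\<Sum>i<n. x i * B j i)"
  shows "\<not> p dvd pf B [0..<n]"
proof -
  define S where "S = {l. distinct l \<and> set l \<subseteq> {..<n} \<and> \<not> p dvd pf B l}"
  have len: "length l \<le> n" if "l \<in> S" for l
  proof -
    have "length l = card (set l)" using that by (simp add: S_def distinct_card)
    also have "\<dots> \<le> card {..<n}" using that by (intro card_mono) (auto simp: S_def)
    finally show ?thesis by simp
  qed
  have "[] \<in> S" using p by (simp add: S_def)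
  moreover have "\<forall>y. y \<in> S \<longrightarrow> length y < Suc n" using len by (simp add: less_Suc_eq_le)
  ultimately have "\<exists>l. l \<in> S \<and> (\<forall>y. y \<in> S \<longrightarrow> length y \<le> length l)"
    by (rule ex_has_greatest_nat[of "\<lambda>l. l \<in> S" "[]" length "Suc n"])
  then obtain l where l: "l \<in> S" "\<And>l'. l' \<in> S \<Longrightarrow> length l' \<le> length l" by blast
  show ?thesis
  proof (cases "set l = {..<n}")
    case True
    have "set l = set [0..<n]" using True by (simp add: atLeast0LessThan)
    moreover have "distinct l" using l(1) by (simp add: S_def)
    ultimately have "mset l = mset [0..<n]"
      using set_eq_iff_mset_eq_distinct[of l "[0..<n]"] distinct_upt by blast
    from abs_pf_mset[where B = B and ws = "[]", OF anti this]
    have "\<bar>pf B l\<bar> = \<bar>pf B [0..<n]\<bar>" by simp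
    then have "p dvd pf B l \<longleftrightarrow> p dvd pf B [0..<n]"
      using dvd_abs_iff[of p "pf B l"] dvd_abs_iff[of p "pf B [0..<n]"] by (simp only:)
    then show ?thesis using l(1) by (simp add: S_def)
  next
    case False
    then obtain a where a: "a < n" "a \<notin> set l" using l(1) by (auto simp: S_def)
    define J where "J = a # l"
    \<comment> \<open>The signed Pfaffians of \<open>J\<close> with one entry removed. Expansion
      along a new first element \<open>v\<close> is exactly the pairing of \<open>v\<close> with
      \<open>x\<close>, and the coordinate at \<open>a\<close> is \<open>pf B l\<close>, because
      \<open>a\<close> occurs in \<open>J\<close> only at the front.\<close>
    define x where "x i = (\<Sum>j<length J. if J ! j = i then (-1) ^ j * pf B (del j J) else 0)" for i
    have Jn: "J ! j < n" if "j < length J" for j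
      using that l(1) a nth_mem[OF that] by (auto simp: J_def S_def)
    have xB: "(\<Sum>i<n. x i * B v i) = pf B (v # J)" for v
    proof -
      have "(\<Sum>i<n. x i * B v i) = (\<Sum>i<n. \<Sum>j<length J. if J ! j = i then (-1) ^ j * pf B (del j J) * B v i else 0)"
        unfolding x_def sum_distrib_right by (intro sum.cong refl) auto
      also have "\<dots> = (\<Sum>j<length J. \<Sum>i<n. if J ! j = i then (-1) ^ j * pf B (del j J) * B v i else 0)"
        by (rule sum.swap)
      also have "\<dots> = (\<Sum>j<length J. (-1) ^ j * pf B (del j J) * B v (J ! j))"
        by (intro sum.cong refl) (simp add: Jn)
      finally show ?thesis by (simp add: pf.simps(2) mult_ac)
    qed
    have "x a = pf B l"
    proof -
      have "x a = (\<Sum>j<length J. if j = 0 then pf B l else 0)"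
        unfolding x_def
      proof (intro sum.cong refl)
        fix j assume j: "j \<in> {..<length J}"
        show "(if J ! j = a then (-1) ^ j * pf B (del j J) else 0) = (if j = 0 then pf B l else 0)"
        proof (cases j)
          case 0 then show ?thesis by (simp add: J_def del_def)
        next
          case (Suc j')
          then have "l ! j' \<in> set l" using j by (simp add: J_def)
          then show ?thesis using a Suc by (auto simp: J_def)
        qed
      qed
      then show ?thesis by (simp add: J_def)
    qed
    then have "\<exists>i<n. \<not> p dvd x i" using a(1) l(1) by (auto simp: S_def)
    from nd[OF this] obtain v where v: "v < n" "\<not> p dvd pf B (v # J)"
      unfolding xB by auto
    have "v \<notin> set J"
    proof
      assume "v \<in> set J"
      then have "pf B (v # J) = 0" by (rule pf_repeated[OF anti])
      then show False using v(2) by simp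
    qed
    then have "v # J \<in> S" using v a l(1) by (auto simp: S_def J_def)
    from l(2)[OF this] show ?thesis by (simp add: J_def)
  qed
qed

section \<open>The Chevalley--Warning argument\<close>

text \<open>Functions given by integer polynomials of degree at most \<open>d\<close> in the
  coordinates below \<open>s\<close>. Sums of monomials are the form in which a sum over a grid
  factorizes, and an upper bound on the degree is all that is compared.\<close>

inductive polyf :: "nat \<Rightarrow> nat \<Rightarrow> ((nat \<Rightarrow> int) \<Rightarrow> int) \<Rightarrow> bool" for s d where
  monomial: "(\<Sum>k<s. a k) \<le> d \<Longrightarrow> polyf s d (\<lambda>x. c * (\<Prod>k<s. x k ^ a k))"
| add: "polyf s d f \<Longrightarrow> polyf s d g \<Longrightarrow> polyf s d (\<lambda>x. f x + g x)"

lemma polyf_const: "polyf s d (\<lambda>x. c)"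
  using polyf.monomial[where a = "\<lambda>_. 0" and c = c and s = s and d = d] by simp

lemma polyf_mono: "polyf s d f \<Longrightarrow> d \<le> d' \<Longrightarrow> polyf s d' f"
  by (induction rule: polyf.induct) (auto intro: polyf.intros)

lemma polyf_mult_monomial:
  "polyf s d f \<Longrightarrow> (\<Sum>k<s. a k) \<le> d' \<Longrightarrow> polyf s (d + d') (\<lambda>x. f x * (c * (\<Prod>k<s. x k ^ a k)))"
proof (induction rule: polyf.induct)
  case (monomial b e)
  have "polyf s (d + d') (\<lambda>x. (e * c) * (\<Prod>k<s. x k ^ (b k + a k)))"
    using monomial by (intro polyf.monomial) (simp add: sum.distrib)
  then show ?case by (simp add: power_add prod.distrib mult_ac)
next
  case (add f g)
  then show ?case using polyf.add by (simp add: distrib_right)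
qed

lemma polyf_mult:
  assumes "polyf s d f"
  shows "polyf s d' g \<Longrightarrow> polyf s (d + d') (\<lambda>x. f x * g x)"
proof (induction rule: polyf.induct)
  case (monomial b e)
  then show ?case by (rule polyf_mult_monomial[OF assms])
next
  case (add f g)
  then show ?case using polyf.add by (simp add: distrib_left)
qed

lemma polyf_sum:
  "finite A \<Longrightarrow> (\<And>i. i \<in> A \<Longrightarrow> polyf s d (f i)) \<Longrightarrow> polyf s d (\<lambda>x. \<Sum>i\<in>A. f i x)"
  by (induction rule: finite_induct) (auto intro: polyf_const polyf.add)

lemma polyf_power: "polyf s d f \<Longrightarrow> polyf s (d * k) (\<lambda>x. f x ^ k)"
proof (induction k)
  case (Suc k)
  then show ?case using polyf_mult[of s d f "d * k"] by simp
qed (simp add: polyf_const)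

lemma polyf_var: "k < s \<Longrightarrow> polyf s 1 (\<lambda>x. x k)"
proof -
  assume k: "k < s"
  have "(\<Prod>i<s. x i ^ (if i = k then 1 else 0)) = (\<Prod>i<s. if i = k then x k else 1)" for x :: "nat \<Rightarrow> int"
    by (intro prod.cong) auto
  then show ?thesis
    using polyf.monomial[where a = "\<lambda>i. if i = k then 1 else 0" and c = 1 and s = s and d = 1] k by simp
qed

lemma polyf_linear: "polyf s 1 (\<lambda>x. \<Sum>k<s. x k * c k)"
proof (intro polyf_sum finite_lessThan)
  fix k assume "k \<in> {..<s}"
  then show "polyf s 1 (\<lambda>x. x k * c k)"
    using polyf_mult[OF polyf_var[of k s] polyf_const[where c = "c k" and d = 0]] by simp
qed

text \<open>One expansion step contributes a single linear factor and removes two indices, which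
  halves the degree.\<close>

lemma polyf_pf:
  assumes "\<And>u v. polyf s 1 (\<lambda>x. B x u v)"
  shows "polyf s (length l div 2) (\<lambda>x. pf (B x) l)"
proof (induction "length l" arbitrary: l rule: less_induct)
  case less
  show ?case
  proof (cases l)
    case Nil
    then show ?thesis by (simp add: polyf_const)
  next
    case (Cons a xs)
    have "polyf s (length l div 2) (\<lambda>x. \<Sum>j<length xs. (-1) ^ j * B x a (xs ! j) * pf (B x) (del j xs))"
    proof (intro polyf_sum finite_lessThan)
      fix j assume j: "j \<in> {..<length xs}"
      have "polyf s (length (del j xs) div 2) (\<lambda>x. pf (B x) (del j xs))"
        using j Cons by (intro less) auto
      moreover have "polyf s 1 (\<lambda>x. (-1) ^ j * B x a (xs ! j))"
        using polyf_mult[OF polyf_const[where c = "(-1) ^ j" and d = 0] assms] by simp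
      ultimately have "polyf s (1 + length (del j xs) div 2) (\<lambda>x. (-1) ^ j * B x a (xs ! j) * pf (B x) (del j xs))"
        by (rule polyf_mult[rotated])
      then show "polyf s (length l div 2) (\<lambda>x. (-1) ^ j * B x a (xs ! j) * pf (B x) (del j xs))"
        using j Cons by (elim polyf_mono) auto
    qed
    then show ?thesis using Cons by (simp add: pf.simps(2))
  qed
qed

text \<open>Telescoping \<open>(t + 1) ^ (a + 1) - t ^ (a + 1)\<close> and expanding binomially
  expresses \<open>(a + 1)\<close> times the power sum through lower power sums and a power of
  \<open>p\<close>. The factor \<open>a + 1 < p\<close> can be cancelled modulo
  \<open>p\<close>.\<close>

lemma prime_dvd_power_sum:
  fixes p :: nat
  assumes p: "Factorial_Ring.prime p"
  shows "a < p - 1 \<Longrightarrow> int p dvd (\<Sum>t<p. int t ^ a)"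
proof (induction a rule: less_induct)
  case (less a)
  define S where "S k = (\<Sum>t<p. int t ^ k)" for k
  have "int p ^ Suc a = (\<Sum>t<p. int (Suc t) ^ Suc a - int t ^ Suc a)"
    by (subst sum_lessThan_telescope[where f = "\<lambda>t. int t ^ Suc a"]) simp
  also have "\<dots> = (\<Sum>t<p. \<Sum>k<Suc a. int (Suc a choose k) * int t ^ k)"
  proof (intro sum.cong refl)
    fix t
    have "int (Suc t) ^ Suc a = (\<Sum>k\<le>Suc a. int (Suc a choose k) * int t ^ k)"
      using binomial_ring[of "int t" 1 "Suc a"] by (simp add: add.commute)
    then show "int (Suc t) ^ Suc a - int t ^ Suc a = (\<Sum>k<Suc a. int (Suc a choose k) * int t ^ k)"
      by (simp add: lessThan_Suc_atMost del: binomial_Suc_Suc)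
  qed
  also have "\<dots> = (\<Sum>k<Suc a. int (Suc a choose k) * S k)"
    by (subst sum.swap) (simp add: S_def sum_distrib_left)
  finally have eq: "int p ^ Suc a = (\<Sum>k<a. int (Suc a choose k) * S k) + int (Suc a) * S a"
    by (simp del: binomial_Suc_Suc)
  have "int p dvd (\<Sum>k<a. int (Suc a choose k) * S k)"
    using less by (intro dvd_sum dvd_mult) (auto simp: S_def)
  moreover have "int p dvd int p ^ Suc a" by simp
  ultimately have "int p dvd int (Suc a) * S a"
    using eq by (metis dvd_add_right_iff)
  moreover have "\<not> int p dvd int (Suc a)"
    using less.prems by (auto dest: dvd_imp_le simp del: of_nat_Suc)
  ultimately show ?case
    using p by (simp add: prime_dvd_mult_iff S_def del: of_nat_Suc)
qed

text \<open>Ax's lemma, the heart of the Chevalley--Warning theorem.\<close>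

lemma polyf_sum_dvd:
  assumes p: "Factorial_Ring.prime p" and "polyf s d f" and "d < s * (p - 1)"
  shows "int p dvd (\<Sum>x\<in>{..<s} \<rightarrow>\<^sub>E int ` {..<p}. f x)"
  using assms(2)
proof (induction rule: polyf.induct)
  case (monomial a c)
  \<comment> \<open>Exponents that add up to less than \<open>s * (p - 1)\<close> leave some
    variable with exponent below \<open>p - 1\<close>. Its power sum is a factor of the sum over the
    grid and vanishes modulo \<open>p\<close>.\<close>
  have "\<exists>k<s. a k < p - 1"
  proof (rule ccontr)
    assume "\<not> ?thesis"
    then have "(\<Sum>k<s. p - 1) \<le> (\<Sum>k<s. a k)" by (intro sum_mono) auto
    then show False using monomial assms(3) by simp
  qed
  then obtain k where k: "k < s" "a k < p - 1" by auto
  have "(\<Sum>x\<in>{..<s} \<rightarrow>\<^sub>E int ` {..<p}. c * (\<Prod>k<s. x k ^ a k)) = c * (\<Prod>k<s. \<Sum>t\<in>int ` {..<p}. t ^ a k)"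
    by (subst prod_sum_PiE) (auto simp: sum_distrib_left)
  moreover have "int p dvd (\<Sum>t\<in>int ` {..<p}. t ^ a k)"
    using prime_dvd_power_sum[OF p k(2)] by (simp add: sum.reindex)
  moreover have "(\<Sum>t\<in>int ` {..<p}. t ^ a k) dvd (\<Prod>k<s. \<Sum>t\<in>int ` {..<p}. t ^ a k)"
    using k(1) by (intro dvd_prodI[where f = "\<lambda>k. \<Sum>t\<in>int ` {..<p}. t ^ a k"]) auto
  ultimately show ?case by (simp only: dvd_trans dvd_mult)
next
  case (add f g)
  then show ?case by (simp add: sum.distrib)
qed

lemma fermat_theorem_int:
  fixes a :: int
  assumes "Factorial_Ring.prime p" and "\<not> int p dvd a"
  shows "[a ^ (p - 1) = 1] (mod int p)"
proof -
  define b where "b = nat (a mod int p)"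
  have p0: "p > 0" using assms(1) by (rule prime_gt_0_nat)
  have b: "int b = a mod int p" using p0 by (simp add: b_def)
  have "int p dvd int b \<longleftrightarrow> int p dvd a"
    unfolding b by (rule dvd_mod_iff) (rule dvd_refl)
  then have "\<not> p dvd b" using assms(2) by (simp only: int_dvd_int_iff simp_thms)
  then have "[b ^ (p - 1) = 1] (mod p)" by (rule fermat_theorem[OF assms(1)])
  then have "[int b ^ (p - 1) = 1] (mod int p)"
    by (metis cong_int_iff of_nat_1 of_nat_power)
  moreover have "[a = int b] (mod int p)" unfolding b cong_def by simp
  ultimately show ?thesis by (meson cong_pow cong_trans)
qed

text \<open>By Fermat, the power \<open>p - 1\<close> of the Pfaffian is 1 modulo \<open>p\<close>
  at every nonzero point of the pencil, and it is 0 at the origin. Its sum over the grid is thus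
  congruent to \<open>p ^ s - 1\<close>, whereas Ax's lemma makes it divisible by \<open>p\<close>
  as soon as the degree bound \<open>(n div 2) * (p - 1)\<close> is below
  \<open>s * (p - 1)\<close>.\<close>

lemma nondegenerate_pencil_bound:
  fixes c :: "nat \<Rightarrow> nat \<Rightarrow> nat \<Rightarrow> int" and p n s :: nat
  assumes p: "Factorial_Ring.prime p" and n: "n > 0"
    and anti: "\<And>k i j. c k i j = - c k j i"
    and nd: "\<And>l x. \<exists>k<s. \<not> int p dvd l k \<Longrightarrow> \<exists>i<n. \<not> int p dvd x i \<Longrightarrow>
               \<exists>j<n. \<not> int p dvd (\<Sum>i<n. x i * (\<Sum>k<s. l k * c k j i))"
  shows "2 * s \<le> n"
proof (rule ccontr)
  assume "\<not> ?thesis"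
  then have s: "n div 2 < s" by simp
  define B where "B l i j = (\<Sum>k<s. l k * c k i j)" for l :: "nat \<Rightarrow> int" and i j
  define F where "F l = pf (B l) [0..<n] ^ (p - 1)" for l
  define \<Lambda> where "\<Lambda> = {..<s} \<rightarrow>\<^sub>E int ` {..<p}"
  define z where "z = restrict (\<lambda>_. 0::int) {..<s}"
  have p1: "p > 1" using p by (rule prime_gt_1_nat)
  have "polyf s 1 (\<lambda>x. B x u v)" for u v
    unfolding B_def by (rule polyf_linear)
  from polyf_pf[OF this, where l = "[0..<n]"] have "polyf s ((n div 2) * (p - 1)) F"
    unfolding F_def by (intro polyf_power) simp
  then have "int p dvd (\<Sum>x\<in>\<Lambda>. F x)" unfolding \<Lambda>_def
    using s p1 by (intro polyf_sum_dvd[OF p]) auto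
  moreover have fin\<Lambda>: "finite \<Lambda>" unfolding \<Lambda>_def by (intro finite_PiE) auto
  moreover have z\<Lambda>: "z \<in> \<Lambda>" using p1 by (auto simp: z_def \<Lambda>_def image_iff)
  \<comment> \<open>\<open>n > 0\<close> supplies a first row, which is zero here; the empty
    Pfaffian would be 1.\<close>
  moreover have "F z = 0"
  proof -
    have "pf (B z) [0..<n] = 0"
      using n by (simp add: upt_conv_Cons pf.simps(2) B_def z_def)
    then show ?thesis using p1 by (simp add: F_def)
  qed
  ultimately have 1: "int p dvd (\<Sum>x\<in>\<Lambda> - {z}. F x)"
    by (simp add: sum.remove)
  have 2: "int p dvd F x - 1" if "x \<in> \<Lambda> - {z}" for x
  proof -
    have "\<exists>k<s. x k \<noteq> 0"
    proof (rule ccontr)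
      assume 0: "\<not> ?thesis"
      have "x k = z k" for k
      proof (cases "k < s")
        case True
        then show ?thesis using 0 by (simp add: z_def)
      next
        case False
        then have k: "k \<notin> {..<s}" by simp
        have "x \<in> {..<s} \<rightarrow>\<^sub>E int ` {..<p}" using that unfolding \<Lambda>_def by blast
        from PiE_arb[OF this k] show ?thesis using False by (simp add: z_def)
      qed
      then have "x = z" by (rule ext)
      then show False using that by blast
    qed
    then obtain k where k: "k < s" "x k \<noteq> 0" by auto
    have "x \<in> \<Lambda>" using that by (rule DiffD1)
    note x\<Lambda> = this[unfolded \<Lambda>_def]
    have "x k \<in> int ` {..<p}" by (rule PiE_mem[OF x\<Lambda>]) (simp add: k(1))
    then obtain t where "x k = int t" "t < p" by blast
    then have "\<not> int p dvd x k" using k(2) by (simp add: nat_dvd_not_less)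
    then have "\<exists>k<s. \<not> int p dvd x k" using k(1) by auto
    note nd = nd[OF this]
    have "B x u v = - B x v u" for u v
      unfolding B_def sum_negf[symmetric] by (intro sum.cong refl) (subst anti[of _ u v], simp)
    then have "\<not> int p dvd pf (B x) [0..<n]"
    proof (rule pf_nondegenerate)
      show "\<not> int p dvd 1" using p1 by auto
    qed (unfold B_def, rule nd)
    then have "[pf (B x) [0..<n] ^ (p - 1) = 1] (mod int p)"
      by (rule fermat_theorem_int[OF p])
    then show ?thesis by (simp add: F_def cong_iff_dvd_diff)
  qed
  have "int p dvd (\<Sum>x\<in>\<Lambda> - {z}. F x - 1)" using 2 by (rule dvd_sum)
  then have "int p dvd (\<Sum>x\<in>\<Lambda> - {z}. F x) - int (card (\<Lambda> - {z}))"
    by (simp add: sum_subtractf)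
  then have "int p dvd int (card (\<Lambda> - {z}))"
    using 1 by (metis dvd_diff_right_iff dvd_diff_commute)
  moreover have "int (card (\<Lambda> - {z})) = int p ^ s - 1"
  proof -
    have "card \<Lambda> = p ^ s" unfolding \<Lambda>_def
      by (subst card_PiE) (auto simp: card_image)
    then show ?thesis using fin\<Lambda> z\<Lambda> p1 by (simp add: card_Diff_singleton of_nat_diff)
  qed
  moreover have "int p dvd int p ^ s" using s by (cases s) auto
  ultimately have "int p dvd 1" by (metis dvd_diff_right_iff)
  then show False using p1 by auto
qed

section \<open>Complex matrices of finite order\<close>

lemma mat_eq_oneI:
  fixes A :: "complex mat"
  assumes "A \<in> carrier_mat n n" and "\<And>j. j < n \<Longrightarrow> A *\<^sub>v unit_vec n j = c \<cdot>\<^sub>v unit_vec n j"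
  shows "A = c \<cdot>\<^sub>m 1\<^sub>m n"
proof (rule eq_matI)
  fix i j assume "i < dim_row (c \<cdot>\<^sub>m 1\<^sub>m n)" "j < dim_col (c \<cdot>\<^sub>m (1\<^sub>m n :: complex mat))"
  then have ij: "i < n" "j < n" by auto
  have "(A *\<^sub>v unit_vec n j) $ i = A $$ (i, j)" using assms(1) ij by simp
  then show "A $$ (i, j) = (c \<cdot>\<^sub>m 1\<^sub>m n) $$ (i, j)"
    using assms(2)[OF ij(2)] ij by simp
qed (use assms(1) in auto)

text \<open>A matrix of finite order cannot act on a plane as a nontrivial Jordan block.\<close>

lemma finite_order_no_shear:
  fixes A :: "complex mat"
  assumes A: "A \<in> carrier_mat n n" and N: "A ^\<^sub>m N = 1\<^sub>m n" "N > 0"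
    and v: "v \<in> carrier_vec n" and w: "w \<in> carrier_vec n"
    and Av: "A *\<^sub>v v = c \<cdot>\<^sub>v v + w" and Aw: "A *\<^sub>v w = c \<cdot>\<^sub>v w"
  shows "w = 0\<^sub>v n"
proof (rule ccontr)
  assume w0: "w \<noteq> 0\<^sub>v n"
  have ev: "eigenvector A w c" using A w w0 Aw by (auto simp: eigenvector_def)
  have Ak: "A ^\<^sub>m k \<in> carrier_mat n n" for k using A by simp
  have pw: "A ^\<^sub>m k *\<^sub>v w = c ^ k \<cdot>\<^sub>v w" for k by (rule eigenvector_pow[OF A ev])
  have pv: "A ^\<^sub>m k *\<^sub>v v = c ^ k \<cdot>\<^sub>v v + (of_nat k * c ^ (k - 1)) \<cdot>\<^sub>v w" for k
  proof (induction k)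
    case 0
    then show ?case using A v w by (intro eq_vecI) auto
  next
    case (Suc k)
    have "A ^\<^sub>m Suc k *\<^sub>v v = A ^\<^sub>m k *\<^sub>v (A *\<^sub>v v)"
      using A Ak v by (simp add: assoc_mult_mat_vec[of _ n n _ n])
    also have "\<dots> = c \<cdot>\<^sub>v (A ^\<^sub>m k *\<^sub>v v) + A ^\<^sub>m k *\<^sub>v w"
      unfolding Av using Ak v w by (simp add: mult_add_distrib_mat_vec[of _ n n] mult_mat_vec[of _ n n])
    also have "\<dots> = c \<cdot>\<^sub>v (c ^ k \<cdot>\<^sub>v v + (of_nat k * c ^ (k - 1)) \<cdot>\<^sub>v w) + c ^ k \<cdot>\<^sub>v w"
      unfolding Suc.IH pw ..
    also have "\<dots> = c ^ Suc k \<cdot>\<^sub>v v + (of_nat (Suc k) * c ^ (Suc k - 1)) \<cdot>\<^sub>v w"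
    proof (rule eq_vecI)
      fix i assume "i < dim_vec (c ^ Suc k \<cdot>\<^sub>v v + (of_nat (Suc k) * c ^ (Suc k - 1)) \<cdot>\<^sub>v w)"
      then have "i < n" using v w by simp
      then show "(c \<cdot>\<^sub>v (c ^ k \<cdot>\<^sub>v v + (of_nat k * c ^ (k - 1)) \<cdot>\<^sub>v w) + c ^ k \<cdot>\<^sub>v w) $ i =
        (c ^ Suc k \<cdot>\<^sub>v v + (of_nat (Suc k) * c ^ (Suc k - 1)) \<cdot>\<^sub>v w) $ i"
        using v w by (cases k) (simp_all add: algebra_simps)
    qed (use v w in simp)
    finally show ?case .
  qed
  obtain i where i: "i < n" "w $ i \<noteq> 0" using w w0 by (metis carrier_vecD eq_vecI index_zero_vec)
  have "w = c ^ N \<cdot>\<^sub>v w" using pw[of N] N w by simp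
  then have "w $ i = (c ^ N \<cdot>\<^sub>v w) $ i" by simp
  then have "w $ i = c ^ N * w $ i" using i(1) w by simp
  then have cN: "c ^ N = 1" using i by simp
  have "v = v + (of_nat N * c ^ (N - 1)) \<cdot>\<^sub>v w" using pv[of N] N v cN by simp
  then have "v $ i = (v + (of_nat N * c ^ (N - 1)) \<cdot>\<^sub>v w) $ i" by simp
  then have "of_nat N * c ^ (N - 1) * w $ i = 0" using i(1) v w by simp
  moreover have "c \<noteq> 0" using cN N(2) by (auto simp: zero_power)
  ultimately show False using i(2) N(2) by simp
qed

text \<open>Column by column: the part \<open>w\<close> of column \<open>j\<close> above the
  diagonal is a combination of earlier unit vectors, which are already scaled by \<open>c\<close>.
  Thus \<open>B\<close> acts on the \<open>j\<close>-th unit vector and \<open>w\<close> as a Jordan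
  block, and \<open>w\<close> vanishes.\<close>

lemma upper_triangular_finite_order_scalar:
  fixes B :: "complex mat"
  assumes B: "B \<in> carrier_mat n n" and N: "B ^\<^sub>m N = 1\<^sub>m n" "N > 0"
    and ut: "upper_triangular B" and diag: "\<And>i. i < n \<Longrightarrow> B $$ (i, i) = c"
  shows "B = c \<cdot>\<^sub>m 1\<^sub>m n"
proof -
  have "\<forall>i<n. B $$ (i, j) = (if i = j then c else 0)" if "j < n" for j
    using that
  proof (induction j rule: less_induct)
    case (less j)
    define w where "w = vec n (\<lambda>i. if i < j then B $$ (i, j) else 0)"
    have w: "w \<in> carrier_vec n" by (simp add: w_def)
    have "B *\<^sub>v unit_vec n j = c \<cdot>\<^sub>v unit_vec n j + w"
    proof (rule eq_vecI)
      fix i assume "i < dim_vec (c \<cdot>\<^sub>v unit_vec n j + w)"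
      then have i: "i < n" using w by auto
      have "(B *\<^sub>v unit_vec n j) $ i = B $$ (i, j)" using B i less.prems by simp
      moreover have "B $$ (i, j) = 0" if "j < i" using ut that i B by auto
      ultimately show "(B *\<^sub>v unit_vec n j) $ i = (c \<cdot>\<^sub>v unit_vec n j + w) $ i"
        using i less.prems diag[of j] by (cases i j rule: linorder_cases) (auto simp: w_def)
    qed (use B w in auto)
    moreover have "B *\<^sub>v w = c \<cdot>\<^sub>v w"
    proof (rule eq_vecI)
      fix i assume "i < dim_vec (c \<cdot>\<^sub>v w)"
      then have i: "i < n" using w by auto
      have "(B *\<^sub>v w) $ i = (\<Sum>k\<in>{0..<n}. B $$ (i, k) * w $ k)"
        using B w i by (simp add: scalar_prod_def)
      also have "\<dots> = (\<Sum>k\<in>{0..<n}. if k = i then c * w $ i else 0)"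
      proof (rule sum.cong[OF refl])
        fix k assume "k \<in> {0..<n}"
        then show "B $$ (i, k) * w $ k = (if k = i then c * w $ i else 0)"
          using less.IH[of k] i by (cases "k < j") (auto simp: w_def)
      qed
      finally show "(B *\<^sub>v w) $ i = (c \<cdot>\<^sub>v w) $ i" using i w by simp
    qed (use B w in auto)
    ultimately have w0: "w = 0\<^sub>v n"
      by (intro finite_order_no_shear[OF B N _ w]) auto
    show ?case
    proof (intro allI impI)
      fix i assume i: "i < n"
      have "w $ i = 0" using w0 i by simp
      moreover have "B $$ (i, j) = 0" if "j < i" using ut that i B by auto
      ultimately show "B $$ (i, j) = (if i = j then c else 0)"
        using i diag[OF i] by (cases i j rule: linorder_cases) (auto simp: w_def)
    qed
  qed
  then show ?thesis using B by (intro eq_matI) auto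
qed

text \<open>The equality case of the triangle inequality. Multiplication by \<open>u\<close> rotates
  the sum onto the positive real \<open>card A\<close>; the real parts of the summands, each at most
  1, must then all equal 1.\<close>

lemma unit_sum_maximal_imp_eq:
  fixes b :: "'i \<Rightarrow> complex"
  assumes A: "finite A" and unit: "\<And>i. i \<in> A \<Longrightarrow> cmod (b i) = 1"
    and sum: "cmod (\<Sum>i\<in>A. b i) = card A"
  shows "\<exists>c. \<forall>i\<in>A. b i = c"
proof (cases "A = {}")
  case False
  define S where "S = (\<Sum>i\<in>A. b i)"
  define r where "r = real (card A)"
  have r: "r > 0" using A False by (simp add: r_def card_gt_0_iff)
  have S: "cmod S = r" using sum by (simp add: S_def r_def)
  then have S0: "S \<noteq> 0" using r by auto
  define u where "u = cnj S / of_real r"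
  have u: "cmod u = 1" using S r by (simp add: u_def norm_divide)
  have uS: "u * S = of_real r"
  proof -
    have "cnj S * S = of_real (r ^ 2)" using S by (metis complex_norm_square mult.commute of_real_power)
    then show ?thesis using r by (simp add: u_def power2_eq_square)
  qed
  have le: "Re (u * b i) \<le> 1" if "i \<in> A" for i
    using complex_Re_le_cmod[of "u * b i"] u unit[OF that] by (simp add: norm_mult)
  have "(\<Sum>i\<in>A. 1 - Re (u * b i)) = r - Re (u * S)"
    by (simp add: sum_subtractf r_def S_def sum_distrib_left)
  then have "(\<Sum>i\<in>A. 1 - Re (u * b i)) = 0" using uS by simp
  then have Re1: "Re (u * b i) = 1" if "i \<in> A" for i
    using sum_nonneg_eq_0_iff[of A "\<lambda>i. 1 - Re (u * b i)"] A le that by auto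
  have "b i = 1 / u" if "i \<in> A" for i
  proof -
    have "cmod (u * b i) = 1" using u unit[OF that] by (simp add: norm_mult)
    then have "Im (u * b i) = 0" using Re1[OF that] by (simp add: cmod_def)
    then have "u * b i = 1" using Re1[OF that] by (simp add: complex_eq_iff)
    moreover have "u \<noteq> 0" using u by auto
    ultimately show ?thesis by (simp add: nonzero_eq_divide_eq mult.commute)
  qed
  then show ?thesis by blast
qed auto

lemma mat_trace_comm:
  fixes A B :: "complex mat"
  assumes "A \<in> carrier_mat n n" "B \<in> carrier_mat n n"
  shows "mat_trace (A * B) = mat_trace (B * A)"
proof -
  have tr: "mat_trace (A * B) = (\<Sum>i<n. \<Sum>k<n. A $$ (i, k) * B $$ (k, i))"
    if "A \<in> carrier_mat n n" "B \<in> carrier_mat n n" for A B :: "complex mat"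
    unfolding mat_trace_def using that
    by (intro sum.cong) (auto simp: scalar_prod_def atLeast0LessThan)
  show ?thesis unfolding tr[OF assms] tr[OF assms(2,1)]
    by (subst sum.swap) (simp add: mult.commute)
qed

text \<open>After triangularization the diagonal consists of eigenvalues, which are roots of unity.
  A trace of modulus \<open>n\<close> makes them equal, finite order then removes the entries above
  the diagonal, and a scalar matrix survives the change back.\<close>

lemma finite_order_trace_scalar:
  fixes A :: "complex mat"
  assumes A: "A \<in> carrier_mat n n" and N: "A ^\<^sub>m N = 1\<^sub>m n" "N > 0"
    and tr: "cmod (mat_trace A) = n"
  shows "\<exists>c. A = c \<cdot>\<^sub>m 1\<^sub>m n"
proof -
  obtain es where es: "char_poly A = (\<Prod>a\<leftarrow>es. [:- a, 1:])"
    using char_poly_factorized[OF A] by blast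
  define B where "B = schur_upper_triangular A es"
  have B: "B \<in> carrier_mat n n" "upper_triangular B" "similar_mat A B"
    using schur_upper_triangular[OF A es] by (auto simp: B_def)
  then obtain P Q where wit: "similar_mat_wit A B P Q" by (auto simp: similar_mat_def)
  note PQ = similar_mat_witD2[OF A wit]
  note wit' = similar_mat_wit_sym[OF wit]
  have BN: "B ^\<^sub>m N = 1\<^sub>m n"
    using similar_mat_wit_pow_id[OF wit', of N] N(1) PQ by simp
  have unit: "cmod (B $$ (i, i)) = 1" if i: "i < n" for i
  proof -
    have "B $$ (i, i) \<in> set (diag_mat B)" using i B(1) by (auto simp: diag_mat_def)
    then have "poly (char_poly B) (B $$ (i, i)) = 0"
      unfolding char_poly_upper_triangular[OF B(1,2)] poly_prod_list
      by (auto simp: prod_list_zero_iff image_iff)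
    then have "eigenvalue B (B $$ (i, i))"
      using eigenvalue_root_char_poly[OF B(1)] by simp
    then obtain v where v: "eigenvector B v (B $$ (i, i))" by (auto simp: eigenvalue_def)
    then have vc: "v \<in> carrier_vec n" "v \<noteq> 0\<^sub>v n" using B(1) by (auto simp: eigenvector_def)
    then obtain k where k: "k < n" "v $ k \<noteq> 0" by (metis carrier_vecD eq_vecI index_zero_vec)
    have "v = (B $$ (i, i)) ^ N \<cdot>\<^sub>v v" using eigenvector_pow[OF B(1) v, of N] BN vc by simp
    then have "v $ k = ((B $$ (i, i)) ^ N \<cdot>\<^sub>v v) $ k" by simp
    then have "(B $$ (i, i)) ^ N = 1" using k vc(1) by simp
    then have "cmod (B $$ (i, i)) ^ N = 1" by (metis norm_one norm_power)
    then show ?thesis 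
      using power_eq_imp_eq_base[of "cmod (B $$ (i, i))" N 1] N(2) by simp
  qed
  have "mat_trace A = mat_trace (P * (B * Q))" using PQ by (simp add: assoc_mult_mat[of _ n n _ n _ n])
  also have "\<dots> = mat_trace ((B * Q) * P)" by (rule mat_trace_comm) (use PQ in auto)
  also have "(B * Q) * P = B" using PQ by (simp add: assoc_mult_mat[of _ n n _ n _ n])
  finally have "mat_trace A = (\<Sum>i<n. B $$ (i, i))" using B(1) by (simp add: mat_trace_def)
  then have "cmod (\<Sum>i<n. B $$ (i, i)) = card {..<n}" using tr by simp
  then obtain c where c: "\<And>i. i < n \<Longrightarrow> B $$ (i, i) = c"
    using unit_sum_maximal_imp_eq[of "{..<n}" "\<lambda>i. B $$ (i, i)"] unit by auto
  have "B = c \<cdot>\<^sub>m 1\<^sub>m n"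
    by (rule upper_triangular_finite_order_scalar[OF B(1) BN N(2) B(2) c])
  then have "A = c \<cdot>\<^sub>m (P * Q)"
    using PQ by (simp add: mult_smult_distrib[of _ n n _ n] mult_smult_assoc_mat[of _ n n _ n])
  then show ?thesis using PQ by auto
qed

section \<open>Matrix representations: finite order, kernels, Schur's lemma\<close>

lemma representation_pow:
  assumes G: "group G" and \<rho>: "representation G d \<rho>" and g: "g \<in> carrier G"
  shows "\<rho> (g [^]\<^bsub>G\<^esub> (k::nat)) = \<rho> g ^\<^sub>m k"
proof -
  interpret group G by (rule G)
  show ?thesis
  proof (induction k)
    case 0
    then show ?case using \<rho> g by (auto simp: representation_def)
  next
    case (Suc k)
    then show ?case using \<rho> g by (simp add: representation_def)
  qed
qed

lemma representation_finite_order: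
  assumes G: "group G" "finite (carrier G)" and \<rho>: "representation G d \<rho>" and g: "g \<in> carrier G"
  shows "\<rho> g ^\<^sub>m Coset.order G = 1\<^sub>m d"
proof -
  interpret group G by (rule G)
  show ?thesis using representation_pow[OF G(1) \<rho> g, of "Coset.order G"] pow_order_eq_1[OF g] \<rho>
    by (simp add: representation_def)
qed

lemma representation_kernel_normal:
  assumes G: "group G" and \<rho>: "representation G d \<rho>"
  shows "{g \<in> carrier G. \<rho> g = 1\<^sub>m d} \<lhd> G"
proof -
  interpret group G by (rule G)
  have mult: "\<rho> (g \<otimes>\<^bsub>G\<^esub> h) = \<rho> g * \<rho> h" if "g \<in> carrier G" "h \<in> carrier G" for g h
    using \<rho> that by (auto simp: representation_def)
  have car: "\<rho> g \<in> carrier_mat d d" if "g \<in> carrier G" for g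
    using \<rho> that by (auto simp: representation_def)
  have one: "\<rho> \<one>\<^bsub>G\<^esub> = 1\<^sub>m d" using \<rho> by (auto simp: representation_def)
  have inv: "\<rho> g * \<rho> (inv\<^bsub>G\<^esub> g) = 1\<^sub>m d" if "g \<in> carrier G" for g
    using mult[of g "inv\<^bsub>G\<^esub> g"] that one by simp
  show ?thesis unfolding normal_inv_iff
  proof (intro conjI ballI)
    show "subgroup {g \<in> carrier G. \<rho> g = 1\<^sub>m d} G"
    proof (rule subgroupI)
      fix a assume a: "a \<in> {g \<in> carrier G. \<rho> g = 1\<^sub>m d}"
      then have "\<rho> (inv\<^bsub>G\<^esub> a) = 1\<^sub>m d" using inv[of a] car[of "inv\<^bsub>G\<^esub> a"] by simp
      then show "inv\<^bsub>G\<^esub> a \<in> {g \<in> carrier G. \<rho> g = 1\<^sub>m d}" using a by simp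
    qed (use one mult in auto)
  next
    fix x h assume x: "x \<in> carrier G" and h: "h \<in> {g \<in> carrier G. \<rho> g = 1\<^sub>m d}"
    then have "\<rho> (x \<otimes>\<^bsub>G\<^esub> h \<otimes>\<^bsub>G\<^esub> inv\<^bsub>G\<^esub> x) = 1\<^sub>m d"
      using car[OF x] inv[OF x] by (simp add: mult)
    then show "x \<otimes>\<^bsub>G\<^esub> h \<otimes>\<^bsub>G\<^esub> inv\<^bsub>G\<^esub> x \<in> {g \<in> carrier G. \<rho> g = 1\<^sub>m d}" using x h by simp
  qed
qed

text \<open>The eigenspace of one eigenvalue of \<open>\<rho> g\<close> is a nonzero invariant
  subspace, hence the whole space.\<close>

lemma schur_scalar:
  assumes irr: "irreducible_rep G d \<rho>" and g: "g \<in> carrier G"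
    and comm: "\<And>h. h \<in> carrier G \<Longrightarrow> \<rho> g * \<rho> h = \<rho> h * \<rho> g"
  shows "\<exists>c. \<rho> g = c \<cdot>\<^sub>m 1\<^sub>m d"
proof -
  have car: "\<rho> h \<in> carrier_mat d d" if "h \<in> carrier G" for h
    using irr that by (auto simp: irreducible_rep_def representation_def)
  have A: "\<rho> g \<in> carrier_mat d d" by (rule car[OF g])
  obtain e where "eigenvalue (\<rho> g) e"
    using spectrum_non_empty[OF A] irr by (auto simp: irreducible_rep_def spectrum_def)
  then obtain v where v: "v \<in> carrier_vec d" "v \<noteq> 0\<^sub>v d" "\<rho> g *\<^sub>v v = e \<cdot>\<^sub>v v"
    using A by (auto simp: eigenvalue_def eigenvector_def)
  define W where "W = {v \<in> carrier_vec d. \<rho> g *\<^sub>v v = e \<cdot>\<^sub>v v}"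
  have "invariant_subspace G d \<rho> W"
    unfolding invariant_subspace_def
  proof (intro conjI ballI allI)
    show "0\<^sub>v d \<in> W" using A by (auto simp: W_def)
  next
    fix v w assume "v \<in> W" "w \<in> W"
    then show "v + w \<in> W" using A
      by (auto simp: W_def mult_add_distrib_mat_vec[of _ d d] smult_add_distrib_vec[of _ d])
  next
    fix c v assume "v \<in> W"
    then show "c \<cdot>\<^sub>v v \<in> W" using A
      by (auto simp: W_def mult_mat_vec[of _ d d] smult_smult_assoc mult.commute)
  next
    fix h v assume h: "h \<in> carrier G" and vW: "v \<in> W"
    have v: "v \<in> carrier_vec d" "\<rho> g *\<^sub>v v = e \<cdot>\<^sub>v v" using vW by (auto simp: W_def)
    have "\<rho> g *\<^sub>v (\<rho> h *\<^sub>v v) = (\<rho> g * \<rho> h) *\<^sub>v v"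
      using A car[OF h] v by (simp add: assoc_mult_mat_vec[of _ d d _ d])
    also have "\<dots> = \<rho> h *\<^sub>v (\<rho> g *\<^sub>v v)"
      unfolding comm[OF h] using A car[OF h] v by (simp add: assoc_mult_mat_vec[of _ d d _ d])
    also have "\<dots> = e \<cdot>\<^sub>v (\<rho> h *\<^sub>v v)" unfolding v(2) using car[OF h] v(1) by (rule mult_mat_vec)
    finally show "\<rho> h *\<^sub>v v \<in> W" using car[OF h] v(1) by (simp add: W_def)
  qed (auto simp: W_def)
  then have "W = {0\<^sub>v d} \<or> W = carrier_vec d" using irr by (auto simp: irreducible_rep_def)
  moreover have "v \<in> W" using v by (simp add: W_def)
  ultimately have "W = carrier_vec d" using v(2) by blast
  then have "unit_vec d j \<in> W" for j by simp
  then have "\<rho> g *\<^sub>v unit_vec d j = e \<cdot>\<^sub>v unit_vec d j" for j unfolding W_def by blast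
  then have "\<rho> g = e \<cdot>\<^sub>m 1\<^sub>m d" by (intro mat_eq_oneI[OF A])
  then show ?thesis by blast
qed

section \<open>Existence of irreducible representations\<close>

lemma mult_mat_zero_vec:
  fixes A :: "complex mat"
  shows "A \<in> carrier_mat d d \<Longrightarrow> A *\<^sub>v 0\<^sub>v d = 0\<^sub>v d"
  by (intro eq_vecI) auto

lemma one_smult_one_mat: "(1 :: complex) \<cdot>\<^sub>m 1\<^sub>m d = 1\<^sub>m d"
  by (intro eq_matI) auto

text \<open>Replaces dimension theory. Take an inclusion-maximal set \<open>I\<close> of columns of
  an invertible matrix that lie in \<open>W\<close>. A vector of \<open>W\<close> with a nonzero
  coordinate outside \<open>I\<close> could be exchanged for the column of that coordinate, which
  would enlarge \<open>I\<close>.\<close>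

lemma complex_subspace_adapted_basis:
  fixes W :: "complex vec set"
  assumes W: "W \<subseteq> carrier_vec d" "0\<^sub>v d \<in> W"
    and add: "\<And>v w. v \<in> W \<Longrightarrow> w \<in> W \<Longrightarrow> v + w \<in> W"
    and smult: "\<And>c v. v \<in> W \<Longrightarrow> c \<cdot>\<^sub>v v \<in> W"
  shows "\<exists>P Q I. P \<in> carrier_mat d d \<and> Q \<in> carrier_mat d d \<and> P * Q = 1\<^sub>m d \<and> Q * P = 1\<^sub>m d \<and>
    I \<subseteq> {..<d} \<and> (\<forall>v\<in>carrier_vec d. v \<in> W \<longleftrightarrow> (\<forall>i<d. i \<notin> I \<longrightarrow> (Q *\<^sub>v v) $ i = 0))"
proof -
  define T where "T I \<longleftrightarrow> I \<subseteq> {..<d} \<and> (\<exists>P Q. P \<in> carrier_mat d d \<and> Q \<in> carrier_mat d d \<and>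
      P * Q = 1\<^sub>m d \<and> Q * P = 1\<^sub>m d \<and> (\<forall>i\<in>I. P *\<^sub>v unit_vec d i \<in> W))" for I
  have "T {}" unfolding T_def by (intro conjI exI[of _ "1\<^sub>m d"]) auto
  moreover have finT: "finite {I. T I}"
    by (rule finite_subset[of _ "Pow {..<d}"]) (auto simp: T_def)
  ultimately obtain I where I: "T I" "\<And>J. T J \<Longrightarrow> I \<subseteq> J \<Longrightarrow> J = I"
    using finite_has_maximal2[of "{I. T I}" "{}"] by (metis mem_Collect_eq)
  then obtain P Q where PQ: "P \<in> carrier_mat d d" "Q \<in> carrier_mat d d"
      "P * Q = 1\<^sub>m d" "Q * P = 1\<^sub>m d" "\<And>i. i \<in> I \<Longrightarrow> P *\<^sub>v unit_vec d i \<in> W" and Id: "I \<subseteq> {..<d}"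
    unfolding T_def by auto
  have span: "P *\<^sub>v u \<in> W" if u: "u \<in> carrier_vec d" "\<And>i. i < d \<Longrightarrow> i \<notin> I \<Longrightarrow> u $ i = 0" for u
  proof -
    have fI: "finite I" using Id by (rule finite_subset) simp
    have "P *\<^sub>v (vec d (\<lambda>i. if i \<in> J then u $ i else 0)) \<in> W" if "finite J" "J \<subseteq> I" for J
      using that
    proof (induction J rule: finite_induct)
      case empty
      have "vec d (\<lambda>i. if i \<in> {} then u $ i else 0) = 0\<^sub>v d" by (intro eq_vecI) auto
      then show ?case using mult_mat_zero_vec[OF PQ(1)] W(2) by simp
    next
      case (insert j J)
      have jd: "j < d" using insert.prems Id by auto
      have "vec d (\<lambda>i. if i \<in> insert j J then u $ i else 0) =
          vec d (\<lambda>i. if i \<in> J then u $ i else 0) + u $ j \<cdot>\<^sub>v unit_vec d j"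
        using insert.hyps jd by (intro eq_vecI) auto
      then have "P *\<^sub>v vec d (\<lambda>i. if i \<in> insert j J then u $ i else 0) =
          P *\<^sub>v vec d (\<lambda>i. if i \<in> J then u $ i else 0) + u $ j \<cdot>\<^sub>v (P *\<^sub>v unit_vec d j)"
        using PQ(1) by (simp add: mult_add_distrib_mat_vec[of _ d d] mult_mat_vec[of _ d d])
      then show ?case using insert.IH insert.prems PQ(5)[of j] add smult by simp
    qed
    from this[OF fI subset_refl] have "P *\<^sub>v (vec d (\<lambda>i. if i \<in> I then u $ i else 0)) \<in> W" .
    moreover have "vec d (\<lambda>i. if i \<in> I then u $ i else 0) = u"
      using u by (intro eq_vecI) auto
    ultimately show ?thesis by simp
  qed
  have "v \<in> W \<longleftrightarrow> (\<forall>i<d. i \<notin> I \<longrightarrow> (Q *\<^sub>v v) $ i = 0)" if v: "v \<in> carrier_vec d" for v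
  proof
    assume "\<forall>i<d. i \<notin> I \<longrightarrow> (Q *\<^sub>v v) $ i = 0"
    then have "P *\<^sub>v (Q *\<^sub>v v) \<in> W" using PQ(2) v by (intro span) auto
    moreover have "P *\<^sub>v (Q *\<^sub>v v) = v"
      using PQ v assoc_mult_mat_vec[OF PQ(1,2) v] by simp
    ultimately show "v \<in> W" by simp
  next
    assume vW: "v \<in> W"
    show "\<forall>i<d. i \<notin> I \<longrightarrow> (Q *\<^sub>v v) $ i = 0"
    proof (intro allI impI, rule ccontr)
      fix i assume i: "i < d" "i \<notin> I" and ne: "(Q *\<^sub>v v) $ i \<noteq> 0"
      define u where "u = Q *\<^sub>v v"
      have u: "u \<in> carrier_vec d" "u $ i \<noteq> 0" using PQ(2) v ne by (auto simp: u_def)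
      \<comment> \<open>The exchange: multiplying \<open>P\<close> by \<open>col_mat u\<close>, the
        identity with column \<open>i\<close> replaced by \<open>u\<close>, makes \<open>v\<close>
        the new \<open>i\<close>-th basis vector and keeps those in \<open>I\<close>. The inverse is
        the same kind of matrix, with column \<open>u'\<close>, and exists because
        \<open>u $ i\<close> is nonzero.\<close>
      define col_mat :: "complex vec \<Rightarrow> complex mat" where
        "col_mat w = mat d d (\<lambda>(a, b). if b = i then w $ a else if a = b then 1 else 0)" for w
      define u' where "u' = vec d (\<lambda>a. if a = i then 1 / u $ i else - (u $ a / u $ i))"
      have cm: "col_mat w \<in> carrier_mat d d" for w by (simp add: col_mat_def)
      have cmv: "(col_mat w *\<^sub>v x) $ a = (if a = i then 0 else x $ a) + w $ a * x $ i"
        if "a < d" "x \<in> carrier_vec d" for w x a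
      proof -
        have "(col_mat w *\<^sub>v x) $ a = (\<Sum>b\<in>{0..<d}. (if b = i then w $ a else if a = b then 1 else 0) * x $ b)"
          using that by (simp add: col_mat_def scalar_prod_def)
        also have "\<dots> = w $ a * x $ i + (\<Sum>b\<in>{0..<d} - {i}. (if b = i then w $ a else if a = b then 1 else 0) * x $ b)"
          using i(1) by (subst sum.remove[of _ i]) auto
        also have "(\<Sum>b\<in>{0..<d} - {i}. (if b = i then w $ a else if a = b then 1 else 0) * x $ b)
            = (\<Sum>b\<in>{0..<d} - {i}. if a = b then x $ b else 0)"
          by (intro sum.cong) auto
        also have "\<dots> = (if a = i then 0 else x $ a)" using that(1) by (subst sum.delta') auto
        finally show ?thesis by simp
      qed
      have inv: "col_mat u * col_mat u' = 1 \<cdot>\<^sub>m 1\<^sub>m d"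
      proof (rule mat_eq_oneI)
        fix j assume j: "j < d"
        have "col_mat u *\<^sub>v (col_mat u' *\<^sub>v unit_vec d j) = unit_vec d j"
        proof (rule eq_vecI)
          fix a assume "a < dim_vec (unit_vec d j :: complex vec)"
          then have a: "a < d" by simp
          have x: "col_mat u' *\<^sub>v unit_vec d j \<in> carrier_vec d"
            by (rule mult_mat_vec_carrier[OF cm]) simp
          have xe: "(col_mat u' *\<^sub>v unit_vec d j) $ b =
              (if b = i then 0 else unit_vec d j $ b) + u' $ b * unit_vec d j $ i" if "b < d" for b
            using that by (rule cmv) simp
          have u'v: "u' $ b = (if b = i then 1 / u $ i else - (u $ b / u $ i))" if "b < d" for b
            using that by (simp add: u'_def)
          show "(col_mat u *\<^sub>v (col_mat u' *\<^sub>v unit_vec d j)) $ a = unit_vec d j $ a"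
            unfolding cmv[OF a x] xe[OF a] xe[OF i(1)] u'v[OF a] u'v[OF i(1)]
            using a j i(1) u(2) by (cases "a = i"; cases "j = i") simp_all
        qed (simp add: col_mat_def)
        then show "col_mat u * col_mat u' *\<^sub>v unit_vec d j = 1 \<cdot>\<^sub>v unit_vec d j"
          using cm[of u] cm[of u'] by (simp add: assoc_mult_mat_vec[of _ d d _ d])
      qed (rule mult_carrier_mat[OF cm cm])
      then have inv: "col_mat u * col_mat u' = 1\<^sub>m d" unfolding one_smult_one_mat .
      then have inv': "col_mat u' * col_mat u = 1\<^sub>m d"
        by (rule mat_mult_left_right_inverse[OF cm cm])
      define P' where "P' = P * col_mat u"
      define Q' where "Q' = col_mat u' * Q"
      have P'Q': "P' \<in> carrier_mat d d" "Q' \<in> carrier_mat d d" using PQ(1,2) cm[of u] cm[of u'] by (auto simp: P'_def Q'_def)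
      have "P' * Q' = P * ((col_mat u * col_mat u') * Q)"
        using PQ(1,2) cm[of u] cm[of u'] by (simp add: P'_def Q'_def assoc_mult_mat[of _ d d _ d _ d])
      then have 1: "P' * Q' = 1\<^sub>m d" unfolding inv using PQ by simp
      then have 2: "Q' * P' = 1\<^sub>m d" by (rule mat_mult_left_right_inverse[OF P'Q'])
      have P'e: "P' *\<^sub>v unit_vec d j = P *\<^sub>v (col_mat u *\<^sub>v unit_vec d j)" for j
        using PQ(1) cm[of u] by (simp add: P'_def assoc_mult_mat_vec[of _ d d _ d])
      have "P' *\<^sub>v unit_vec d j \<in> W" if j: "j \<in> insert i I" for j
      proof (cases "j = i")
        case True
        have "col_mat u *\<^sub>v unit_vec d i = u"
          using cm[of u] u i(1) by (intro eq_vecI) (auto simp: cmv simp del: index_mult_mat_vec)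
        then have "P' *\<^sub>v unit_vec d j = P *\<^sub>v u" unfolding P'e True by simp
        also have "\<dots> = v" unfolding u_def using PQ v assoc_mult_mat_vec[OF PQ(1,2) v] by simp
        finally show ?thesis using vW by simp
      next
        case False
        then have jI: "j \<in> I" "j < d" using j Id by auto
        have "col_mat u *\<^sub>v unit_vec d j = unit_vec d j"
          using cm[of u] u i(1) False jI by (intro eq_vecI) (auto simp: cmv simp del: index_mult_mat_vec)
        then show ?thesis unfolding P'e using PQ(5)[OF jI(1)] by simp
      qed
      then have "T (insert i I)" unfolding T_def using P'Q' 1 2 Id i(1) by blast
      from I(2)[OF this] i(2) show False by blast
    qed
  qed
  then show ?thesis using PQ Id by blast
qed

definition compress :: "(nat \<Rightarrow> nat) \<Rightarrow> nat \<Rightarrow> complex mat \<Rightarrow> complex mat" where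
  "compress e c M = mat c c (\<lambda>(i, j). M $$ (e i, e j))"

text \<open>For block triangular matrices one factor of every product passing through an index
  outside \<open>J\<close> is zero. Stating \<open>z\<close> for the product covers both diagonal
  blocks, that of the invariant subspace and that of the quotient.\<close>

lemma compress_mult:
  assumes e: "bij_betw e {..<c} J" "J \<subseteq> {..<d}" and M: "M \<in> carrier_mat d d" "M' \<in> carrier_mat d d"
    and z: "\<And>i j l. i \<in> J \<Longrightarrow> j \<in> J \<Longrightarrow> l < d \<Longrightarrow> l \<notin> J \<Longrightarrow> M $$ (i, l) * M' $$ (l, j) = 0"
  shows "compress e c (M * M') = compress e c M * compress e c M'"
proof (rule eq_matI)
  fix i j assume "i < dim_row (compress e c M * compress e c M')" "j < dim_col (compress e c M * compress e c M')"
  then have ij: "i < c" "j < c" by (auto simp: compress_def)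
  then have eJ: "e i \<in> J" "e j \<in> J" using e(1) by (auto simp: bij_betw_def)
  then have ed: "e i < d" "e j < d" using e(2) by auto
  have "(M * M') $$ (e i, e j) = (\<Sum>l<d. M $$ (e i, l) * M' $$ (l, e j))"
    using M ed by (simp add: scalar_prod_def atLeast0LessThan)
  also have "\<dots> = (\<Sum>l\<in>J. M $$ (e i, l) * M' $$ (l, e j))"
    using e(2) z[OF eJ] by (intro sum.mono_neutral_right) auto
  also have "\<dots> = (\<Sum>l<c. M $$ (e i, e l) * M' $$ (e l, e j))"
    by (rule sum.reindex_bij_betw[OF e(1), symmetric])
  finally show "compress e c (M * M') $$ (i, j) = (compress e c M * compress e c M') $$ (i, j)"
    using ij by (simp add: compress_def scalar_prod_def atLeast0LessThan)
qed (auto simp: compress_def)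

lemma compress_one:
  assumes e: "bij_betw e {..<c} J" "J \<subseteq> {..<d}"
  shows "compress e c (1\<^sub>m d) = 1\<^sub>m c"
proof (rule eq_matI)
  fix i j assume "i < dim_row (1\<^sub>m c :: complex mat)" "j < dim_col (1\<^sub>m c :: complex mat)"
  then have ij: "i < c" "j < c" by auto
  then have "e i < d" "e j < d" "e i = e j \<longleftrightarrow> i = j"
    using e by (auto simp: bij_betw_def inj_on_def)
  then show "compress e c (1\<^sub>m d) $$ (i, j) = 1\<^sub>m c $$ (i, j)"
    using ij by (simp add: compress_def)
qed (auto simp: compress_def)

text \<open>An element acting trivially on an invariant subspace and on its quotient acts by a
  transvection, which is trivial as it has finite order.\<close>

lemma reducible_rep_splits:
  assumes G: "group G" "finite (carrier G)" and \<rho>: "representation G d \<rho>"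
    and W: "invariant_subspace G d \<rho> W" "W \<noteq> {0\<^sub>v d}" "W \<noteq> carrier_vec d"
    and g: "g \<in> carrier G" "\<rho> g \<noteq> 1\<^sub>m d"
  shows "\<exists>d' \<rho>'. d' < d \<and> representation G d' \<rho>' \<and> \<rho>' g \<noteq> 1\<^sub>m d' \<and>
    (\<forall>h\<in>carrier G. \<rho> h = 1\<^sub>m d \<longrightarrow> \<rho>' h = 1\<^sub>m d')"
proof -
  interpret group G by (rule G(1))
  have "\<exists>P Q I. P \<in> carrier_mat d d \<and> Q \<in> carrier_mat d d \<and> P * Q = 1\<^sub>m d \<and> Q * P = 1\<^sub>m d \<and>
    I \<subseteq> {..<d} \<and> (\<forall>v\<in>carrier_vec d. v \<in> W \<longleftrightarrow> (\<forall>i<d. i \<notin> I \<longrightarrow> (Q *\<^sub>v v) $ i = 0))"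
    by (rule complex_subspace_adapted_basis) (use W(1) in \<open>auto simp: invariant_subspace_def\<close>)
  then obtain P Q I where PQ: "P \<in> carrier_mat d d" "Q \<in> carrier_mat d d" "P * Q = 1\<^sub>m d" "Q * P = 1\<^sub>m d"
    and I: "I \<subseteq> {..<d}" and WI: "\<And>v. v \<in> carrier_vec d \<Longrightarrow> v \<in> W \<longleftrightarrow> (\<forall>i<d. i \<notin> I \<longrightarrow> (Q *\<^sub>v v) $ i = 0)"
    by blast
  have car: "\<rho> h \<in> carrier_mat d d" if "h \<in> carrier G" for h
    using \<rho> that by (auto simp: representation_def)
  have mult: "\<rho> (h \<otimes>\<^bsub>G\<^esub> k) = \<rho> h * \<rho> k" if "h \<in> carrier G" "k \<in> carrier G" for h k
    using \<rho> that by (auto simp: representation_def)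
  have one: "\<rho> \<one>\<^bsub>G\<^esub> = 1\<^sub>m d" using \<rho> by (auto simp: representation_def)
  \<comment> \<open>In the adapted basis each \<open>\<sigma> h\<close> is block triangular: rows
    outside \<open>I\<close> vanish in the columns of \<open>I\<close>. The two diagonal blocks are
    the candidates for \<open>\<rho>'\<close>.\<close>
  define \<sigma> where "\<sigma> h = Q * \<rho> h * P" for h
  have scar: "\<sigma> h \<in> carrier_mat d d" if "h \<in> carrier G" for h
    using car[OF that] PQ by (auto simp: \<sigma>_def)
  have smult: "\<sigma> (h \<otimes>\<^bsub>G\<^esub> k) = \<sigma> h * \<sigma> k" if "h \<in> carrier G" "k \<in> carrier G" for h k
  proof -
    have "\<sigma> h * \<sigma> k = Q * \<rho> h * ((P * Q) * (\<rho> k * P))"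
      unfolding \<sigma>_def using car[OF that(1)] car[OF that(2)] PQ(1,2) by (simp add: assoc_mult_mat[of _ d d _ d _ d])
    then show ?thesis unfolding PQ(3) \<sigma>_def mult[OF that]
      using car[OF that(1)] car[OF that(2)] PQ(1,2) by (simp add: assoc_mult_mat[of _ d d _ d _ d])
  qed
  have sone: "\<sigma> h = 1\<^sub>m d" if "\<rho> h = 1\<^sub>m d" for h unfolding \<sigma>_def that using PQ by simp
  have srep: "representation G d \<sigma>"
    unfolding representation_def using scar smult sone[OF one] by auto
  have \<sigma>g: "\<sigma> g \<noteq> 1\<^sub>m d"
  proof
    assume a: "\<sigma> g = 1\<^sub>m d"
    have "P * \<sigma> g * Q = (P * Q) * \<rho> g * (P * Q)"
      unfolding \<sigma>_def using car[OF g(1)] PQ(1,2) by (simp add: assoc_mult_mat[of _ d d _ d _ d])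
    then have "P * \<sigma> g * Q = \<rho> g" unfolding PQ(3) using car[OF g(1)] by simp
    then show False using g(2) PQ unfolding a by simp
  qed
  have zero: "\<sigma> h $$ (i, j) = 0" if h: "h \<in> carrier G" and ij: "i < d" "i \<notin> I" "j \<in> I" for h i j
  proof -
    have jd: "j < d" using ij I by auto
    have Pj: "P *\<^sub>v unit_vec d j \<in> carrier_vec d" using PQ(1) by simp
    have "Q *\<^sub>v (P *\<^sub>v unit_vec d j) = unit_vec d j"
      using PQ assoc_mult_mat_vec[OF PQ(2,1), of "unit_vec d j"] by simp
    then have "P *\<^sub>v unit_vec d j \<in> W" using WI[OF Pj] ij jd by auto
    then have w: "\<rho> h *\<^sub>v (P *\<^sub>v unit_vec d j) \<in> W" using W(1) h by (auto simp: invariant_subspace_def)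
    then have "(Q *\<^sub>v (\<rho> h *\<^sub>v (P *\<^sub>v unit_vec d j))) $ i = 0"
      using WI[of "\<rho> h *\<^sub>v (P *\<^sub>v unit_vec d j)"] ij car[OF h] Pj by auto
    moreover have "Q *\<^sub>v (\<rho> h *\<^sub>v (P *\<^sub>v unit_vec d j)) = \<sigma> h *\<^sub>v unit_vec d j"
      unfolding \<sigma>_def using car[OF h] PQ(1,2) by (simp add: assoc_mult_mat_vec[of _ d d _ d])
    moreover have "(\<sigma> h *\<^sub>v unit_vec d j) $ i = \<sigma> h $$ (i, j)" using scar[OF h] ij(1) jd by simp
    ultimately show ?thesis by simp
  qed
  define I' where "I' = {..<d} - I"
  have finI: "finite I" "finite I'" using I by (auto simp: I'_def intro: finite_subset)
  obtain e where e: "bij_betw e {..<card I} I"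
    using ex_bij_betw_nat_finite[OF finI(1)] by (auto simp: atLeast0LessThan)
  obtain e' where e': "bij_betw e' {..<card I'} I'"
    using ex_bij_betw_nat_finite[OF finI(2)] by (auto simp: atLeast0LessThan)
  have I'd: "I' \<subseteq> {..<d}" by (auto simp: I'_def)
  define \<rho>1 where "\<rho>1 h = compress e (card I) (\<sigma> h)" for h
  define \<rho>2 where "\<rho>2 h = compress e' (card I') (\<sigma> h)" for h
  have rep1: "representation G (card I) \<rho>1"
    unfolding representation_def \<rho>1_def
  proof (intro conjI ballI)
    fix h k assume hk: "h \<in> carrier G" "k \<in> carrier G"
    show "compress e (card I) (\<sigma> (h \<otimes>\<^bsub>G\<^esub> k)) = compress e (card I) (\<sigma> h) * compress e (card I) (\<sigma> k)"
      unfolding smult[OF hk] by (rule compress_mult[OF e I scar scar]) (use hk zero in auto)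
  qed (use sone[OF one] compress_one[OF e I] in \<open>auto simp: compress_def\<close>)
  have rep2: "representation G (card I') \<rho>2"
    unfolding representation_def \<rho>2_def
  proof (intro conjI ballI)
    fix h k assume hk: "h \<in> carrier G" "k \<in> carrier G"
    show "compress e' (card I') (\<sigma> (h \<otimes>\<^bsub>G\<^esub> k)) = compress e' (card I') (\<sigma> h) * compress e' (card I') (\<sigma> k)"
      unfolding smult[OF hk] by (rule compress_mult[OF e' I'd scar scar]) (use hk zero in \<open>auto simp: I'_def\<close>)
  qed (use sone[OF one] compress_one[OF e' I'd] in \<open>auto simp: compress_def\<close>)
  have "I \<noteq> {..<d}"
  proof
    assume "I = {..<d}"
    then have "carrier_vec d \<subseteq> W" using WI by auto
    then show False using W(1,3) by (auto simp: invariant_subspace_def)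
  qed
  moreover have "I \<noteq> {}"
  proof
    assume I0: "I = {}"
    have "w = 0\<^sub>v d" if "w \<in> W" for w
    proof -
      have wc: "w \<in> carrier_vec d" using that W(1) by (auto simp: invariant_subspace_def)
      have "Q *\<^sub>v w = 0\<^sub>v d" using WI[OF wc] that I0 PQ(2) by (intro eq_vecI) (auto simp del: index_mult_mat_vec)
      then have "P *\<^sub>v (Q *\<^sub>v w) = 0\<^sub>v d" using mult_mat_zero_vec[OF PQ(1)] by simp
      then show ?thesis using assoc_mult_mat_vec[OF PQ(1,2) wc] PQ(3) wc by simp
    qed
    then show False using W(1,2) by (auto simp: invariant_subspace_def)
  qed
  ultimately have "I \<subset> {..<d}" "I' \<subset> {..<d}" using I by (auto simp: I'_def)
  then have cd: "card I < d" "card I' < d" by (metis card_lessThan finite_lessThan psubset_card_mono)+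
  have "\<not> (\<rho>1 g = 1\<^sub>m (card I) \<and> \<rho>2 g = 1\<^sub>m (card I'))"
  proof
    assume triv: "\<rho>1 g = 1\<^sub>m (card I) \<and> \<rho>2 g = 1\<^sub>m (card I')"
    have II: "\<sigma> g $$ (i, j) = (if i = j then 1 else 0)" if "i \<in> I" "j \<in> I" for i j
    proof -
      have "i \<in> e ` {..<card I}" "j \<in> e ` {..<card I}"
        by (simp_all only: bij_betw_imp_surj_on[OF e] that)
      then obtain a b where ab: "a < card I" "b < card I" "i = e a" "j = e b" by auto
      then have "\<sigma> g $$ (i, j) = \<rho>1 g $$ (a, b)" by (simp add: \<rho>1_def compress_def)
      moreover have "i = j \<longleftrightarrow> a = b" using ab e by (auto simp: bij_betw_def inj_on_def)
      ultimately show ?thesis using triv ab by simp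
    qed
    have I'I': "\<sigma> g $$ (i, j) = (if i = j then 1 else 0)" if "i \<in> I'" "j \<in> I'" for i j
    proof -
      have "i \<in> e' ` {..<card I'}" "j \<in> e' ` {..<card I'}"
        by (simp_all only: bij_betw_imp_surj_on[OF e'] that)
      then obtain a b where ab: "a < card I'" "b < card I'" "i = e' a" "j = e' b" by auto
      then have "\<sigma> g $$ (i, j) = \<rho>2 g $$ (a, b)" by (simp add: \<rho>2_def compress_def)
      moreover have "i = j \<longleftrightarrow> a = b" using ab e' by (auto simp: bij_betw_def inj_on_def)
      ultimately show ?thesis using triv ab by simp
    qed
    have A: "\<sigma> g \<in> carrier_mat d d" by (rule scar[OF g(1)])
    have N: "\<sigma> g ^\<^sub>m Coset.order G = 1\<^sub>m d" by (rule representation_finite_order[OF G srep g(1)])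
    have N0: "Coset.order G > 0" using G(2) by (simp add: order_gt_0_iff_finite)
    have colI: "\<sigma> g *\<^sub>v unit_vec d j = unit_vec d j" if j: "j \<in> I" for j
    proof (rule eq_vecI)
      fix i assume "i < dim_vec (unit_vec d j :: complex vec)"
      then have i: "i < d" by simp
      have "(\<sigma> g *\<^sub>v unit_vec d j) $ i = \<sigma> g $$ (i, j)" using A i j I by auto
      then show "(\<sigma> g *\<^sub>v unit_vec d j) $ i = unit_vec d j $ i"
        using II[OF _ j, of i] zero[OF g(1) i _ j] i j I by (cases "i \<in> I") auto
    qed (use A in auto)
    have fixI: "\<sigma> g *\<^sub>v w = w" if w: "w \<in> carrier_vec d" "\<And>i. i < d \<Longrightarrow> i \<notin> I \<Longrightarrow> w $ i = 0" for w
    proof (rule eq_vecI)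
      fix i assume "i < dim_vec w"
      then have i: "i < d" using w by simp
      have "(\<sigma> g *\<^sub>v w) $ i = (\<Sum>j\<in>{0..<d}. \<sigma> g $$ (i, j) * w $ j)"
        using A w i by (simp add: scalar_prod_def)
      also have "\<dots> = (\<Sum>j\<in>{0..<d}. if i = j then w $ j else 0)"
      proof (rule sum.cong[OF refl])
        fix j assume j: "j \<in> {0..<d}"
        show "\<sigma> g $$ (i, j) * w $ j = (if i = j then w $ j else 0)"
        proof (cases "j \<in> I")
          case True
          then show ?thesis using II[OF _ True, of i] zero[OF g(1) i _ True] by (cases "i \<in> I") auto
        next
          case False
          then show ?thesis using w(2)[of j] j by auto
        qed
      qed
      also have "\<dots> = w $ i" using i by simp
      finally show "(\<sigma> g *\<^sub>v w) $ i = w $ i" .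
    qed (use A w in auto)
    have "\<sigma> g *\<^sub>v unit_vec d j = 1 \<cdot>\<^sub>v unit_vec d j" if j: "j < d" for j
    proof (cases "j \<in> I")
      case True
      then show ?thesis using colI by simp
    next
      case False
      then have jI': "j \<in> I'" using j by (simp add: I'_def)
      define w where "w = vec d (\<lambda>i. if i \<in> I then \<sigma> g $$ (i, j) else 0)"
      have w: "w \<in> carrier_vec d" by (simp add: w_def)
      have eq: "\<sigma> g *\<^sub>v unit_vec d j = 1 \<cdot>\<^sub>v unit_vec d j + w"
      proof (rule eq_vecI)
        fix i assume "i < dim_vec (1 \<cdot>\<^sub>v unit_vec d j + w)"
        then have i: "i < d" using w by simp
        have "(\<sigma> g *\<^sub>v unit_vec d j) $ i = \<sigma> g $$ (i, j)" using A i j by simp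
        then show "(\<sigma> g *\<^sub>v unit_vec d j) $ i = (1 \<cdot>\<^sub>v unit_vec d j + w) $ i"
          using I'I'[OF _ jI', of i] i j False by (cases "i \<in> I") (auto simp: w_def I'_def)
      qed (use A w in auto)
      have "\<sigma> g *\<^sub>v w = 1 \<cdot>\<^sub>v w" using fixI[OF w] by (simp add: w_def)
      then have "w = 0\<^sub>v d" by (intro finite_order_no_shear[OF A N N0 _ w eq]) simp_all
      then show ?thesis unfolding eq by simp
    qed
    then have "\<sigma> g = 1 \<cdot>\<^sub>m 1\<^sub>m d" by (rule mat_eq_oneI[OF A])
    then show False using \<sigma>g unfolding one_smult_one_mat by blast
  qed
  moreover have "\<rho>1 h = 1\<^sub>m (card I)" "\<rho>2 h = 1\<^sub>m (card I')" if "\<rho> h = 1\<^sub>m d" for h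
    using sone[OF that] compress_one[OF e I] compress_one[OF e' I'd] by (auto simp: \<rho>1_def \<rho>2_def)
  ultimately show ?thesis using rep1 rep2 cd by blast
qed

text \<open>Descent on the dimension: at each splitting one of the two blocks still moves
  \<open>g\<close>. The last clause carries the kernel along, so that a representation lifted from a
  quotient remains trivial on the normal subgroup.\<close>

lemma ex_irreducible_rep:
  assumes G: "group G" "finite (carrier G)" and g: "g \<in> carrier G"
  shows "representation G d \<rho> \<Longrightarrow> \<rho> g \<noteq> 1\<^sub>m d \<Longrightarrow>
    \<exists>d' \<rho>'. irreducible_rep G d' \<rho>' \<and> \<rho>' g \<noteq> 1\<^sub>m d' \<and> (\<forall>h\<in>carrier G. \<rho> h = 1\<^sub>m d \<longrightarrow> \<rho>' h = 1\<^sub>m d')"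
proof (induction d arbitrary: \<rho> rule: less_induct)
  case (less d)
  have d0: "d > 0"
  proof (rule ccontr)
    assume "\<not> d > 0"
    then have "\<rho> g = 1\<^sub>m d" using less.prems(1) g by (intro eq_matI) (auto simp: representation_def)
    then show False using less.prems(2) by simp
  qed
  show ?case
  proof (cases "irreducible_rep G d \<rho>")
    case True
    then show ?thesis using less.prems by blast
  next
    case False
    then obtain W where W: "invariant_subspace G d \<rho> W" "W \<noteq> {0\<^sub>v d}" "W \<noteq> carrier_vec d"
      using d0 less.prems(1) by (auto simp: irreducible_rep_def)
    obtain d1 \<rho>1 where 1: "d1 < d" "representation G d1 \<rho>1" "\<rho>1 g \<noteq> 1\<^sub>m d1"
        "\<And>h. h \<in> carrier G \<Longrightarrow> \<rho> h = 1\<^sub>m d \<Longrightarrow> \<rho>1 h = 1\<^sub>m d1"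
      using reducible_rep_splits[OF G less.prems(1) W g less.prems(2)] by blast
    from less.IH[OF 1(1-3)] 1(4) show ?thesis by blast
  qed
qed

text \<open>The regular representation by permutation matrices: \<open>g\<close> sends the basis
  vector of \<open>q j\<close> to that of \<open>g\<close> times \<open>q j\<close>, and the image
  of the unit recovers \<open>g\<close>.\<close>

lemma faithful_representation:
  assumes Q: "group Q" "finite (carrier Q)"
  shows "\<exists>R. representation Q (card (carrier Q)) R \<and> (\<forall>g\<in>carrier Q. R g = 1\<^sub>m (card (carrier Q)) \<longrightarrow> g = \<one>\<^bsub>Q\<^esub>)"
proof -
  interpret Q: group Q by (rule Q(1))
  define d where "d = card (carrier Q)"
  obtain q where q: "bij_betw q {..<d} (carrier Q)"
    using ex_bij_betw_nat_finite[OF Q(2)] by (auto simp: atLeast0LessThan d_def)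
  have qc: "q i \<in> carrier Q" if "i < d" for i using q that by (auto simp: bij_betw_def)
  have qi: "q i = q j \<longleftrightarrow> i = j" if "i < d" "j < d" for i j using q that by (auto simp: bij_betw_def inj_on_def)
  have qs: "\<exists>i<d. q i = x" if "x \<in> carrier Q" for x using that unfolding bij_betw_imp_surj_on[OF q, symmetric] by auto
  define R :: "'a \<Rightarrow> complex mat" where "R g = mat d d (\<lambda>(i, j). if q i = g \<otimes>\<^bsub>Q\<^esub> q j then 1 else 0)" for g
  have "representation Q d R"
    unfolding representation_def
  proof (intro conjI ballI)
    show "R \<one>\<^bsub>Q\<^esub> = 1\<^sub>m d" by (intro eq_matI) (auto simp: R_def qi qc)
  next
    fix g h assume gh: "g \<in> carrier Q" "h \<in> carrier Q"
    show "R (g \<otimes>\<^bsub>Q\<^esub> h) = R g * R h"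
    proof (rule eq_matI)
      fix i j assume "i < dim_row (R g * R h)" "j < dim_col (R g * R h)"
      then have ij: "i < d" "j < d" by (auto simp: R_def)
      obtain l where l: "l < d" "q l = h \<otimes>\<^bsub>Q\<^esub> q j" using qs[of "h \<otimes>\<^bsub>Q\<^esub> q j"] gh qc[OF ij(2)] by auto
      have "(R g * R h) $$ (i, j) = (\<Sum>m\<in>{0..<d}. (if q i = g \<otimes>\<^bsub>Q\<^esub> q m then 1 else 0) * (if q m = h \<otimes>\<^bsub>Q\<^esub> q j then 1 else 0))"
        using ij by (simp add: R_def scalar_prod_def)
      also have "\<dots> = (\<Sum>m\<in>{0..<d}. if m = l then (if q i = g \<otimes>\<^bsub>Q\<^esub> q l then 1 else 0) else 0)"
        using l by (intro sum.cong refl) (auto simp: qi l(2)[symmetric])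
      also have "\<dots> = (if q i = g \<otimes>\<^bsub>Q\<^esub> q l then 1 else 0)" using l(1) by simp
      finally show "R (g \<otimes>\<^bsub>Q\<^esub> h) $$ (i, j) = (R g * R h) $$ (i, j)"
        using ij l(2) gh qc[OF ij(2)] by (simp add: R_def Q.m_assoc)
    qed (auto simp: R_def)
  qed (auto simp: R_def)
  moreover have "g = \<one>\<^bsub>Q\<^esub>" if g: "g \<in> carrier Q" "R g = 1\<^sub>m d" for g
  proof -
    obtain i where i: "i < d" "q i = \<one>\<^bsub>Q\<^esub>" using qs[of "\<one>\<^bsub>Q\<^esub>"] by auto
    have "R g $$ (i, i) = 1" using g(2) i(1) by simp
    then have "q i = g \<otimes>\<^bsub>Q\<^esub> q i" using i(1) by (simp add: R_def split: if_splits)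
    then show ?thesis using i(2) g(1) by simp
  qed
  ultimately show ?thesis unfolding d_def by blast
qed

section \<open>Commutators and pairings\<close>

abbreviation cmt :: "('a, 'b) monoid_scheme \<Rightarrow> 'a \<Rightarrow> 'a \<Rightarrow> 'a" where
  "cmt G x y \<equiv> inv\<^bsub>G\<^esub> x \<otimes>\<^bsub>G\<^esub> inv\<^bsub>G\<^esub> y \<otimes>\<^bsub>G\<^esub> x \<otimes>\<^bsub>G\<^esub> y"

text \<open>For normal \<open>N\<close> this is the preimage in \<open>G\<close> of the center of
  \<open>G / N\<close>. Commutators express it without cosets, so most arguments stay inside
  \<open>G\<close>.\<close>

definition center_mod :: "('a, 'b) monoid_scheme \<Rightarrow> 'a set \<Rightarrow> 'a set" where
  "center_mod G N = {g \<in> carrier G. \<forall>h \<in> carrier G. cmt G g h \<in> N}"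

context group begin

lemma inv_cancel [simp]:
  "x \<in> carrier G \<Longrightarrow> y \<in> carrier G \<Longrightarrow> inv x \<otimes> (x \<otimes> y) = y"
  "x \<in> carrier G \<Longrightarrow> y \<in> carrier G \<Longrightarrow> x \<otimes> (inv x \<otimes> y) = y"
  by (simp_all add: m_assoc[symmetric])

lemma cmt_closed: "x \<in> carrier G \<Longrightarrow> y \<in> carrier G \<Longrightarrow> cmt G x y \<in> carrier G"
  by simp

lemma mult_cmt: "x \<in> carrier G \<Longrightarrow> y \<in> carrier G \<Longrightarrow> y \<otimes> x \<otimes> cmt G x y = x \<otimes> y"
  by (simp add: m_assoc)

lemma cmt_self: "x \<in> carrier G \<Longrightarrow> cmt G x x = \<one>"
  by (simp add: m_assoc)

lemma cmt_one: "x \<in> carrier G \<Longrightarrow> cmt G x \<one> = \<one>" "x \<in> carrier G \<Longrightarrow> cmt G \<one> x = \<one>"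
  by (simp_all add: m_assoc)

lemma cmt_eq_one_iff:
  "x \<in> carrier G \<Longrightarrow> y \<in> carrier G \<Longrightarrow> cmt G x y = \<one> \<longleftrightarrow> x \<otimes> y = y \<otimes> x"
  using mult_cmt[of x y] l_cancel_one[of "y \<otimes> x" "cmt G x y"] cmt_closed[of x y] by auto

lemma inv_cmt: "x \<in> carrier G \<Longrightarrow> y \<in> carrier G \<Longrightarrow> inv (cmt G x y) = cmt G y x"
  by (simp add: inv_mult_group m_assoc)

lemma cmt_mult_right:
  "x \<in> carrier G \<Longrightarrow> y \<in> carrier G \<Longrightarrow> z \<in> carrier G \<Longrightarrow>
   cmt G x (y \<otimes> z) = cmt G x z \<otimes> (cmt G x y \<otimes> cmt G (cmt G x y) z)"
  by (simp add: inv_mult_group m_assoc)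

lemma cmt_mult_left:
  "x \<in> carrier G \<Longrightarrow> y \<in> carrier G \<Longrightarrow> z \<in> carrier G \<Longrightarrow>
   cmt G (x \<otimes> y) z = cmt G x z \<otimes> cmt G (cmt G x z) y \<otimes> cmt G y z"
  by (simp add: inv_mult_group m_assoc)

lemma conj_eq_mult_cmt:
  "x \<in> carrier G \<Longrightarrow> g \<in> carrier G \<Longrightarrow> g \<otimes> x \<otimes> inv g = x \<otimes> cmt G x (inv g)"
  by (simp add: m_assoc)


lemma normal_cmt_mem:
  assumes N: "N \<lhd> G" and x: "x \<in> N" and g: "g \<in> carrier G"
  shows "cmt G x g \<in> N" "cmt G g x \<in> N"
proof -
  interpret N: normal N G by (rule N)
  have "inv x \<otimes> (inv g \<otimes> x \<otimes> g) \<in> N" using x N.inv_op_closed1[OF g x] by blast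
  then show 1: "cmt G x g \<in> N" using x g by (simp add: m_assoc)
  have "inv (cmt G x g) \<in> N" using 1 by blast
  then show "cmt G g x \<in> N" using x g inv_cmt[of x g] by simp
qed

lemma normalI_cmt:
  assumes "subgroup S G" and "\<And>x g. x \<in> S \<Longrightarrow> g \<in> carrier G \<Longrightarrow> cmt G x g \<in> S"
  shows "S \<lhd> G"
  unfolding normal_inv_iff
proof (intro conjI ballI assms(1))
  interpret S: subgroup S G by (rule assms(1))
  fix g x assume g: "g \<in> carrier G" and x: "x \<in> S"
  have "x \<otimes> cmt G x (inv g) \<in> S" using x assms(2)[OF x, of "inv g"] g by blast
  then show "g \<otimes> x \<otimes> inv g \<in> S" using g x conj_eq_mult_cmt[of x g] by simp
qed

lemma center_mod_subset: "center_mod G N \<subseteq> carrier G"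
  by (auto simp: center_mod_def)

lemma center_mod_mono: "N \<subseteq> M \<Longrightarrow> center_mod G N \<subseteq> center_mod G M"
  by (auto simp: center_mod_def)

lemma subset_center_mod: "N \<lhd> G \<Longrightarrow> N \<subseteq> center_mod G N"
  using normal_cmt_mem normal_imp_subgroup subgroup.mem_carrier by (fastforce simp: center_mod_def)

lemma center_mod_normal:
  assumes N: "N \<lhd> G"
  shows "center_mod G N \<lhd> G"
proof (rule normalI_cmt)
  interpret N: normal N G by (rule N)
  show "subgroup (center_mod G N) G"
  proof (rule subgroupI)
    have "\<one> \<in> center_mod G N" by (auto simp: center_mod_def cmt_one)
    then show "center_mod G N \<noteq> {}" by blast
  next
    fix a assume a: "a \<in> center_mod G N"
    then have ac: "a \<in> carrier G" by (simp add: center_mod_def)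
    have "cmt G (inv a) h \<in> N" if h: "h \<in> carrier G" for h
    proof -
      have "cmt G a h \<in> N" using a h by (simp add: center_mod_def)
      then have "a \<otimes> inv (cmt G a h) \<otimes> inv a \<in> N" using N.inv_op_closed2[OF ac] by blast
      moreover have "a \<otimes> inv (cmt G a h) \<otimes> inv a = cmt G (inv a) h"
        using ac h by (simp add: inv_mult_group m_assoc)
      ultimately show ?thesis by simp
    qed
    then show "inv a \<in> center_mod G N" using ac by (simp add: center_mod_def)
  next
    fix a b assume a: "a \<in> center_mod G N" and b: "b \<in> center_mod G N"
    then have ac: "a \<in> carrier G" "b \<in> carrier G" by (auto simp: center_mod_def)
    have "cmt G (a \<otimes> b) h \<in> N" if h: "h \<in> carrier G" for h
    proof -
      have 1: "cmt G a h \<in> N" "cmt G b h \<in> N" using a b h by (auto simp: center_mod_def)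
      have 2: "cmt G (cmt G a h) b \<in> N" by (rule normal_cmt_mem[OF N 1(1) ac(2)])
      show ?thesis unfolding cmt_mult_left[OF ac h] using 1 2 by blast
    qed
    then show "a \<otimes> b \<in> center_mod G N" using ac by (simp add: center_mod_def)
  qed (rule center_mod_subset)
next
  fix x g assume x: "x \<in> center_mod G N" and g: "g \<in> carrier G"
  then have "cmt G x g \<in> N" by (simp add: center_mod_def)
  then show "cmt G x g \<in> center_mod G N" using subset_center_mod[OF N] by blast
qed

lemma comm_subgroup_subset_iff:
  assumes "A \<subseteq> carrier G" "B \<subseteq> carrier G" "subgroup S G"
  shows "comm_subgroup G A B \<subseteq> S \<longleftrightarrow> (\<forall>a\<in>A. \<forall>b\<in>B. cmt G a b \<in> S)"
proof
  assume "comm_subgroup G A B \<subseteq> S"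
  then show "\<forall>a\<in>A. \<forall>b\<in>B. cmt G a b \<in> S"
    unfolding comm_subgroup_def by (blast intro: generate.incl)
next
  assume "\<forall>a\<in>A. \<forall>b\<in>B. cmt G a b \<in> S"
  then show "comm_subgroup G A B \<subseteq> S"
    unfolding comm_subgroup_def by (intro generate_subgroup_incl assms(3)) blast
qed

lemma comm_subgroup_subgroup:
  assumes "A \<subseteq> carrier G" "B \<subseteq> carrier G"
  shows "subgroup (comm_subgroup G A B) G"
  unfolding comm_subgroup_def using assms by (intro generate_is_subgroup) blast

lemma cmt_in_comm_subgroup: "a \<in> A \<Longrightarrow> b \<in> B \<Longrightarrow> cmt G a b \<in> comm_subgroup G A B"
  unfolding comm_subgroup_def by (blast intro: generate.incl)

lemma comm_subgroup_normal:
  assumes M: "M \<lhd> G"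
  shows "comm_subgroup G M (carrier G) \<lhd> G" "comm_subgroup G M (carrier G) \<subseteq> M"
proof -
  interpret M: normal M G by (rule M)
  show sub: "comm_subgroup G M (carrier G) \<subseteq> M"
    using comm_subgroup_subset_iff[of M "carrier G" M] normal_cmt_mem[OF M] M.subset M.subgroup_axioms
    by blast
  show "comm_subgroup G M (carrier G) \<lhd> G"
    by (rule normalI_cmt) (use M.subset sub in \<open>blast intro: comm_subgroup_subgroup cmt_in_comm_subgroup\<close>)+
qed

end

section \<open>Complex valued pairings of finite groups\<close>

lemma sum_character_eq_0:
  fixes h :: "'a \<Rightarrow> complex"
  assumes B: "subgroup B G" "group G"
    and h: "\<And>x y. x \<in> B \<Longrightarrow> y \<in> B \<Longrightarrow> h (x \<otimes>\<^bsub>G\<^esub> y) = h x * h y"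
    and b: "b \<in> B" "h b \<noteq> 1"
  shows "(\<Sum>y\<in>B. h y) = 0"
proof -
  interpret group G by (rule B(2))
  interpret B: subgroup B G by (rule B(1))
  have "(\<Sum>y\<in>B. h y) = (\<Sum>y\<in>B. h (b \<otimes>\<^bsub>G\<^esub> y))"
    by (rule sum.reindex_bij_witness[of _ "\<lambda>y. b \<otimes>\<^bsub>G\<^esub> y" "\<lambda>y. inv\<^bsub>G\<^esub> b \<otimes>\<^bsub>G\<^esub> y"])
      (use b(1) in \<open>auto simp: m_assoc[symmetric] B.mem_carrier\<close>)
  also have "\<dots> = h b * (\<Sum>y\<in>B. h y)"
    using h b(1) by (simp add: sum_distrib_left)
  finally show ?thesis using b(2) by simp
qed

text \<open>Double counting of the sum of all values of a pairing replaces duality theory.\<close>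

lemma card_pairing_kernels:
  fixes f :: "'a \<Rightarrow> 'a \<Rightarrow> complex"
  assumes G: "group G" and A: "subgroup A G" and B: "subgroup B G"
    and fl: "\<And>x y z. x \<in> A \<Longrightarrow> y \<in> A \<Longrightarrow> z \<in> B \<Longrightarrow> f (x \<otimes>\<^bsub>G\<^esub> y) z = f x z * f y z"
    and fr: "\<And>x y z. x \<in> A \<Longrightarrow> y \<in> B \<Longrightarrow> z \<in> B \<Longrightarrow> f x (y \<otimes>\<^bsub>G\<^esub> z) = f x y * f x z"
    and fin: "finite A" "finite B"
  shows "card A * card {b \<in> B. \<forall>a\<in>A. f a b = 1} = card B * card {a \<in> A. \<forall>b\<in>B. f a b = 1}"
proof -
  have 1: "(\<Sum>b\<in>B. f a b) = (if \<forall>b\<in>B. f a b = 1 then of_nat (card B) else 0)" if "a \<in> A" for a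
    using sum_character_eq_0[OF B G, of "f a"] fr[OF that] by auto
  have 2: "(\<Sum>a\<in>A. f a b) = (if \<forall>a\<in>A. f a b = 1 then of_nat (card A) else 0)" if "b \<in> B" for b
    using sum_character_eq_0[OF A G, of "\<lambda>a. f a b"] fl[OF _ _ that] by auto
  have "of_nat (card B * card {a \<in> A. \<forall>b\<in>B. f a b = 1}) = (\<Sum>a\<in>A. \<Sum>b\<in>B. f a b)"
    using fin by (simp add: 1 sum.If_cases Int_def)
  also have "\<dots> = (\<Sum>b\<in>B. \<Sum>a\<in>A. f a b)" by (rule sum.swap)
  also have "\<dots> = of_nat (card A * card {b \<in> B. \<forall>a\<in>A. f a b = 1})"
    using fin by (simp add: 2 sum.If_cases Int_def)
  finally have eq: "(of_nat (card B * card {a \<in> A. \<forall>b\<in>B. f a b = 1}) :: complex) =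
    of_nat (card A * card {b \<in> B. \<forall>a\<in>A. f a b = 1})" .
  show ?thesis by (rule of_nat_eq_iff[THEN iffD1, OF eq, symmetric])
qed

lemma subgroup_card_dvd:
  assumes G: "group G" and H: "subgroup H G" and K: "subgroup K G" and "K \<subseteq> H" and fin: "finite (carrier G)"
  shows "card K dvd card H"
proof -
  interpret H: group "G\<lparr>carrier := H\<rparr>" by (rule group.subgroup_imp_group[OF G H])
  have "subgroup K (G\<lparr>carrier := H\<rparr>)" by (rule group.subgroup_incl[OF G K H assms(4)])
  from H.lagrange[OF this]
  have "card H = card K * card (rcosets\<^bsub>G\<lparr>carrier := H\<rparr>\<^esub> K)" by (simp add: Coset.order_def mult.commute)
  then show ?thesis by (rule dvdI)
qed

locale alternating_pairing = group G for G (structure) +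
  fixes f :: "'a \<Rightarrow> 'a \<Rightarrow> complex"
  assumes fin: "finite (carrier G)"
    and mult_left: "\<And>x y z. x \<in> carrier G \<Longrightarrow> y \<in> carrier G \<Longrightarrow> z \<in> carrier G \<Longrightarrow> f (x \<otimes> y) z = f x z * f y z"
    and mult_right: "\<And>x y z. x \<in> carrier G \<Longrightarrow> y \<in> carrier G \<Longrightarrow> z \<in> carrier G \<Longrightarrow> f x (y \<otimes> z) = f x y * f x z"
    and alt: "\<And>x. x \<in> carrier G \<Longrightarrow> f x x = 1"
begin

definition radical where "radical = {x \<in> carrier G. \<forall>y \<in> carrier G. f x y = 1}"

text \<open>Expand \<open>f (x \<otimes> y) (x \<otimes> y) = 1\<close>. In particular all values of
  the pairing are nonzero.\<close>

lemma swap: "x \<in> carrier G \<Longrightarrow> y \<in> carrier G \<Longrightarrow> f x y * f y x = 1"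
  using alt[of "x \<otimes> y"] alt[of x] alt[of y] mult_left[of x y "x \<otimes> y"] mult_right[of x x y] mult_right[of y x y]
  by (simp add: mult_ac)

lemma swap_eq_1: "x \<in> carrier G \<Longrightarrow> y \<in> carrier G \<Longrightarrow> f x y = 1 \<longleftrightarrow> f y x = 1"
  using swap[of x y] by auto

lemma one_left: "x \<in> carrier G \<Longrightarrow> f \<one> x = 1"
  using mult_left[of \<one> \<one> x] swap[of \<one> x] by auto

lemma perp_subgroup:
  assumes "S \<subseteq> carrier G"
  shows "subgroup {g \<in> carrier G. \<forall>s\<in>S. f g s = 1} G"
proof (rule subgroupI)
  show "{g \<in> carrier G. \<forall>s\<in>S. f g s = 1} \<noteq> {}" using one_left assms by blast
next
  fix a assume a: "a \<in> {g \<in> carrier G. \<forall>s\<in>S. f g s = 1}"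
  have "f (inv a) s = 1" if "s \<in> S" for s
    using mult_left[of a "inv a" s] one_left[of s] a that assms by auto
  then show "inv a \<in> {g \<in> carrier G. \<forall>s\<in>S. f g s = 1}" using a by simp
qed (use mult_left assms in auto)

lemma radical_subset: "radical \<subseteq> carrier G"
  by (auto simp: radical_def)

lemma radical_subgroup: "subgroup radical G"
  unfolding radical_def by (rule perp_subgroup) simp

lemma card_perp:
  assumes "subgroup A G"
  shows "card A * card {g \<in> carrier G. \<forall>a\<in>A. f a g = 1} = card (carrier G) * card {a \<in> A. \<forall>g\<in>carrier G. f a g = 1}"
proof -
  interpret A: subgroup A G by (rule assms)
  show ?thesis
    by (rule card_pairing_kernels[OF group_axioms assms subgroup_self])
       (use mult_left mult_right A.subset fin finite_subset[OF A.subset fin] in auto)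
qed

text \<open>An isotropic subgroup lies in its own annihilator, whose order \<open>card_perp\<close>
  computes in terms of the part of \<open>A\<close> inside the radical.\<close>

lemma card_isotropic_le:
  assumes A: "subgroup A G" and iso: "\<And>x y. x \<in> A \<Longrightarrow> y \<in> A \<Longrightarrow> f x y = 1"
  shows "card A * card A \<le> card (carrier G) * card radical"
proof -
  interpret A: subgroup A G by (rule A)
  have "card A * card A \<le> card A * card {g \<in> carrier G. \<forall>a\<in>A. f a g = 1}"
    using iso A.subset fin by (intro mult_le_mono le_refl card_mono) auto
  also have "\<dots> = card (carrier G) * card {a \<in> A. \<forall>g\<in>carrier G. f a g = 1}" by (rule card_perp[OF A])
  also have "\<dots> \<le> card (carrier G) * card radical"
    using A.subset finite_subset[OF radical_subset fin] by (intro mult_le_mono le_refl card_mono) (auto simp: radical_def)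
  finally show ?thesis .
qed

text \<open>A maximal isotropic set is a subgroup that equals its own annihilator.\<close>

lemma index_radical_square: "\<exists>k. card (carrier G) div card radical = k ^ 2"
proof -
  \<comment> \<open>Arbitrary isotropic sets, so that adjoining a single element of the annihilator
    visibly preserves isotropy. The maximal set is a subgroup afterwards, because it equals an
    annihilator.\<close>
  define I where "I = {S. S \<subseteq> carrier G \<and> (\<forall>x\<in>S. \<forall>y\<in>S. f x y = 1)}"
  have "finite I" using fin by (auto simp: I_def)
  moreover have "{} \<in> I" by (simp add: I_def)
  ultimately obtain A where A: "A \<in> I" "\<And>S. S \<in> I \<Longrightarrow> A \<subseteq> S \<Longrightarrow> S = A"
    using finite_has_maximal2[of I "{}"] by metis
  have Ac: "A \<subseteq> carrier G" using A(1) by (simp add: I_def)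
  have perp: "{g \<in> carrier G. \<forall>a\<in>A. f g a = 1} = A"
  proof
    show "A \<subseteq> {g \<in> carrier G. \<forall>a\<in>A. f g a = 1}" using A(1) by (auto simp: I_def)
    show "{g \<in> carrier G. \<forall>a\<in>A. f g a = 1} \<subseteq> A"
    proof
      fix g assume g: "g \<in> {g \<in> carrier G. \<forall>a\<in>A. f g a = 1}"
      then have "f a g = 1" if "a \<in> A" for a using swap_eq_1[of a g] that Ac by auto
      then have "insert g A \<in> I" using g A(1) alt by (auto simp: I_def)
      from A(2)[OF this] show "g \<in> A" by blast
    qed
  qed
  then have subA: "subgroup A G" using perp_subgroup[OF Ac] by simp
  have radA: "radical \<subseteq> A" using Ac by (subst perp[symmetric]) (auto simp: radical_def)
  have "{g \<in> carrier G. \<forall>a\<in>A. f a g = 1} = A"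
    using perp swap_eq_1 Ac by blast
  moreover have "{a \<in> A. \<forall>g\<in>carrier G. f a g = 1} = radical"
    using radA Ac by (auto simp: radical_def)
  ultimately have eq: "card A * card A = card (carrier G) * card radical"
    using card_perp[OF subA] by simp
  obtain m where m: "card A = card radical * m"
    using subgroup_card_dvd[OF group_axioms subA radical_subgroup radA fin] by (auto elim: dvdE)
  have "card radical > 0"
    using radical_subgroup fin by (metis card_gt_0_iff empty_iff finite_subset subgroup.one_closed subgroup.subset)
  moreover have "card radical * card (carrier G) = card radical * (card radical * m ^ 2)"
    using eq[symmetric] m by (simp add: power2_eq_square mult_ac)
  ultimately have "card (carrier G) = card radical * m ^ 2"
    by (metis mult_cancel1 less_numeral_extra(3))
  then show ?thesis using \<open>card radical > 0\<close> by (metis nonzero_mult_div_cancel_left less_numeral_extra(3))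
qed

end

section \<open>Kernels and centers of irreducible characters\<close>

lemma smult_smult_mat: "a \<cdot>\<^sub>m (b \<cdot>\<^sub>m (A :: complex mat)) = (a * b) \<cdot>\<^sub>m A"
  by (intro eq_matI) auto

text \<open>The data that an irreducible character leaves behind: its kernel \<open>K\<close>, its center \<open>Z\<close>,
  and the linear character \<open>f\<close> by which \<open>Z\<close> acts.\<close>

definition central_char :: "('a, 'b) monoid_scheme \<Rightarrow> 'a set \<Rightarrow> 'a set \<Rightarrow> ('a \<Rightarrow> complex) \<Rightarrow> bool" where
  "central_char G Z K f \<longleftrightarrow> K \<lhd> G \<and> Z = center_mod G K \<and>
     (\<forall>x\<in>Z. \<forall>y\<in>Z. f (x \<otimes>\<^bsub>G\<^esub> y) = f x * f y) \<and> K = {x \<in> Z. f x = 1}"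

text \<open>Three conditions on \<open>g\<close> coincide: \<open>\<chi> g\<close> has maximal
  modulus, \<open>\<rho> g\<close> is scalar, and all commutators \<open>cmt G g h\<close> lie in
  the kernel. The first implies the second by finite order, the third implies it by Schur's lemma.
  On scalar matrices the entry \<open>(0, 0)\<close> reads off the scalar, which gives the linear
  character.\<close>

lemma irreducible_rep_central_char:
  assumes G: "group G" "finite (carrier G)" and irr: "irreducible_rep G d \<rho>"
    and \<chi>: "\<chi> = (\<lambda>g. if g \<in> carrier G then mat_trace (\<rho> g) else 0)"
  shows "central_char G (char_center G \<chi>) {g \<in> carrier G. \<rho> g = 1\<^sub>m d} (\<lambda>g. \<rho> g $$ (0, 0))"
proof -
  interpret group G by (rule G(1))
  have d: "d > 0" and \<rho>: "representation G d \<rho>" using irr by (auto simp: irreducible_rep_def)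
  have car: "\<rho> g \<in> carrier_mat d d" if "g \<in> carrier G" for g
    using \<rho> that by (auto simp: representation_def)
  have mult: "\<rho> (g \<otimes>\<^bsub>G\<^esub> h) = \<rho> g * \<rho> h" if "g \<in> carrier G" "h \<in> carrier G" for g h
    using \<rho> that by (auto simp: representation_def)
  have one: "\<rho> \<one>\<^bsub>G\<^esub> = 1\<^sub>m d" using \<rho> by (auto simp: representation_def)
  define K where "K = {g \<in> carrier G. \<rho> g = 1\<^sub>m d}"
  have K: "K \<lhd> G" unfolding K_def by (rule representation_kernel_normal[OF G(1) \<rho>])
  have N0: "Coset.order G > 0" using G(2) by (simp add: order_gt_0_iff_finite)
  have tr: "mat_trace (c \<cdot>\<^sub>m 1\<^sub>m d) = of_nat d * c" for c :: complex
    by (simp add: mat_trace_def)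
  have \<chi>1: "\<chi> \<one>\<^bsub>G\<^esub> = of_nat d" using tr[of 1] unfolding one_smult_one_mat by (simp add: \<chi> one)
  have scalar: "\<exists>c. \<rho> g = c \<cdot>\<^sub>m 1\<^sub>m d" if g: "g \<in> char_center G \<chi>" for g
  proof -
    have gc: "g \<in> carrier G" and "complex_of_real (cmod (mat_trace (\<rho> g))) = of_real (of_nat d)"
      using g \<chi>1 by (auto simp: char_center_def \<chi>)
    then have "cmod (mat_trace (\<rho> g)) = d" by (simp only: of_real_eq_iff)
    then show ?thesis
      by (rule finite_order_trace_scalar[OF car[OF gc] representation_finite_order[OF G \<rho> gc] N0])
  qed
  \<comment> \<open>Conversely a scalar value is a root of unity, since \<open>\<rho> g\<close> has
    finite order, so the trace has modulus \<open>d\<close>.\<close>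
  have in_center: "g \<in> char_center G \<chi>" if g: "g \<in> carrier G" and c: "\<rho> g = c \<cdot>\<^sub>m 1\<^sub>m d" for g c
  proof -
    have pow: "\<rho> g ^\<^sub>m k = c ^ k \<cdot>\<^sub>m 1\<^sub>m d" for k
    proof (induction k)
      case 0
      then show ?case using car[OF g] by (simp add: one_smult_one_mat)
    next
      case (Suc k)
      then show ?case unfolding pow_mat.simps(2) c
        by (simp add: mult_smult_distrib[of _ d d _ d] mult_smult_assoc_mat[of _ d d _ d] smult_smult_mat mult.commute)
    qed
    have "c ^ Coset.order G \<cdot>\<^sub>m 1\<^sub>m d = (1\<^sub>m d :: complex mat)"
      using pow[of "Coset.order G"] representation_finite_order[OF G \<rho> g] by simp
    then have "(c ^ Coset.order G \<cdot>\<^sub>m 1\<^sub>m d) $$ (0, 0) = (1\<^sub>m d :: complex mat) $$ (0, 0)" by simp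
    then have "c ^ Coset.order G = 1" using d by simp
    then have "cmod c ^ Coset.order G = 1" by (metis norm_one norm_power)
    then have "cmod c = 1" 
      using power_eq_imp_eq_base[of "cmod c" "Coset.order G" 1] N0 by simp
    then show ?thesis using g \<chi>1 by (simp add: char_center_def \<chi> c tr norm_mult)
  qed
  have comm_iff: "cmt G g h \<in> K \<longleftrightarrow> \<rho> g * \<rho> h = \<rho> h * \<rho> g" if gh: "g \<in> carrier G" "h \<in> carrier G" for g h
  proof -
    have eq: "\<rho> g * \<rho> h = \<rho> h * \<rho> g * \<rho> (cmt G g h)"
      using mult_cmt[OF gh] gh by (metis mult cmt_closed m_closed)
    have hg: "h \<otimes>\<^bsub>G\<^esub> g \<in> carrier G" using gh by simp
    have cl: "cmt G g h \<in> carrier G" by (rule cmt_closed[OF gh])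
    have inv1: "\<rho> (inv\<^bsub>G\<^esub> (h \<otimes>\<^bsub>G\<^esub> g)) * \<rho> (h \<otimes>\<^bsub>G\<^esub> g) = 1\<^sub>m d"
      using mult[of "inv\<^bsub>G\<^esub> (h \<otimes>\<^bsub>G\<^esub> g)" "h \<otimes>\<^bsub>G\<^esub> g"] hg one by simp
    show ?thesis
    proof
      assume "cmt G g h \<in> K"
      then have "\<rho> (cmt G g h) = 1\<^sub>m d" by (simp add: K_def)
      moreover have "\<rho> h * \<rho> g \<in> carrier_mat d d"
        by (rule mult_carrier_mat[OF car[OF gh(2)] car[OF gh(1)]])
      ultimately show "\<rho> g * \<rho> h = \<rho> h * \<rho> g" using eq right_mult_one_mat by metis
    next
      assume "\<rho> g * \<rho> h = \<rho> h * \<rho> g"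
      then have e: "\<rho> (h \<otimes>\<^bsub>G\<^esub> g) * \<rho> (cmt G g h) = \<rho> (h \<otimes>\<^bsub>G\<^esub> g)"
        using eq mult[of h g] gh by simp
      have "\<rho> (cmt G g h) = (\<rho> (inv\<^bsub>G\<^esub> (h \<otimes>\<^bsub>G\<^esub> g)) * \<rho> (h \<otimes>\<^bsub>G\<^esub> g)) * \<rho> (cmt G g h)"
        unfolding inv1 using car[OF cl] by simp
      also have "\<dots> = \<rho> (inv\<^bsub>G\<^esub> (h \<otimes>\<^bsub>G\<^esub> g)) * (\<rho> (h \<otimes>\<^bsub>G\<^esub> g) * \<rho> (cmt G g h))"
        by (rule assoc_mult_mat) (use car hg cl in auto)
      also have "\<dots> = 1\<^sub>m d" unfolding e by (rule inv1)
      finally show "cmt G g h \<in> K" using cl by (simp add: K_def)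
    qed
  qed
  have Z: "char_center G \<chi> = center_mod G K"
  proof
    show "char_center G \<chi> \<subseteq> center_mod G K"
    proof
      fix g assume g: "g \<in> char_center G \<chi>"
      then have gc: "g \<in> carrier G" by (simp add: char_center_def)
      obtain c where c: "\<rho> g = c \<cdot>\<^sub>m 1\<^sub>m d" using scalar[OF g] by blast
      have "\<rho> g * \<rho> h = \<rho> h * \<rho> g" if "h \<in> carrier G" for h
        unfolding c using car[OF that]
        by (simp add: mult_smult_distrib[of _ d d _ d] mult_smult_assoc_mat[of _ d d _ d])
      then show "g \<in> center_mod G K" using gc comm_iff[OF gc] by (simp add: center_mod_def)
    qed
    show "center_mod G K \<subseteq> char_center G \<chi>"
    proof
      fix g assume g: "g \<in> center_mod G K"
      then have gc: "g \<in> carrier G" by (simp add: center_mod_def)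
      have "\<exists>c. \<rho> g = c \<cdot>\<^sub>m 1\<^sub>m d"
        by (rule schur_scalar[OF irr gc]) (use g comm_iff[OF gc] in \<open>simp add: center_mod_def\<close>)
      then show "g \<in> char_center G \<chi>" using in_center[OF gc] by blast
    qed
  qed
  have "\<rho> (x \<otimes>\<^bsub>G\<^esub> y) $$ (0, 0) = \<rho> x $$ (0, 0) * \<rho> y $$ (0, 0)"
    if xy: "x \<in> char_center G \<chi>" "y \<in> char_center G \<chi>" for x y
  proof -
    obtain a b where ab: "\<rho> x = a \<cdot>\<^sub>m 1\<^sub>m d" "\<rho> y = b \<cdot>\<^sub>m 1\<^sub>m d" using xy scalar by metis
    have "\<rho> (x \<otimes>\<^bsub>G\<^esub> y) = \<rho> x * \<rho> y" using xy by (intro mult) (auto simp: char_center_def)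
    then have "\<rho> (x \<otimes>\<^bsub>G\<^esub> y) = (a * b) \<cdot>\<^sub>m 1\<^sub>m d" unfolding ab
      by (simp add: mult_smult_distrib[of _ d d _ d] mult_smult_assoc_mat[of _ d d _ d] smult_smult_mat mult.commute)
    then show ?thesis using ab d by simp
  qed
  moreover have "K = {x \<in> char_center G \<chi>. \<rho> x $$ (0, 0) = 1}"
  proof
    show "K \<subseteq> {x \<in> char_center G \<chi>. \<rho> x $$ (0, 0) = 1}"
      using subset_center_mod[OF K] Z d by (auto simp: K_def)
    show "{x \<in> char_center G \<chi>. \<rho> x $$ (0, 0) = 1} \<subseteq> K"
    proof
      fix x assume x: "x \<in> {x \<in> char_center G \<chi>. \<rho> x $$ (0, 0) = 1}"
      then obtain c where c: "\<rho> x = c \<cdot>\<^sub>m 1\<^sub>m d" using scalar by blast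
      then have "c = 1" using x d by simp
      then show "x \<in> K" using x c by (simp add: K_def char_center_def one_smult_one_mat)
    qed
  qed
  ultimately show ?thesis unfolding central_char_def K_def[symmetric] using K Z by blast
qed

lemma Irr_central_char:
  assumes "group G" "finite (carrier G)" "\<chi> \<in> Irr G"
  shows "\<exists>K f. central_char G (char_center G \<chi>) K f"
  using assms(3) irreducible_rep_central_char[OF assms(1,2)] unfolding Irr_def by blast

text \<open>Lift the regular representation of \<open>G / N\<close> to \<open>G\<close>, where
  \<open>g\<close> acts nontrivially, and descend to an irreducible representation that still moves
  \<open>g\<close> and whose kernel still contains \<open>N\<close>.\<close>

lemma Irr_separates:
  assumes G: "group G" "finite (carrier G)" and N: "N \<lhd> G" and g: "g \<in> carrier G" "g \<notin> N"
  shows "\<exists>\<chi>\<in>Irr G. \<exists>K f. central_char G (char_center G \<chi>) K f \<and> N \<subseteq> K \<and> g \<notin> K"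
proof -
  interpret group G by (rule G(1))
  interpret N: normal N G by (rule N)
  have Q: "group (G Mod N)" by (rule N.factorgroup_is_group)
  have finQ: "finite (carrier (G Mod N))"
    using G(2) by (simp add: FactGroup_def RCOSETS_def)
  obtain d R where R: "representation (G Mod N) d R"
      "\<And>q. q \<in> carrier (G Mod N) \<Longrightarrow> R q = 1\<^sub>m d \<Longrightarrow> q = \<one>\<^bsub>G Mod N\<^esub>"
    using faithful_representation[OF Q finQ] by blast
  define \<rho> where "\<rho> h = R (N #>\<^bsub>G\<^esub> h)" for h
  have qc: "N #>\<^bsub>G\<^esub> h \<in> carrier (G Mod N)" if "h \<in> carrier G" for h
    using that by (auto simp: FactGroup_def RCOSETS_def)
  have qone: "N #>\<^bsub>G\<^esub> h = \<one>\<^bsub>G Mod N\<^esub> \<longleftrightarrow> h \<in> N" if "h \<in> carrier G" for h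
    unfolding one_FactGroup using rcos_self[OF that N.subgroup_axioms] N.rcos_const[OF is_group] by blast
  have \<rho>: "representation G d \<rho>"
    unfolding representation_def
  proof (intro conjI ballI)
    fix h k assume hk: "h \<in> carrier G" "k \<in> carrier G"
    have "N #>\<^bsub>G\<^esub> (h \<otimes>\<^bsub>G\<^esub> k) = (N #>\<^bsub>G\<^esub> h) \<otimes>\<^bsub>G Mod N\<^esub> (N #>\<^bsub>G\<^esub> k)"
      using N.rcos_sum[OF hk] by simp
    then show "\<rho> (h \<otimes>\<^bsub>G\<^esub> k) = \<rho> h * \<rho> k"
      using R(1) qc hk by (simp add: \<rho>_def representation_def)
  next
    show "\<rho> \<one>\<^bsub>G\<^esub> = 1\<^sub>m d" using R(1) qone[of "\<one>\<^bsub>G\<^esub>"] by (simp add: \<rho>_def representation_def N.one_closed)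
  qed (use R(1) qc in \<open>auto simp: \<rho>_def representation_def\<close>)
  have "\<rho> g \<noteq> 1\<^sub>m d" using R(2)[OF qc[OF g(1)]] qone[OF g(1)] g(2) by (auto simp: \<rho>_def)
  then obtain d' \<rho>' where irr: "irreducible_rep G d' \<rho>'" "\<rho>' g \<noteq> 1\<^sub>m d'"
      "\<And>h. h \<in> carrier G \<Longrightarrow> \<rho> h = 1\<^sub>m d \<Longrightarrow> \<rho>' h = 1\<^sub>m d'"
    using ex_irreducible_rep[OF G g(1) \<rho>] by blast
  define \<chi> where "\<chi> = (\<lambda>g. if g \<in> carrier G then mat_trace (\<rho>' g) else 0)"
  have "\<chi> \<in> Irr G" using irr(1) by (auto simp: Irr_def \<chi>_def)
  moreover note irreducible_rep_central_char[OF G irr(1) \<chi>_def]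
  moreover have "N \<subseteq> {g \<in> carrier G. \<rho>' g = 1\<^sub>m d'}"
  proof
    fix h assume h: "h \<in> N"
    then have hc: "h \<in> carrier G" by (rule N.mem_carrier)
    then have "\<rho> h = 1\<^sub>m d" using qone[OF hc] h R(1) by (simp add: \<rho>_def representation_def)
    then show "h \<in> {g \<in> carrier G. \<rho>' g = 1\<^sub>m d'}" using irr(3) hc by simp
  qed
  ultimately show ?thesis using irr(2) by blast
qed

section \<open>Elementary abelian sections\<close>

lemma (in group) finite_subgroupI:
  assumes fin: "finite (carrier G)" and sub: "H \<subseteq> carrier G" and one: "\<one> \<in> H"
    and mult: "\<And>x y. x \<in> H \<Longrightarrow> y \<in> H \<Longrightarrow> x \<otimes> y \<in> H"
  shows "subgroup H G"
proof (rule subgroupI[OF sub])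
  fix a assume a: "a \<in> H"
  then have ac: "a \<in> carrier G" using sub by blast
  have pw: "a [^] (k::nat) \<in> H" for k by (induction k) (use a one mult in auto)
  define m where "m = Coset.order G - 1"
  have "Coset.order G = Suc m" using fin order_gt_0_iff_finite by (simp add: m_def)
  then have "a [^] m \<otimes> a = \<one>" using pow_order_eq_1[OF ac] by simp
  then have "inv a = a [^] m" using ac by (intro inv_equality) auto
  then show "inv a \<in> H" using pw by simp
qed (use one mult in auto)

text \<open>Otherwise Bezout expresses \<open>a\<close> through powers of \<open>a [^] p\<close> and
  \<open>a [^] m\<close>, both of which lie in \<open>T\<close>.\<close>

lemma (in group) prime_pow_mem:
  fixes p m :: nat
  assumes p: "Factorial_Ring.prime p" and T: "subgroup T G" and a: "a \<in> carrier G"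
    and ap: "a [^] p \<in> T" and am: "a [^] m \<in> T" and nT: "a \<notin> T"
  shows "p dvd m"
proof (rule ccontr)
  interpret T: subgroup T G by (rule T)
  assume "\<not> p dvd m"
  then have "coprime p m" using p by (simp add: prime_imp_coprime)
  then have cop: "coprime m p" by (simp add: coprime_commute)
  have pw: "b [^] (k::nat) \<in> T" if "b \<in> T" for b k
    by (induction k) (use that in auto)
  have "p \<noteq> 0" using p by auto
  then have "m \<noteq> 0" using cop p by (metis coprime_0_left_iff not_prime_1 normalize_nat_def id_apply nat_dvd_1_iff_1 not_prime_unit)
  then obtain u v where "m * u = p * v + 1"
    using bezout_nat[of m p] cop by (metis coprime_imp_gcd_eq_1)
  then have "a [^] (m * u) = a [^] (p * v + 1)" by simp
  then have "(a [^] m) [^] u = (a [^] p) [^] v \<otimes> a"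
    using a by (simp add: nat_pow_pow nat_pow_mult[symmetric])
  then have "a = inv ((a [^] p) [^] v) \<otimes> (a [^] m) [^] u"
    using a by (simp add: inv_solve_left)
  moreover have "inv ((a [^] p) [^] v) \<otimes> (a [^] m) [^] u \<in> T"
    using pw ap am by simp
  ultimately show False using nT by simp
qed

text \<open>Coordinates \<open>c\<close> with respect to a basis \<open>e\<close> of the elementary abelian section \<open>S / R\<close>.\<close>

definition section_basis ::
  "('a, 'b) monoid_scheme \<Rightarrow> nat \<Rightarrow> 'a set \<Rightarrow> 'a set \<Rightarrow> nat \<Rightarrow> (nat \<Rightarrow> 'a) \<Rightarrow> (nat \<Rightarrow> 'a \<Rightarrow> int) \<Rightarrow> bool" where
  "section_basis G p S R t e c \<longleftrightarrow>
     card S = p ^ t * card R \<and> (\<forall>k<t. e k \<in> S) \<and>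
     (\<forall>k<t. \<forall>x\<in>S. \<forall>y\<in>S. [c k (x \<otimes>\<^bsub>G\<^esub> y) = c k x + c k y] (mod int p)) \<and>
     (\<forall>k<t. \<forall>x\<in>R. int p dvd c k x) \<and>
     (\<forall>k<t. \<forall>j<t. [c k (e j) = (if k = j then 1 else 0)] (mod int p)) \<and>
     (\<forall>x\<in>S. (\<forall>k<t. int p dvd c k x) \<longrightarrow> x \<in> R)"

text \<open>Each element of the enlarged subgroup is \<open>y \<otimes> a [^] j\<close> with
  \<open>y\<close> in \<open>T\<close> unique modulo \<open>R\<close> and \<open>j\<close> unique
  modulo \<open>p\<close>. The old coordinates of \<open>y\<close>, together with \<open>j\<close>,
  are the new coordinates.\<close>

lemma (in group) section_basis_extend:
  assumes p: "Factorial_Ring.prime p" and fin: "finite (carrier G)"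
    and R: "R \<lhd> G" and T: "subgroup T G" "R \<subseteq> T"
    and S: "subgroup S G" "T \<subseteq> S" and a: "a \<in> S" "a \<notin> T"
    and comm: "\<And>x y. x \<in> S \<Longrightarrow> y \<in> S \<Longrightarrow> cmt G x y \<in> R"
    and pow: "\<And>x. x \<in> S \<Longrightarrow> x [^] p \<in> R"
    and bas: "section_basis G p T R t e c"
  shows "\<exists>T' e' c'. subgroup T' G \<and> T \<subset> T' \<and> T' \<subseteq> S \<and> section_basis G p T' R (Suc t) e' c'"
proof -
  interpret T: subgroup T G by (rule T(1))
  interpret S: subgroup S G by (rule S(1))
  interpret R: normal R G by (rule R)
  have p0: "p > 0" using p by (rule prime_gt_0_nat)
  have ac: "a \<in> carrier G" using a(1) by (rule S.mem_carrier)
  have b: "card T = p ^ t * card R" "\<And>k. k < t \<Longrightarrow> e k \<in> T"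
    "\<And>k x y. k < t \<Longrightarrow> x \<in> T \<Longrightarrow> y \<in> T \<Longrightarrow> [c k (x \<otimes> y) = c k x + c k y] (mod int p)"
    "\<And>k x. k < t \<Longrightarrow> x \<in> R \<Longrightarrow> int p dvd c k x"
    "\<And>k j. k < t \<Longrightarrow> j < t \<Longrightarrow> [c k (e j) = (if k = j then 1 else 0)] (mod int p)"
    "\<And>x. x \<in> T \<Longrightarrow> (\<And>k. k < t \<Longrightarrow> int p dvd c k x) \<Longrightarrow> x \<in> R"
    using bas unfolding section_basis_def by blast+
  have aT: "a [^] m \<in> T \<longleftrightarrow> p dvd m" for m :: nat
  proof
    assume "a [^] m \<in> T"
    then show "p dvd m" using prime_pow_mem[OF p T(1) ac _ _ a(2)] pow[OF a(1)] T(2) by blast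
  next
    assume "p dvd m"
    then obtain v where "m = p * v" ..
    then have m: "a [^] m = (a [^] p) [^] v" using ac by (simp add: nat_pow_pow)
    have "(a [^] p) [^] v \<in> R" by (induction v) (use pow[OF a(1)] in auto)
    then show "a [^] m \<in> T" unfolding m using T(2) by blast
  qed
  have aR: "a [^] m \<in> R" if dvd: "p dvd m" for m :: nat
  proof -
    obtain v where "m = p * v" using dvd ..
    then have m: "a [^] m = (a [^] p) [^] v" using ac by (simp add: nat_pow_pow)
    show ?thesis unfolding m by (induction v) (use pow[OF a(1)] in auto)
  qed
  have aS: "a [^] m \<in> S" for m :: nat by (induction m) (use a(1) in auto)
  have cR: "[c k (y \<otimes> r) = c k y] (mod int p)" if "k < t" "y \<in> T" "r \<in> R" for k y r
  proof -
    have "[c k (y \<otimes> r) = c k y + c k r] (mod int p)" using that T(2) by (intro b(3)) auto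
    moreover have "[c k y + c k r = c k y + 0] (mod int p)"
      using b(4)[OF that(1,3)] by (intro cong_add) (auto simp: cong_0_iff)
    ultimately show ?thesis by (simp add: cong_trans)
  qed
  define T' where "T' = {y \<otimes> a [^] (j::nat) | y j. y \<in> T}"
  have TT': "T \<subseteq> T'"
  proof
    fix y assume y: "y \<in> T"
    then have "y = y \<otimes> a [^] (0::nat)" by simp
    then show "y \<in> T'" using y unfolding T'_def by blast
  qed
  have aT': "a \<in> T'"
  proof -
    have "a = \<one> \<otimes> a [^] (1::nat)" using ac by simp
    then show ?thesis unfolding T'_def using T.one_closed by blast
  qed
  have T'S: "T' \<subseteq> S" unfolding T'_def using S(2) aS by auto
  \<comment> \<open>Moving \<open>a [^] i\<close> past \<open>z\<close> costs a commutator from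
    \<open>R\<close>, which the coordinates do not see.\<close>
  have prod: "\<exists>r\<in>R. (y \<otimes> a [^] i) \<otimes> (z \<otimes> a [^] j) = (y \<otimes> (z \<otimes> r)) \<otimes> a [^] (i + j)"
    if yz: "y \<in> T" "z \<in> T" for y z and i j :: nat
  proof
    have yc: "y \<in> carrier G" "z \<in> carrier G" using yz by auto
    define r where "r = cmt G z (inv (a [^] i))"
    show "r \<in> R" unfolding r_def using yz S(2) aS by (intro comm) auto
    show "(y \<otimes> a [^] i) \<otimes> (z \<otimes> a [^] j) = (y \<otimes> (z \<otimes> r)) \<otimes> a [^] (i + j)"
      using yc ac by (simp add: r_def m_assoc nat_pow_mult[symmetric])
  qed
  have subT': "subgroup T' G"
  proof (rule finite_subgroupI[OF fin])
    show "T' \<subseteq> carrier G" using T'S S.subset by blast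
    show "\<one> \<in> T'" using TT' by auto
    fix x x' assume "x \<in> T'" "x' \<in> T'"
    then obtain y i z j where x: "x = y \<otimes> a [^] (i::nat)" "y \<in> T" "x' = z \<otimes> a [^] (j::nat)" "z \<in> T"
      unfolding T'_def by blast
    obtain r where "r \<in> R" "x \<otimes> x' = (y \<otimes> (z \<otimes> r)) \<otimes> a [^] (i + j)"
      using prod[OF x(2,4), of i j] x(1,3) by blast
    moreover have "y \<otimes> (z \<otimes> r) \<in> T" using x \<open>r \<in> R\<close> T(2) by auto
    ultimately show "x \<otimes> x' \<in> T'" unfolding T'_def by blast
  qed
  have uniq: "int p dvd int i - int j \<and> (\<exists>r\<in>R. y = z \<otimes> r)"
    if eq: "y \<otimes> a [^] i = z \<otimes> a [^] j" and yz: "y \<in> T" "z \<in> T" for y z and i j :: nat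
  proof -
    have main: "p dvd j - i \<and> inv z \<otimes> y = a [^] (j - i)"
      if eq: "y \<otimes> a [^] i = z \<otimes> a [^] j" and ij: "i \<le> j" and yz: "y \<in> T" "z \<in> T" for y z and i j :: nat
    proof -
      have yc: "y \<in> carrier G" "z \<in> carrier G" using yz by auto
      have "z \<otimes> a [^] j = z \<otimes> (a [^] (j - i) \<otimes> a [^] i)"
        using ac ij by (simp add: nat_pow_mult)
      then have "y \<otimes> a [^] i = (z \<otimes> a [^] (j - i)) \<otimes> a [^] i" using eq yc ac by (simp add: m_assoc)
      then have y: "y = z \<otimes> a [^] (j - i)" using yc ac by (simp only: r_cancel m_closed nat_pow_closed)
      then have 1: "inv z \<otimes> y = a [^] (j - i)" using yc ac by simp
      moreover have "inv z \<otimes> y \<in> T" using yz by simp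
      ultimately show ?thesis using aT by simp
    qed
    have yc: "y \<in> carrier G" "z \<in> carrier G" using yz by auto
    show ?thesis
    proof (cases "i \<le> j")
      case True
      from main[OF eq this yz] have m: "p dvd j - i" "inv z \<otimes> y = a [^] (j - i)" by auto
      have "y = z \<otimes> (inv z \<otimes> y)" using yc by simp
      moreover have "inv z \<otimes> y \<in> R" unfolding m(2) by (rule aR[OF m(1)])
      moreover have "int p dvd int j - int i" using m(1) True by (metis of_nat_diff of_nat_dvd_iff)
      ultimately show ?thesis by (metis dvd_diff_commute)
    next
      case False
      then have ji: "j \<le> i" by simp
      from main[OF eq[symmetric] this yz(2,1)] have m: "p dvd i - j" "inv y \<otimes> z = a [^] (i - j)" by auto
      have "inv (inv y \<otimes> z) \<in> R" unfolding m(2) using aR[OF m(1)] by blast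
      moreover have "y = z \<otimes> inv (inv y \<otimes> z)" using yc by (simp add: inv_mult_group)
      moreover have "int p dvd int i - int j" using m(1) ji by (metis of_nat_diff of_nat_dvd_iff)
      ultimately show ?thesis by blast
    qed
  qed
  \<comment> \<open>Any choice serves: by \<open>uniq\<close>, another one changes the coordinates
    only by multiples of \<open>p\<close>, as \<open>c'1\<close> and \<open>c'2\<close>
    record.\<close>
  define rep where "rep x = (SOME yj. fst yj \<in> T \<and> x = fst yj \<otimes> a [^] (snd yj :: nat))" for x
  have rep: "fst (rep x) \<in> T \<and> x = fst (rep x) \<otimes> a [^] snd (rep x)" if "x \<in> T'" for x
  proof -
    obtain y j where "y \<in> T" "x = y \<otimes> a [^] (j::nat)" using \<open>x \<in> T'\<close> unfolding T'_def by blast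
    then have "\<exists>yj. fst yj \<in> T \<and> x = fst yj \<otimes> a [^] (snd yj :: nat)" by (intro exI[of _ "(y, j)"]) simp
    then show ?thesis unfolding rep_def by (rule someI_ex)
  qed
  define c' where "c' k x = (if k < t then c k (fst (rep x)) else int (snd (rep x)))" for k x
  define e' where "e' k = (if k < t then e k else a)" for k
  have c'1: "[c' k (y \<otimes> a [^] j) = c k y] (mod int p)" if k: "k < t" and y: "y \<in> T" for k y and j :: nat
  proof -
    have "y \<otimes> a [^] j \<in> T'" using y unfolding T'_def by blast
    note r = rep[OF this]
    have "\<exists>r\<in>R. fst (rep (y \<otimes> a [^] j)) = y \<otimes> r"
      using uniq[OF r[THEN conjunct2, symmetric] r[THEN conjunct1] y] by blast
    then obtain r where "r \<in> R" "fst (rep (y \<otimes> a [^] j)) = y \<otimes> r" by blast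
    then show ?thesis using cR[OF k y] k by (simp add: c'_def)
  qed
  have c'2: "[c' t (y \<otimes> a [^] j) = int j] (mod int p)" if y: "y \<in> T" for y and j :: nat
  proof -
    have "y \<otimes> a [^] j \<in> T'" using y unfolding T'_def by blast
    note r = rep[OF this]
    have "int p dvd int (snd (rep (y \<otimes> a [^] j))) - int j"
      using uniq[OF r[THEN conjunct2, symmetric] r[THEN conjunct1] y] by blast
    then show ?thesis by (simp add: c'_def cong_iff_dvd_diff)
  qed
  have c'T: "[c' k y = (if k < t then c k y else 0)] (mod int p)" if "k < Suc t" "y \<in> T" for k y
  proof -
    have y: "y = y \<otimes> a [^] (0::nat)" using that by simp
    show ?thesis
    proof (cases "k < t")
      case True
      then show ?thesis using c'1[OF True that(2), of 0] y by simp
    next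
      case False
      then have "k = t" using that by simp
      then show ?thesis using c'2[OF that(2), of 0] y by simp
    qed
  qed
  have "section_basis G p T' R (Suc t) e' c'"
    unfolding section_basis_def
  proof (intro conjI allI impI ballI)
    have "bij_betw (\<lambda>(y, j). y \<otimes> a [^] j) (T \<times> {..<p}) T'"
      unfolding bij_betw_def
    proof
      show "inj_on (\<lambda>(y, j). y \<otimes> a [^] j) (T \<times> {..<p})"
      proof (rule inj_onI, clarify)
        fix y z and i j :: nat
        assume y: "y \<in> T" and z: "z \<in> T" and i: "i < p" "j < p" and eq: "y \<otimes> a [^] i = z \<otimes> a [^] j"
        have "int p dvd int i - int j" using uniq[OF eq y z] by blast
        then have "[int i = int j] (mod int p)" by (simp add: cong_iff_dvd_diff)
        then have "i = j" using i by (simp add: cong_int_iff cong_less_modulus_unique_nat)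
        then show "y = z \<and> i = j" using eq y z ac by simp
      qed
      show "(\<lambda>(y, j). y \<otimes> a [^] j) ` (T \<times> {..<p}) = T'"
      proof
        show "(\<lambda>(y, j). y \<otimes> a [^] j) ` (T \<times> {..<p}) \<subseteq> T'" unfolding T'_def by auto
        show "T' \<subseteq> (\<lambda>(y, j). y \<otimes> a [^] j) ` (T \<times> {..<p})"
        proof
          fix x assume "x \<in> T'"
          then obtain y j where x: "y \<in> T" "x = y \<otimes> a [^] (j::nat)" unfolding T'_def by blast
          have "a [^] j = a [^] (p * (j div p)) \<otimes> a [^] (j mod p)"
            using ac by (simp add: nat_pow_mult)
          then have "x = (y \<otimes> a [^] (p * (j div p))) \<otimes> a [^] (j mod p)"
            using x ac by (simp add: m_assoc)
          moreover have "y \<otimes> a [^] (p * (j div p)) \<in> T" using x(1) aT[of "p * (j div p)"] by simp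
          ultimately show "x \<in> (\<lambda>(y, j). y \<otimes> a [^] j) ` (T \<times> {..<p})"
            using p0 by (intro image_eqI[of _ _ "(y \<otimes> a [^] (p * (j div p)), j mod p)"]) auto
        qed
      qed
    qed
    from bij_betw_same_card[OF this] have "card T' = card T * p" by (simp add: card_cartesian_product)
    then show "card T' = p ^ Suc t * card R" using b(1) by simp
  next
    fix k assume "k < Suc t"
    then show "e' k \<in> T'" using b(2)[of k] TT' aT' by (auto simp: e'_def)
  next
    fix k x x' assume k: "k < Suc t" and "x \<in> T'" "x' \<in> T'"
    then obtain y i z j where x: "x = y \<otimes> a [^] (i::nat)" "y \<in> T" "x' = z \<otimes> a [^] (j::nat)" "z \<in> T"
      unfolding T'_def by blast
    obtain r where r: "r \<in> R" "x \<otimes> x' = (y \<otimes> (z \<otimes> r)) \<otimes> a [^] (i + j)"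
      using prod[OF x(2,4), of i j] x(1,3) by blast
    have zr: "z \<otimes> r \<in> T" and yzr: "y \<otimes> (z \<otimes> r) \<in> T" using x r(1) T(2) by auto
    show "[c' k (x \<otimes> x') = c' k x + c' k x'] (mod int p)"
    proof (cases "k < t")
      case True
      have "[c' k (x \<otimes> x') = c k (y \<otimes> (z \<otimes> r))] (mod int p)" unfolding r(2) by (rule c'1[OF True yzr])
      also have "[c k (y \<otimes> (z \<otimes> r)) = c k y + c k (z \<otimes> r)] (mod int p)" by (rule b(3)[OF True x(2) zr])
      also have "[c k y + c k (z \<otimes> r) = c k y + c k z] (mod int p)"
        by (intro cong_add cong_refl cR[OF True x(4) r(1)])
      also have "[c k y + c k z = c' k x + c' k x'] (mod int p)"
        unfolding x by (intro cong_add cong_sym[OF c'1[OF True x(2)]] cong_sym[OF c'1[OF True x(4)]])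
      finally show ?thesis .
    next
      case False
      then have k: "k = t" using k by simp
      have "[c' t (x \<otimes> x') = int (i + j)] (mod int p)" unfolding r(2) by (rule c'2[OF yzr])
      also have "[int (i + j) = c' t x + c' t x'] (mod int p)"
        unfolding x of_nat_add by (intro cong_add cong_sym[OF c'2[OF x(2)]] cong_sym[OF c'2[OF x(4)]])
      finally show ?thesis unfolding k .
    qed
  next
    fix k x assume k: "k < Suc t" and x: "x \<in> R"
    have "[c' k x = (if k < t then c k x else 0)] (mod int p)" using c'T[OF k] x T(2) by blast
    moreover have "int p dvd (if k < t then c k x else 0)" using b(4)[OF _ x] by simp
    ultimately show "int p dvd c' k x" by (simp only: cong_dvd_iff)
  next
    fix k j assume kj: "k < Suc t" "j < Suc t"
    show "[c' k (e' j) = (if k = j then 1 else 0)] (mod int p)"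
    proof (cases "j < t")
      case True
      have "[c' k (e' j) = (if k < t then c k (e j) else 0)] (mod int p)"
        using c'T[OF kj(1) b(2)[OF True]] True by (simp add: e'_def)
      also have "[(if k < t then c k (e j) else 0) = (if k = j then 1 else 0)] (mod int p)"
        using b(5)[of k j] True by (cases "k < t") auto
      finally show ?thesis .
    next
      case False
      then have j: "j = t" using kj by simp
      have e: "e' j = \<one> \<otimes> a [^] (1::nat)" using ac by (simp add: e'_def j)
      show ?thesis
      proof (cases "k < t")
        case True
        have "[c' k (e' j) = c k \<one>] (mod int p)" unfolding e by (rule c'1[OF True T.one_closed])
        moreover have "int p dvd c k \<one>" by (rule b(4)[OF True R.one_closed])
        ultimately show ?thesis using True j by (simp add: cong_0_iff cong_dvd_iff)
      next
        case False
        then have k: "k = t" using kj by simp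
        show ?thesis using c'2[OF T.one_closed, of 1] e by (simp add: k j)
      qed
    qed
  next
    fix x assume "x \<in> T'" and d: "\<forall>k<Suc t. int p dvd c' k x"
    then obtain y j where x: "y \<in> T" "x = y \<otimes> a [^] (j::nat)" unfolding T'_def by blast
    have "int p dvd c' t x" using d by simp
    then have "int p dvd int j" using c'2[OF x(1), of j] unfolding x(2) by (simp only: cong_dvd_iff)
    then have pj: "p dvd j" by simp
    have "int p dvd c k y" if k: "k < t" for k
    proof -
      have "int p dvd c' k x" using d k by simp
      then show ?thesis using c'1[OF k x(1), of j] unfolding x(2) by (simp only: cong_dvd_iff)
    qed
    then have "y \<in> R" by (rule b(6)[OF x(1)])
    then show "x \<in> R" unfolding x(2) using aR[OF pj] by simp
  qed
  moreover have "T \<noteq> T'" using a(2) aT' by blast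
  ultimately show ?thesis using subT' TT' T'S by blast
qed

text \<open>Among the subgroups that carry a basis over \<open>R\<close>, starting with
  \<open>R\<close> and the empty basis, a maximal one must be \<open>S\<close>, since an element
  outside could be adjoined.\<close>

lemma (in group) ex_section_basis:
  assumes p: "Factorial_Ring.prime p" and fin: "finite (carrier G)"
    and R: "R \<lhd> G" and S: "subgroup S G" "R \<subseteq> S"
    and comm: "\<And>x y. x \<in> S \<Longrightarrow> y \<in> S \<Longrightarrow> cmt G x y \<in> R"
    and pow: "\<And>x. x \<in> S \<Longrightarrow> x [^] p \<in> R"
  shows "\<exists>t e c. section_basis G p S R t e c"
proof -
  interpret R: normal R G by (rule R)
  define P where "P T \<longleftrightarrow> subgroup T G \<and> R \<subseteq> T \<and> T \<subseteq> S \<and> (\<exists>t e c. section_basis G p T R t e c)" for T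
  have "section_basis G p R R 0 e c" for e c by (simp add: section_basis_def)
  then have "P R" unfolding P_def using R.subgroup_axioms S(2) by blast
  moreover have "finite {T. P T}"
    by (rule finite_subset[of _ "Pow (carrier G)"]) (use fin subgroup.subset P_def in blast)+
  ultimately obtain T where T: "P T" "\<And>T'. P T' \<Longrightarrow> T \<subseteq> T' \<Longrightarrow> T' = T"
    using finite_has_maximal2[of "{T. P T}" R] by (metis mem_Collect_eq)
  then obtain t e c where T': "subgroup T G" "R \<subseteq> T" "T \<subseteq> S" "section_basis G p T R t e c"
    unfolding P_def by blast
  have "T = S"
  proof (rule ccontr)
    assume "T \<noteq> S"
    then obtain a where a: "a \<in> S" "a \<notin> T" using T'(3) by blast
    obtain T1 where "P T1" "T \<subset> T1"
      using section_basis_extend[OF p fin R T'(1,2) S(1) T'(3) a comm pow T'(4)] T'(2) unfolding P_def by blast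
    then show False using T(2) by blast
  qed
  then show ?thesis using T'(4) by blast
qed

text \<open>Serves two purposes: to find an element with prescribed coordinates, and to extend a
  congruence to all of \<open>S\<close> by checking it on \<open>R\<close> and on the basis, with
  \<open>H\<close> the subgroup where it holds.\<close>

lemma (in group) section_basis_generates:
  assumes p: "Factorial_Ring.prime p"
    and bas: "section_basis G p S R t e c" and S: "subgroup S G"
    and R: "R \<subseteq> H" and H: "subgroup H G" "H \<subseteq> S" and e: "\<And>j. j < t \<Longrightarrow> e j \<in> H"
  shows "(\<exists>g\<in>H. \<forall>k<t. [c k g = x k] (mod int p)) \<and> S \<subseteq> H"
proof -
  interpret S: subgroup S G by (rule S)
  interpret H: subgroup H G by (rule H(1))
  have p0: "p > 0" using p by (rule prime_gt_0_nat)
  have b: "\<And>k. k < t \<Longrightarrow> e k \<in> S"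
    "\<And>k x y. k < t \<Longrightarrow> x \<in> S \<Longrightarrow> y \<in> S \<Longrightarrow> [c k (x \<otimes> y) = c k x + c k y] (mod int p)"
    "\<And>k x. k < t \<Longrightarrow> x \<in> R \<Longrightarrow> int p dvd c k x"
    "\<And>k j. k < t \<Longrightarrow> j < t \<Longrightarrow> [c k (e j) = (if k = j then 1 else 0)] (mod int p)"
    "\<And>x. x \<in> S \<Longrightarrow> (\<And>k. k < t \<Longrightarrow> int p dvd c k x) \<Longrightarrow> x \<in> R"
    using bas unfolding section_basis_def by blast+
  have one: "int p dvd c k \<one>" if "k < t" for k
  proof -
    have "[c k (\<one> \<otimes> \<one>) = c k \<one> + c k \<one>] (mod int p)" by (rule b(2)[OF that]) auto
    then have "int p dvd c k \<one> - (c k \<one> + c k \<one>)" by (simp add: cong_iff_dvd_diff)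
    then show ?thesis by simp
  qed
  have powc: "[c k (y [^] m) = int m * c k y] (mod int p)" if k: "k < t" and y: "y \<in> S" for k y and m :: nat
  proof (induction m)
    case 0
    then show ?case using one[OF k] by (simp add: cong_0_iff)
  next
    case (Suc m)
    have "y [^] m \<in> S" by (induction m) (use y in auto)
    then have "[c k (y [^] Suc m) = c k (y [^] m) + c k y] (mod int p)" using b(2)[OF k _ y] by simp
    also have "[c k (y [^] m) + c k y = int m * c k y + c k y] (mod int p)" by (intro cong_add Suc.IH cong_refl)
    finally show ?case by (simp add: algebra_simps)
  qed
  \<comment> \<open>Coordinates are set one at a time, multiplying by a power of \<open>e m\<close>
    whose exponent is a natural number congruent to \<open>x m\<close>.\<close>
  have ex: "\<exists>g\<in>H. \<forall>k<t. [c k g = (if k < m then x k else 0)] (mod int p)" if "m \<le> t" for m and x :: "nat \<Rightarrow> int"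
    using that
  proof (induction m)
    case 0
    then show ?case using one H.one_closed by (intro bexI[of _ \<one>]) (auto simp: cong_0_iff)
  next
    case (Suc m)
    then obtain g where g: "g \<in> H" "\<And>k. k < t \<Longrightarrow> [c k g = (if k < m then x k else 0)] (mod int p)" by auto
    have mt: "m < t" using Suc.prems by simp
    define u where "u = nat (x m mod int p)"
    have u: "[int u = x m] (mod int p)" using p0 by (simp add: u_def cong_def)
    have em: "e m [^] u \<in> H" by (induction u) (use e[OF mt] in auto)
    have "[c k (g \<otimes> e m [^] u) = (if k < Suc m then x k else 0)] (mod int p)" if k: "k < t" for k
    proof -
      have "[c k (g \<otimes> e m [^] u) = c k g + c k (e m [^] u)] (mod int p)"
        using g(1) em H(2) by (intro b(2)[OF k]) auto
      also have "[c k g + c k (e m [^] u) = (if k < m then x k else 0) + int u * c k (e m)] (mod int p)"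
        by (intro cong_add g(2)[OF k] powc[OF k b(1)[OF mt]])
      also have "[(if k < m then x k else 0) + int u * c k (e m) = (if k < m then x k else 0) + x m * (if k = m then 1 else 0)] (mod int p)"
        by (intro cong_add cong_refl cong_mult u b(4)[OF k mt])
      finally show ?thesis by (cases k m rule: linorder_cases) simp_all
    qed
    then show ?case using g(1) em by (intro bexI[of _ "g \<otimes> e m [^] u"]) auto
  qed
  have "S \<subseteq> H"
  proof
    fix y assume y: "y \<in> S"
    \<comment> \<open>With the coordinates of \<open>inv y\<close>, the product
      \<open>g \<otimes> y\<close> has all coordinates 0 and so falls into \<open>R\<close>, hence
      into \<open>H\<close>.\<close>
    obtain g where g: "g \<in> H" "\<And>k. k < t \<Longrightarrow> [c k g = c k (inv y)] (mod int p)"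
      using ex[of t "\<lambda>k. c k (inv y)"] by auto
    have gS: "g \<in> S" using g(1) H(2) by blast
    have "int p dvd c k (g \<otimes> y)" if k: "k < t" for k
    proof -
      have "[c k (g \<otimes> y) = c k g + c k y] (mod int p)" by (rule b(2)[OF k gS y])
      also have "[c k g + c k y = c k (inv y) + c k y] (mod int p)" by (intro cong_add g(2)[OF k] cong_refl)
      also have "[c k (inv y) + c k y = c k (inv y \<otimes> y)] (mod int p)"
        by (rule cong_sym, rule b(2)[OF k _ y]) (use y in simp)
      finally show ?thesis using one[OF k] y by (simp add: cong_dvd_iff)
    qed
    then have "g \<otimes> y \<in> R" using gS y by (intro b(5)) auto
    then have "inv g \<otimes> (g \<otimes> y) \<in> H" using R g(1) by blast
    then show "y \<in> H" using gS y by simp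
  qed
  then show ?thesis using ex[of t x] by auto
qed

section \<open>Chains of centers\<close>

text \<open>The class equation: if only the unit were central, every other conjugacy class would
  have size divisible by \<open>p\<close>, and the group order would be 1 modulo
  \<open>p\<close>.\<close>

lemma p_group_center_nontrivial:
  assumes Q: "group Q" and p: "Factorial_Ring.prime (p::nat)" and card: "card (carrier Q) = p ^ e" and e: "e > 0"
  shows "\<exists>z\<in>carrier Q. z \<noteq> \<one>\<^bsub>Q\<^esub> \<and> (\<forall>g\<in>carrier Q. z \<otimes>\<^bsub>Q\<^esub> g = g \<otimes>\<^bsub>Q\<^esub> z)"
proof (rule ccontr)
  assume neg: "\<not> ?thesis"
  interpret Q: group Q by (rule Q)
  define \<phi> where "\<phi> = (\<lambda>g. \<lambda>h\<in>carrier Q. g \<otimes>\<^bsub>Q\<^esub> h \<otimes>\<^bsub>Q\<^esub> inv\<^bsub>Q\<^esub> g)"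
  interpret A: group_action Q "carrier Q" \<phi> unfolding \<phi>_def by (rule Q.action_by_conjugation)
  have p1: "p > 1" using p by (rule prime_gt_1_nat)
  have fin: "finite (carrier Q)" by (rule card_ge_0_finite) (use card p1 in simp)
  define O' where "O' = orbits Q (carrier Q) \<phi>"
  have part: "partition (carrier Q) O'" unfolding O'_def by (rule A.orbit_partition)
  have sub: "U \<subseteq> carrier Q" if "U \<in> O'" for U using part that unfolding partition_def by blast
  have disj: "U = V \<or> U \<inter> V = {}" if "U \<in> O'" "V \<in> O'" for U V
    using part that sub unfolding partition_def by blast
  have cover: "carrier Q = \<Union>O'" using part unfolding partition_def by blast
  have finO: "finite O'" by (rule finite_subset[of _ "Pow (carrier Q)"]) (use sub fin in auto)
  have orb: "\<exists>x\<in>carrier Q. U = orbit Q \<phi> x" if "U \<in> O'" for U using that by (auto simp: O'_def orbits_def)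
  have self: "x \<in> orbit Q \<phi> x" if "x \<in> carrier Q" for x using A.orbit_refl[OF that] .
  have one_orb: "orbit Q \<phi> \<one>\<^bsub>Q\<^esub> = {\<one>\<^bsub>Q\<^esub>}"
    using self[OF Q.one_closed] by (auto simp: orbit_def \<phi>_def)
  have one_in: "{\<one>\<^bsub>Q\<^esub>} \<in> O'" unfolding O'_def orbits_def using one_orb Q.one_closed by blast
  have pdvd: "p dvd card U" if U: "U \<in> O' - {{\<one>\<^bsub>Q\<^esub>}}" for U
  proof -
    obtain x where x: "x \<in> carrier Q" "U = orbit Q \<phi> x" using orb U by blast
    have "x \<noteq> \<one>\<^bsub>Q\<^esub>" using x U one_orb by auto
    then obtain g where g: "g \<in> carrier Q" "x \<otimes>\<^bsub>Q\<^esub> g \<noteq> g \<otimes>\<^bsub>Q\<^esub> x" using neg x(1) by blast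
    have gx: "g \<otimes>\<^bsub>Q\<^esub> x \<otimes>\<^bsub>Q\<^esub> inv\<^bsub>Q\<^esub> g \<in> U" using x g by (auto simp: orbit_def \<phi>_def)
    have "g \<otimes>\<^bsub>Q\<^esub> x \<otimes>\<^bsub>Q\<^esub> inv\<^bsub>Q\<^esub> g \<noteq> x"
    proof
      assume "g \<otimes>\<^bsub>Q\<^esub> x \<otimes>\<^bsub>Q\<^esub> inv\<^bsub>Q\<^esub> g = x"
      then have "g \<otimes>\<^bsub>Q\<^esub> x \<otimes>\<^bsub>Q\<^esub> inv\<^bsub>Q\<^esub> g \<otimes>\<^bsub>Q\<^esub> g = x \<otimes>\<^bsub>Q\<^esub> g" by simp
      then show False using g x by (simp add: Q.m_assoc)
    qed
    then have "card U \<noteq> 1" using gx self[OF x(1)] x(2) by (auto simp: card_1_singleton_iff)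
    moreover have "card U * card (stabilizer Q \<phi> x) = p ^ e"
      using A.orbit_stabilizer_theorem[OF x(1)] x(2) card by (simp add: Coset.order_def)
    then have "card U dvd p ^ e" by (metis dvd_triv_left)
    then obtain i where "card U = p ^ i" using divides_primepow_nat[OF p] by blast
    ultimately show ?thesis by (cases i) auto
  qed
  have "card (carrier Q) = (\<Sum>U\<in>O'. card U)"
    unfolding cover
  proof (rule card_Union_disjoint)
    show "pairwise disjnt O'" unfolding pairwise_def disjnt_def using disj by blast
    show "finite U" if "U \<in> O'" for U using sub[OF that] fin by (rule finite_subset)
  qed
  also have "\<dots> = 1 + (\<Sum>U\<in>O' - {{\<one>\<^bsub>Q\<^esub>}}. card U)"
    using sum.remove[OF finO one_in, of card] by simp
  finally have "p ^ e = 1 + (\<Sum>U\<in>O' - {{\<one>\<^bsub>Q\<^esub>}}. card U)" using card by simp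
  moreover have "p dvd (\<Sum>U\<in>O' - {{\<one>\<^bsub>Q\<^esub>}}. card U)" by (rule dvd_sum) (rule pdvd)
  moreover have "p dvd p ^ e" using e by simp
  ultimately have "p dvd 1" by (metis dvd_add_left_iff)
  then show False using p1 by simp
qed

text \<open>The fibres of the map from \<open>H\<close> to \<open>G / N\<close> are translates of
  \<open>H \<inter> N\<close>. This gives the count behind the second isomorphism theorem, also for
  \<open>H\<close> not containing \<open>N\<close>.\<close>

lemma card_eq_card_kernel_image:
  assumes G: "group G" "finite (carrier G)" and N: "N \<lhd> G" and H: "subgroup H G"
  shows "card H = card (H \<inter> N) * card ((\<lambda>g. N #>\<^bsub>G\<^esub> g) ` H)"
proof -
  interpret group G by (rule G(1))
  interpret N: normal N G by (rule N)
  interpret H: subgroup H G by (rule H)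
  define \<pi> where "\<pi> g = N #>\<^bsub>G\<^esub> g" for g
  have \<pi>eq: "\<pi> g = \<pi> h \<longleftrightarrow> g \<otimes>\<^bsub>G\<^esub> inv\<^bsub>G\<^esub> h \<in> N" if "g \<in> carrier G" "h \<in> carrier G" for g h
  proof
    assume "\<pi> g = \<pi> h"
    then have "g \<in> N #>\<^bsub>G\<^esub> h" using rcos_self[OF that(1) N.subgroup_axioms] by (simp add: \<pi>_def)
    then show "g \<otimes>\<^bsub>G\<^esub> inv\<^bsub>G\<^esub> h \<in> N" by (rule N.rcos_module_imp[OF is_group that(2)])
  next
    assume "g \<otimes>\<^bsub>G\<^esub> inv\<^bsub>G\<^esub> h \<in> N"
    then have "g \<in> N #>\<^bsub>G\<^esub> h" by (rule N.rcos_module_rev[OF is_group that(2,1)])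
    then show "\<pi> g = \<pi> h" unfolding \<pi>_def using repr_independence[OF _ that(2) N.subgroup_axioms] by simp
  qed
  have finH: "finite H" using H.subset G(2) by (rule finite_subset)
  have fib: "card {h \<in> H. \<pi> h = q} = card (H \<inter> N)" if "q \<in> \<pi> ` H" for q
  proof -
    obtain h0 where "q = \<pi> h0" "h0 \<in> H" by (rule imageE[OF \<open>q \<in> \<pi> ` H\<close>]) blast
    note h0 = this(2,1)
    have h0c: "h0 \<in> carrier G" using h0(1) by (rule H.mem_carrier)
    have "bij_betw (\<lambda>x. x \<otimes>\<^bsub>G\<^esub> h0) (H \<inter> N) {h \<in> H. \<pi> h = q}"
    proof (rule bij_betw_byWitness[where f' = "\<lambda>h. h \<otimes>\<^bsub>G\<^esub> inv\<^bsub>G\<^esub> h0"])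
      show "(\<lambda>x. x \<otimes>\<^bsub>G\<^esub> h0) ` (H \<inter> N) \<subseteq> {h \<in> H. \<pi> h = q}"
      proof clarify
        fix x assume x: "x \<in> H" "x \<in> N"
        have xc: "x \<in> carrier G" using x(1) by (rule H.mem_carrier)
        have "(x \<otimes>\<^bsub>G\<^esub> h0) \<otimes>\<^bsub>G\<^esub> inv\<^bsub>G\<^esub> h0 = x" using xc h0c by (simp add: m_assoc)
        then have "\<pi> (x \<otimes>\<^bsub>G\<^esub> h0) = \<pi> h0" using \<pi>eq[of "x \<otimes>\<^bsub>G\<^esub> h0" h0] x(2) xc h0c by simp
        then show "x \<otimes>\<^bsub>G\<^esub> h0 \<in> H \<and> \<pi> (x \<otimes>\<^bsub>G\<^esub> h0) = q" using x(1) h0 by simp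
      qed
      show "(\<lambda>h. h \<otimes>\<^bsub>G\<^esub> inv\<^bsub>G\<^esub> h0) ` {h \<in> H. \<pi> h = q} \<subseteq> H \<inter> N"
      proof clarify
        fix h assume h: "h \<in> H" "q = \<pi> h"
        have hc: "h \<in> carrier G" using h(1) by (rule H.mem_carrier)
        have "h \<otimes>\<^bsub>G\<^esub> inv\<^bsub>G\<^esub> h0 \<in> N" using \<pi>eq[OF hc h0c] h(2) h0(2) by simp
        then show "h \<otimes>\<^bsub>G\<^esub> inv\<^bsub>G\<^esub> h0 \<in> H \<inter> N" using h(1) h0(1) by simp
      qed
    qed (use h0c in \<open>simp_all add: m_assoc\<close>)
    then show ?thesis by (metis bij_betw_same_card)
  qed
  have "card H = (\<Sum>q\<in>\<pi> ` H. card {h \<in> H. \<pi> h = q})"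
    using sum.image_gen[OF finH, of "\<lambda>_. 1::nat" \<pi>] by simp
  also have "\<dots> = (\<Sum>q\<in>\<pi> ` H. card (H \<inter> N))" by (rule sum.cong[OF refl fib])
  finally show ?thesis unfolding \<pi>_def by (simp add: mult.commute)
qed

section \<open>Commutators under the linear character of a center\<close>

context group begin

lemma hall_witt:
  assumes "x \<in> carrier G" "y \<in> carrier G" "z \<in> carrier G"
  shows "(inv y \<otimes> cmt G (cmt G x (inv y)) z \<otimes> y) \<otimes> (inv z \<otimes> cmt G (cmt G y (inv z)) x \<otimes> z)
    \<otimes> (inv x \<otimes> cmt G (cmt G z (inv x)) y \<otimes> x) = \<one>"
  using assms by (simp add: inv_mult_group m_assoc)

lemma central_charD:
  assumes cc: "central_char G Z K f"
  shows "K \<lhd> G" "Z = center_mod G K" "Z \<lhd> G" "K \<subseteq> Z" "Z \<subseteq> carrier G"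
    "\<And>x y. x \<in> Z \<Longrightarrow> y \<in> Z \<Longrightarrow> f (x \<otimes> y) = f x * f y"
    "\<And>x. x \<in> Z \<Longrightarrow> x \<in> K \<longleftrightarrow> f x = 1"
    "\<And>x g. x \<in> Z \<Longrightarrow> g \<in> carrier G \<Longrightarrow> cmt G x g \<in> K"
proof -
  show K: "K \<lhd> G" and Z: "Z = center_mod G K" using cc unfolding central_char_def by blast+
  show "Z \<lhd> G" unfolding Z by (rule center_mod_normal[OF K])
  show "K \<subseteq> Z" unfolding Z by (rule subset_center_mod[OF K])
  show "Z \<subseteq> carrier G" unfolding Z by (rule center_mod_subset)
  show "f (x \<otimes> y) = f x * f y" if "x \<in> Z" "y \<in> Z" for x y
    using cc that unfolding central_char_def by blast
  show "x \<in> K \<longleftrightarrow> f x = 1" if "x \<in> Z" for x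
    using cc that unfolding central_char_def by blast
  show "cmt G x g \<in> K" if "x \<in> Z" "g \<in> carrier G" for x g
    using that by (simp add: Z center_mod_def)
qed

text \<open>The correction factor in the product formula is a commutator with an element of
  \<open>Z\<close>, so it lies in \<open>K\<close> and \<open>f\<close> sends it to 1.\<close>

lemma central_char_cmt_mult:
  assumes cc: "central_char G Z K f" and xyz: "x \<in> carrier G" "y \<in> carrier G" "z \<in> carrier G"
  shows "cmt G x z \<in> Z \<Longrightarrow> cmt G y z \<in> Z \<Longrightarrow> f (cmt G (x \<otimes> y) z) = f (cmt G x z) * f (cmt G y z)"
    and "cmt G x y \<in> Z \<Longrightarrow> cmt G x z \<in> Z \<Longrightarrow> f (cmt G x (y \<otimes> z)) = f (cmt G x y) * f (cmt G x z)"
proof -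
  note D = central_charD[OF cc]
  interpret Z: normal Z G by (rule D(3))
  have 1: "f (cmt G c g) = 1" "cmt G c g \<in> Z" if "c \<in> Z" "g \<in> carrier G" for c g
    using D(8)[OF that] D(4) D(7)[of "cmt G c g"] by auto
  show "f (cmt G (x \<otimes> y) z) = f (cmt G x z) * f (cmt G y z)"
    if a: "cmt G x z \<in> Z" "cmt G y z \<in> Z"
      unfolding cmt_mult_left[OF xyz] using a 1[OF a(1) xyz(2)] by (simp add: D(6) Z.m_closed)
  show "f (cmt G x (y \<otimes> z)) = f (cmt G x y) * f (cmt G x z)"
    if a: "cmt G x y \<in> Z" "cmt G x z \<in> Z"
      unfolding cmt_mult_right[OF xyz] using a 1[OF a(1) xyz(3)] by (simp add: D(6) Z.m_closed)
qed

lemma central_char_pow: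
  assumes cc: "central_char G Z K f" and x: "x \<in> Z"
  shows "x [^] (k::nat) \<in> Z" "f (x [^] k) = f x ^ k"
proof -
  note D = central_charD[OF cc]
  interpret Z: normal Z G by (rule D(3))
  interpret K: normal K G by (rule D(1))
  have one: "f \<one> = 1" using D(7)[OF Z.one_closed] K.one_closed by blast
  have m: "x [^] k \<in> Z" for k :: nat by (induction k) (use x in auto)
  show "x [^] k \<in> Z" by (rule m)
  show "f (x [^] k) = f x ^ k"
    by (induction k) (use one D(6)[OF m x] in \<open>simp_all add: mult.commute\<close>)
qed

lemma central_char_cmt_pow:
  assumes cc: "central_char G Z K f" and xg: "x \<in> carrier G" "g \<in> carrier G"
    and a: "\<And>k::nat. cmt G (x [^] k) g \<in> Z"
  shows "f (cmt G (x [^] k) g) = f (cmt G x g) ^ k"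
proof (induction k)
  case 0
  have "f \<one> = 1"
    using central_char_pow(2)[OF cc a[of 1], of 0] by simp
  then show ?case using xg by (simp add: cmt_one)
next
  case (Suc k)
  have "cmt G x g \<in> Z" using a[of 1] xg by simp
  then have "f (cmt G (x [^] k \<otimes> x) g) = f (cmt G (x [^] k) g) * f (cmt G x g)"
    using a[of k] xg by (intro central_char_cmt_mult(1)[OF cc]) auto
  then show ?case using Suc.IH by (simp add: mult.commute)
qed

text \<open>An element is in the radical when all its commutators lie in the kernel \<open>K\<close>
  of \<open>f\<close>, that is, when it is central modulo \<open>K\<close>; this describes
  \<open>Z\<close>.\<close>

lemma central_char_alternating_pairing:
  assumes fin: "finite (carrier G)" and cc: "central_char G Z K f"
    and cm: "\<And>x y. x \<in> carrier G \<Longrightarrow> y \<in> carrier G \<Longrightarrow> cmt G x y \<in> Z"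
  shows "alternating_pairing G (\<lambda>x y. f (cmt G x y))"
    and "alternating_pairing.radical G (\<lambda>x y. f (cmt G x y)) = Z"
proof -
  note D = central_charD[OF cc]
  show ap: "alternating_pairing G (\<lambda>x y. f (cmt G x y))"
  proof (intro alternating_pairing.intro alternating_pairing_axioms.intro is_group fin)
    fix x y z assume xyz: "x \<in> carrier G" "y \<in> carrier G" "z \<in> carrier G"
    show "f (cmt G (x \<otimes> y) z) = f (cmt G x z) * f (cmt G y z)"
      by (rule central_char_cmt_mult(1)[OF cc xyz cm[OF xyz(1,3)] cm[OF xyz(2,3)]])
    show "f (cmt G x (y \<otimes> z)) = f (cmt G x y) * f (cmt G x z)"
      by (rule central_char_cmt_mult(2)[OF cc xyz cm[OF xyz(1,2)] cm[OF xyz(1,3)]])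
  next
    fix x assume x: "x \<in> carrier G"
    show "f (cmt G x x) = 1"
      using central_char_pow(2)[OF cc cm[OF x x], of 0] cmt_self[OF x] by simp
  qed
  show "alternating_pairing.radical G (\<lambda>x y. f (cmt G x y)) = Z"
    unfolding alternating_pairing.radical_def[OF ap] D(2) center_mod_def
    using D(7)[OF cm] by blast
qed

end

text \<open>Beyond this point characters enter only through \<open>C_char\<close> and
  \<open>separates\<close>. The index \<open>i\<close> does not determine the kernel of a character
  with center \<open>C i\<close>, hence the existential quantifiers over \<open>K\<close> and
  \<open>f\<close>.\<close>

locale chain_group = group G for G :: "('a, 'b) monoid_scheme" (structure) +
  fixes p e n :: nat and C :: "nat \<Rightarrow> 'a set"
  assumes p: "Factorial_Ring.prime p" and card_G: "card (carrier G) = p ^ e"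
    and C0: "C 0 = carrier G" and C_less: "i < n \<Longrightarrow> C (Suc i) \<subset> C i"
    and C_char: "i \<le> n \<Longrightarrow> \<exists>K f. central_char G (C i) K f"
    and separates: "N \<lhd> G \<Longrightarrow> g \<in> carrier G \<Longrightarrow> g \<notin> N \<Longrightarrow>
      \<exists>i\<le>n. \<exists>K f. central_char G (C i) K f \<and> N \<subseteq> K \<and> g \<notin> K"
begin

lemma fin: "finite (carrier G)"
  using card_G p by (metis card.infinite not_prime_0 power_not_zero)

lemma C_antimono: "i \<le> j \<Longrightarrow> j \<le> n \<Longrightarrow> C j \<subseteq> C i"
proof (induction j rule: dec_induct)
  case (step j)
  then show ?case using C_less[of j] by auto
qed simp

lemma C_normal: "i \<le> n \<Longrightarrow> C i \<lhd> G"
  using C_char central_charD(3) by blast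

text \<open>A character that is trivial on \<open>N\<close> but not on \<open>cmt G x g\<close>
  cannot have \<open>x\<close> in its center, so its center is some \<open>C j\<close> with
  \<open>j > i\<close>. That center contains everything central modulo \<open>N\<close>.\<close>

lemma center_mod_subset_next:
  assumes N: "N \<lhd> G" and i: "i < n" and x: "x \<in> C i" "g \<in> carrier G" "cmt G x g \<notin> N"
  shows "center_mod G N \<subseteq> C (Suc i)"
proof -
  have xc: "x \<in> carrier G" using x(1) C_antimono[of 0 i] i C0 by auto
  obtain j K f where j: "j \<le> n" "central_char G (C j) K f" "N \<subseteq> K" "cmt G x g \<notin> K"
    using separates[OF N cmt_closed[OF xc x(2)] x(3)] by blast
  note D = central_charD[OF j(2)]
  have "\<not> j \<le> i"
  proof
    assume "j \<le> i"
    then have "x \<in> C j" using C_antimono[of j i] x(1) i by auto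
    then show False using D(8) x(2) j(4) by blast
  qed
  then have "C j \<subseteq> C (Suc i)" using C_antimono[of "Suc i" j] j(1) by simp
  moreover have "center_mod G N \<subseteq> C j" unfolding D(2) by (rule center_mod_mono[OF j(3)])
  ultimately show ?thesis by blast
qed

text \<open>The nontrivial center of the \<open>p\<close>-group \<open>G / N\<close>, pulled back to
  \<open>G\<close>.\<close>

lemma center_mod_psupset:
  assumes N: "N \<lhd> G" "N \<noteq> carrier G"
  shows "\<exists>g\<in>center_mod G N. g \<notin> N"
proof -
  interpret N: normal N G by (rule N(1))
  have Q: "group (G Mod N)" by (rule N.factorgroup_is_group)
  have lag: "card (rcosets N) * card N = p ^ e" using lagrange[OF N.subgroup_axioms] card_G by (simp add: Coset.order_def)
  then have "card (rcosets N) dvd p ^ e" by (metis dvd_triv_left)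
  then obtain i where i: "card (rcosets N) = p ^ i" using divides_primepow_nat[OF p] by blast
  have "card N < card (carrier G)" using N.subset N(2) fin by (intro psubset_card_mono) auto
  then have i0: "i > 0" using lag i card_G by (cases i) auto
  have cQ: "card (carrier (G Mod N)) = p ^ i" using i by (simp add: FactGroup_def)
  obtain z where z: "z \<in> carrier (G Mod N)" "z \<noteq> \<one>\<^bsub>G Mod N\<^esub>"
      "\<And>q. q \<in> carrier (G Mod N) \<Longrightarrow> z \<otimes>\<^bsub>G Mod N\<^esub> q = q \<otimes>\<^bsub>G Mod N\<^esub> z"
    using p_group_center_nontrivial[OF Q p cQ i0] by (elim bexE conjE) blast
  obtain g where g: "g \<in> carrier G" "z = N #> g" using z(1) by (auto simp: FactGroup_def RCOSETS_def)
  have "g \<notin> N" using z(2) g N.rcos_const[OF is_group] by auto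
  moreover have "cmt G g h \<in> N" if h: "h \<in> carrier G" for h
  proof -
    have "N #> h \<in> carrier (G Mod N)" using h by (auto simp: FactGroup_def RCOSETS_def)
    from z(3)[OF this] have "(N #> g) <#> (N #> h) = (N #> h) <#> (N #> g)" using g(2) by simp
    then have eq: "N #> (g \<otimes> h) = N #> (h \<otimes> g)" using N.rcos_sum g(1) h by simp
    have gh: "g \<otimes> h \<in> carrier G" "h \<otimes> g \<in> carrier G" using g(1) h by auto
    have "g \<otimes> h \<in> N #> (h \<otimes> g)" using rcos_self[OF gh(1) N.subgroup_axioms] eq by simp
    then have "(g \<otimes> h) \<otimes> inv (h \<otimes> g) \<in> N" by (rule N.rcos_module_imp[OF is_group gh(2)])
    then have "inv (h \<otimes> g) \<otimes> ((g \<otimes> h) \<otimes> inv (h \<otimes> g)) \<otimes> (h \<otimes> g) \<in> N"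
      by (rule N.inv_op_closed1[OF gh(2)])
    then show ?thesis using g(1) h by (simp add: m_assoc inv_mult_group)
  qed
  ultimately show ?thesis using g(1) by (auto simp: center_mod_def)
qed

text \<open>Otherwise \<open>center_mod_subset_next\<close> with \<open>N = C (Suc i)\<close> would
  confine all elements central modulo \<open>C (Suc i)\<close> to \<open>C (Suc i)\<close> itself,
  although the corresponding quotient is a nontrivial \<open>p\<close>-group.\<close>

lemma cmt_in_next:
  assumes i: "i < n" and x: "x \<in> C i" "g \<in> carrier G"
  shows "cmt G x g \<in> C (Suc i)"
proof (rule ccontr)
  assume a: "cmt G x g \<notin> C (Suc i)"
  have N: "C (Suc i) \<lhd> G" using i by (intro C_normal) simp
  have "C (Suc i) \<subset> carrier G" using C_less[OF i] C_antimono[of 0 i] C0 i by auto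
  then have "\<exists>g\<in>center_mod G (C (Suc i)). g \<notin> C (Suc i)" by (intro center_mod_psupset[OF N]) auto
  then show False using center_mod_subset_next[OF N i x a] by blast
qed

text \<open>Some power of the linear character \<open>f\<close> of a center \<open>C (Suc i)\<close> has order \<open>p\<close> on
  \<open>[C i, G]\<close>; the kernel of that power is the normal subgroup \<open>N\<close> to test against.\<close>

lemma pow_in_next:
  assumes i: "i < n" and x: "x \<in> C i"
  shows "x [^] p \<in> C (Suc i)"
proof -
  obtain K f where cc: "central_char G (C (Suc i)) K f" using C_char[of "Suc i"] i by auto
  note D = central_charD[OF cc]
  interpret Z: normal "C (Suc i)" G by (rule D(3))
  have Ci: "C i \<lhd> G" using i by (intro C_normal) simp
  interpret Ci: normal "C i" G by (rule Ci)
  have cm: "cmt G y g \<in> C (Suc i)" if "y \<in> C i" "g \<in> carrier G" for y g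
    by (rule cmt_in_next[OF i that])
  \<comment> \<open>\<open>P k\<close> says that \<open>f\<close> takes values among the
    \<open>p ^ k\<close>-th roots of unity on commutators of \<open>C i\<close> with
    \<open>G\<close>. The least such \<open>k\<close> is positive, since \<open>P 0\<close> would
    make \<open>C i\<close> central modulo \<open>K\<close> and thus put it inside
    \<open>C (Suc i)\<close>.\<close>
  define P where "P k \<longleftrightarrow> (\<forall>y\<in>C i. \<forall>g\<in>carrier G. f (cmt G y g) ^ (p ^ k) = 1)" for k
  have f1: "f z = 1" if "z = \<one>" for z
    using central_char_pow(2)[OF cc Z.one_closed, of 0] that by simp
  have "P e" unfolding P_def
  proof (intro ballI)
    fix y g assume yg: "y \<in> C i" "g \<in> carrier G"
    have "cmt G y g [^] (p ^ e) = \<one>"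
      using pow_order_eq_1[of "cmt G y g"] yg Ci.mem_carrier card_G by (simp add: Coset.order_def)
    then show "f (cmt G y g) ^ (p ^ e) = 1"
      using central_char_pow(2)[OF cc cm[OF yg], of "p ^ e"] f1 by simp
  qed
  define k where "k = (LEAST k. P k)"
  have k: "P k" unfolding k_def using \<open>P e\<close> by (rule LeastI)
  have "\<not> P 0"
  proof
    assume P0: "P 0"
    have "C i \<subseteq> center_mod G K"
    proof
      fix y assume y: "y \<in> C i"
      have "cmt G y g \<in> K" if g: "g \<in> carrier G" for g
        using P0 y g D(7)[OF cm[OF y g]] by (simp add: P_def)
      then show "y \<in> center_mod G K" using y by (simp add: center_mod_def)
    qed
    then show False using C_less[OF i] D(2) by blast
  qed
  then obtain m where m: "k = Suc m" using k by (cases k) auto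
  have nP: "\<not> P m" using not_less_Least[of m P] m by (simp add: k_def)
  then obtain y0 g0 where y0: "y0 \<in> C i" "g0 \<in> carrier G" "f (cmt G y0 g0) ^ (p ^ m) \<noteq> 1"
    by (auto simp: P_def)
  \<comment> \<open>By minimality of \<open>k = Suc m\<close> this subgroup misses the commutator of
    \<open>y0\<close> and \<open>g0\<close>. It contains every commutator with
    \<open>x [^] p\<close>, because there \<open>f\<close> is a \<open>p\<close>-th power of a value
    on commutators.\<close>
  define N where "N = {z \<in> C (Suc i). f z ^ (p ^ m) = 1}"
  have KN: "K \<subseteq> N"
  proof
    fix z assume "z \<in> K"
    then show "z \<in> N" using D(4) D(7)[of z] by (auto simp: N_def)
  qed
  have N: "N \<lhd> G"
  proof (rule normalI_cmt)
    show "subgroup N G"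
    proof (rule finite_subgroupI[OF fin])
      show "N \<subseteq> carrier G" using Z.subset by (auto simp: N_def)
      show "\<one> \<in> N" using f1 by (simp add: N_def)
      fix y z assume "y \<in> N" "z \<in> N"
      then show "y \<otimes> z \<in> N" by (simp add: N_def D(6) power_mult_distrib)
    qed
    fix z g assume "z \<in> N" "g \<in> carrier G"
    then have "cmt G z g \<in> K" using D(8) by (simp add: N_def)
    then show "cmt G z g \<in> N" using KN by blast
  qed
  have "cmt G y0 g0 \<notin> N" using y0(3) by (simp add: N_def)
  from center_mod_subset_next[OF N i y0(1,2) this] have sub: "center_mod G N \<subseteq> C (Suc i)" .
  have xp: "x [^] (l::nat) \<in> C i" for l by (induction l) (use x in auto)
  have "cmt G (x [^] p) g \<in> N" if g: "g \<in> carrier G" for g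
  proof -
    have "f (cmt G (x [^] p) g) = f (cmt G x g) ^ p"
      by (rule central_char_cmt_pow[OF cc _ g cm[OF xp g]]) (use x in simp)
    then have "f (cmt G (x [^] p) g) ^ (p ^ m) = f (cmt G x g) ^ (p ^ k)"
      by (simp add: m power_mult)
    then show ?thesis using k x g cm[OF xp g, of p] by (simp add: N_def P_def)
  qed
  then have "x [^] p \<in> center_mod G N" using x by (simp add: center_mod_def)
  then show ?thesis using sub by blast
qed

end

section \<open>Semi-extraspecial quotients\<close>

lemma grp_center_eq_center_mod: "group E \<Longrightarrow> grp_center E = center_mod E {\<one>\<^bsub>E\<^esub>}"
  by (auto simp: grp_center_def center_mod_def group.cmt_eq_one_iff)

text \<open>Only the Frattini subgroup needs work. A maximal subgroup \<open>H\<close> not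
  containing the center would satisfy \<open>H Z = E\<close>, so that
  \<open>E' = [H, H] \<subseteq> H\<close>, although \<open>E' = Z\<close>. Conversely, a noncentral
  \<open>g\<close> is avoided by the centralizer of an element \<open>y\<close> not commuting with
  it, and this centralizer is maximal.\<close>

lemma extraspecialI:
  assumes p: "Factorial_Ring.prime (p::nat)" and pg: "p_group p E"
    and Z: "grp_center E = derived_subgroup E" and card: "card (grp_center E) = p"
  shows "extraspecial p E"
proof -
  interpret group E using pg by (simp add: p_group_def)
  have fin: "finite (carrier E)" using pg by (simp add: p_group_def)
  define Z where "Z = grp_center E"
  have ZD: "Z = derived_subgroup E" using Z by (simp add: Z_def)
  have "Z \<lhd> E" unfolding Z_def grp_center_eq_center_mod[OF group_axioms]
    by (rule center_mod_normal[OF one_is_normal])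
  then interpret Z: normal Z E .
  have central: "z \<otimes>\<^bsub>E\<^esub> g = g \<otimes>\<^bsub>E\<^esub> z" if "z \<in> Z" "g \<in> carrier E" for z g
    using that unfolding Z_def grp_center_def by blast
  have cm1: "cmt E z g = \<one>\<^bsub>E\<^esub>" if "z \<in> Z" "g \<in> carrier E" for z g
    using cmt_eq_one_iff[of z g] central[OF that] that by simp
  have cm2: "cmt E g z = \<one>\<^bsub>E\<^esub>" if "z \<in> Z" "g \<in> carrier E" for z g
    using cmt_eq_one_iff[of g z] central[OF that] that by simp
  have cZ: "cmt E x y \<in> Z" if "x \<in> carrier E" "y \<in> carrier E" for x y
    unfolding ZD using that by (rule cmt_in_comm_subgroup)
  have ml: "cmt E (x \<otimes>\<^bsub>E\<^esub> y) z = cmt E x z \<otimes>\<^bsub>E\<^esub> cmt E y z"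
    if "x \<in> carrier E" "y \<in> carrier E" "z \<in> carrier E" for x y z
    unfolding cmt_mult_left[OF that] using cm1[OF cZ[OF that(1,3)] that(2)] that by simp
  have mr: "cmt E x (y \<otimes>\<^bsub>E\<^esub> z) = cmt E x z \<otimes>\<^bsub>E\<^esub> cmt E x y"
    if "x \<in> carrier E" "y \<in> carrier E" "z \<in> carrier E" for x y z
    unfolding cmt_mult_right[OF that] using cm1[OF cZ[OF that(1,2)] that(3)] that by simp
  have "Z \<subseteq> H" if H: "maximal_subgroup H E" for H
  proof
    fix z assume z: "z \<in> Z"
    have Hs: "subgroup H E" and max: "\<And>K. subgroup K E \<Longrightarrow> H \<subseteq> K \<Longrightarrow> K = H \<or> K = carrier E"
      using H by (auto simp: maximal_subgroup_def)
    interpret H: subgroup H E by (rule Hs)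
    show "z \<in> H"
    proof (rule ccontr)
      assume zH: "z \<notin> H"
      define M where "M = {h \<otimes>\<^bsub>E\<^esub> w | h w. h \<in> H \<and> w \<in> Z}"
      have HM: "H \<subseteq> M"
      proof
        fix h assume h: "h \<in> H"
        then have "h = h \<otimes>\<^bsub>E\<^esub> \<one>\<^bsub>E\<^esub>" by simp
        then show "h \<in> M" using h Z.one_closed unfolding M_def by blast
      qed
      have "z = \<one>\<^bsub>E\<^esub> \<otimes>\<^bsub>E\<^esub> z" using z by simp
      then have zM: "z \<in> M" using z H.one_closed unfolding M_def by blast
      have "subgroup M E"
      proof (rule finite_subgroupI[OF fin])
        show "M \<subseteq> carrier E" unfolding M_def by auto
        show "\<one>\<^bsub>E\<^esub> \<in> M" using HM H.one_closed by blast
        fix x y assume "x \<in> M" "y \<in> M"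
        then obtain h w h' w' where x: "x = h \<otimes>\<^bsub>E\<^esub> w" "h \<in> H" "w \<in> Z" "y = h' \<otimes>\<^bsub>E\<^esub> w'" "h' \<in> H" "w' \<in> Z"
          unfolding M_def by blast
        have c: "h \<in> carrier E" "w \<in> carrier E" "h' \<in> carrier E" "w' \<in> carrier E" using x by auto
        have "x \<otimes>\<^bsub>E\<^esub> y = h \<otimes>\<^bsub>E\<^esub> (w \<otimes>\<^bsub>E\<^esub> h') \<otimes>\<^bsub>E\<^esub> w'" unfolding x(1,4) using c by (simp add: m_assoc)
        also have "\<dots> = (h \<otimes>\<^bsub>E\<^esub> h') \<otimes>\<^bsub>E\<^esub> (w \<otimes>\<^bsub>E\<^esub> w')"
          unfolding central[OF x(3) c(3)] using c by (simp add: m_assoc)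
        finally show "x \<otimes>\<^bsub>E\<^esub> y \<in> M" unfolding M_def using x H.m_closed Z.m_closed by blast
      qed
      then have ME: "M = carrier E" using max[OF _ HM] zM zH by blast
      have "cmt E x y \<in> H" if xy: "x \<in> carrier E" "y \<in> carrier E" for x y
      proof -
        obtain h w where x: "x = h \<otimes>\<^bsub>E\<^esub> w" "h \<in> H" "w \<in> Z" using xy(1) unfolding ME[symmetric] M_def by blast
        obtain h' w' where y: "y = h' \<otimes>\<^bsub>E\<^esub> w'" "h' \<in> H" "w' \<in> Z" using xy(2) unfolding ME[symmetric] M_def by blast
        have c: "h \<in> carrier E" "w \<in> carrier E" "h' \<in> carrier E" "w' \<in> carrier E" using x y by auto
        have "cmt E x y = cmt E h y" unfolding x(1) ml[OF c(1,2) xy(2)] cm1[OF x(3) xy(2)] using c xy by simp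
        also have "\<dots> = cmt E h h'" unfolding y(1) mr[OF c(1,3,4)] cm2[OF y(3) c(1)] using c by simp
        finally show ?thesis using x(2) y(2) by simp
      qed
      then have "derived_subgroup E \<subseteq> H"
        using comm_subgroup_subset_iff[of "carrier E" "carrier E" H] Hs by blast
      then show False using z zH unfolding ZD by blast
    qed
  qed
  then have "Z \<subseteq> frattini E" unfolding frattini_def using Z.subset by blast
  moreover have "frattini E \<subseteq> Z"
  proof
    fix g assume g: "g \<in> frattini E"
    then have gc: "g \<in> carrier E" by (simp add: frattini_def)
    show "g \<in> Z"
    proof (rule ccontr)
      assume "g \<notin> Z"
      then obtain y where y: "y \<in> carrier E" "g \<otimes>\<^bsub>E\<^esub> y \<noteq> y \<otimes>\<^bsub>E\<^esub> g"
        using gc unfolding Z_def grp_center_def by blast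
      define Cy where "Cy = {x \<in> carrier E. cmt E x y = \<one>\<^bsub>E\<^esub>}"
      have gCy: "g \<notin> Cy" using y gc cmt_eq_one_iff[OF gc y(1)] by (simp add: Cy_def)
      have subCy: "subgroup Cy E"
      proof (rule finite_subgroupI[OF fin])
        show "\<one>\<^bsub>E\<^esub> \<in> Cy" using y(1) by (simp add: Cy_def cmt_one)
        fix a b assume "a \<in> Cy" "b \<in> Cy"
        then show "a \<otimes>\<^bsub>E\<^esub> b \<in> Cy" using ml[of a b y] y(1) by (simp add: Cy_def)
      qed (simp add: Cy_def)
      have "K = Cy \<or> K = carrier E" if K: "subgroup K E" "Cy \<subseteq> K" for K
      proof (rule disjCI)
        assume "K \<noteq> carrier E"
        show "K = Cy"
        proof (rule ccontr)
          assume "K \<noteq> Cy"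
          interpret K: subgroup K E by (rule K(1))
          obtain k where k: "k \<in> K" "k \<notin> Cy" using K(2) \<open>K \<noteq> Cy\<close> by blast
          \<comment> \<open>The map \<open>x \<mapsto> cmt E x y\<close> is a homomorphism with
            kernel \<open>Cy\<close>. It sends \<open>K\<close> onto a nontrivial subgroup of a
            group of order \<open>p\<close>, hence onto all of \<open>Z\<close>, so \<open>K\<close>
            meets every coset of \<open>Cy\<close>.\<close>
          define I where "I = (\<lambda>x. cmt E x y) ` K"
          have Isub: "subgroup I E"
          proof (rule finite_subgroupI[OF fin])
            show "I \<subseteq> carrier E" using y(1) by (auto simp: I_def)
            have "cmt E \<one>\<^bsub>E\<^esub> y \<in> I" unfolding I_def using K.one_closed by blast
            then show "\<one>\<^bsub>E\<^esub> \<in> I" using cmt_one(2)[OF y(1)] by simp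
            fix a b assume "a \<in> I" "b \<in> I"
            then obtain u v where uv: "u \<in> K" "a = cmt E u y" "v \<in> K" "b = cmt E v y" unfolding I_def by blast
            have "a \<otimes>\<^bsub>E\<^esub> b = cmt E (u \<otimes>\<^bsub>E\<^esub> v) y" using ml[of u v y] uv y(1) by simp
            then show "a \<otimes>\<^bsub>E\<^esub> b \<in> I" unfolding I_def using uv K.m_closed by blast
          qed
          have IZ: "I \<subseteq> Z" unfolding I_def using cZ y(1) by auto
          have finZ: "finite Z" using Z.subset fin by (rule finite_subset)
          have "card I dvd p"
            using subgroup_card_dvd[OF group_axioms Z.subgroup_axioms Isub IZ fin] card by (simp add: Z_def)
          moreover have "card I \<noteq> 1"
          proof
            assume "card I = 1"
            then obtain i where i: "I = {i}" by (auto simp: card_1_singleton_iff)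
            have "\<one>\<^bsub>E\<^esub> = i" using subgroup.one_closed[OF Isub] unfolding i by (rule singletonD)
            moreover have "cmt E k y \<in> I" unfolding I_def using k(1) by (rule imageI)
            then have "cmt E k y = i" unfolding i by (rule singletonD)
            ultimately have "cmt E k y = \<one>\<^bsub>E\<^esub>" by (simp only:)
            then show False using k by (simp add: Cy_def)
          qed
          ultimately have "card I = card Z" using p card unfolding Z_def prime_nat_iff by blast
          then have IZ: "I = Z" by (rule card_subset_eq[OF finZ IZ])
          have "x \<in> K" if x: "x \<in> carrier E" for x
          proof -
            have "cmt E x y \<in> I" unfolding IZ by (rule cZ[OF x y(1)])
            then obtain u where u: "u \<in> K" "cmt E x y = cmt E u y" unfolding I_def by blast
            have uc: "u \<in> carrier E" "inv\<^bsub>E\<^esub> u \<in> carrier E" using u(1) by auto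
            have "cmt E (u \<otimes>\<^bsub>E\<^esub> inv\<^bsub>E\<^esub> u) y = cmt E u y \<otimes>\<^bsub>E\<^esub> cmt E (inv\<^bsub>E\<^esub> u) y"
              by (rule ml[OF uc y(1)])
            moreover have "u \<otimes>\<^bsub>E\<^esub> inv\<^bsub>E\<^esub> u = \<one>\<^bsub>E\<^esub>" using uc by simp
            ultimately have "cmt E (x \<otimes>\<^bsub>E\<^esub> inv\<^bsub>E\<^esub> u) y = \<one>\<^bsub>E\<^esub>"
              using ml[OF x uc(2) y(1)] u(2) cmt_one(2)[OF y(1)] by metis
            then have "x \<otimes>\<^bsub>E\<^esub> inv\<^bsub>E\<^esub> u \<in> K" using K(2) x uc by (auto simp: Cy_def)
            then have "x \<otimes>\<^bsub>E\<^esub> inv\<^bsub>E\<^esub> u \<otimes>\<^bsub>E\<^esub> u \<in> K" using u(1) by (rule K.m_closed)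
            then show ?thesis using x uc by (simp add: m_assoc)
          qed
          then show False using \<open>K \<noteq> carrier E\<close> K.subset by blast
        qed
      qed
      moreover have "Cy \<noteq> carrier E" using gCy gc by blast
      ultimately have "maximal_subgroup Cy E" unfolding maximal_subgroup_def using subCy by blast
      then show False using g gCy by (auto simp: frattini_def)
    qed
  qed
  ultimately show ?thesis unfolding extraspecial_def using pg Z card by (simp add: Z_def)
qed

section \<open>Center, derived subgroup and order of a quotient\<close>

context
  fixes G :: "('a, 'b) monoid_scheme" (structure) and N
  assumes normal: "N \<lhd> G"
begin

interpretation normal N G by (rule normal)

lemma Mod_group_hom: "group_hom G (G Mod N) (\<lambda>g. N #> g)"
  by (rule group_hom.intro[OF is_group factorgroup_is_group]) (rule group_hom_axioms.intro[OF r_coset_hom_Mod])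

lemma Mod_cmt: "g \<in> carrier G \<Longrightarrow> h \<in> carrier G \<Longrightarrow> N #> cmt G g h = cmt (G Mod N) (N #> g) (N #> h)"
proof -
  assume gh: "g \<in> carrier G" "h \<in> carrier G"
  interpret \<pi>: group_hom G "G Mod N" "\<lambda>g. N #> g" by (rule Mod_group_hom)
  have "N #> (inv g \<otimes> inv h \<otimes> g \<otimes> h) =
     (N #> inv g) \<otimes>\<^bsub>G Mod N\<^esub> (N #> inv h) \<otimes>\<^bsub>G Mod N\<^esub> (N #> g) \<otimes>\<^bsub>G Mod N\<^esub> (N #> h)"
    using gh by (simp only: \<pi>.hom_mult inv_closed m_closed)
  then show ?thesis using gh by (simp only: \<pi>.hom_inv)
qed

lemma Mod_eq_one_iff: "g \<in> carrier G \<Longrightarrow> N #> g = \<one>\<^bsub>G Mod N\<^esub> \<longleftrightarrow> g \<in> N"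
  unfolding one_FactGroup using rcos_self[OF _ subgroup_axioms] rcos_const[OF is_group] by blast

lemma grp_center_Mod: "grp_center (G Mod N) = (\<lambda>g. N #> g) ` center_mod G N"
proof -
  have iff: "cmt (G Mod N) (N #> g) (N #> h) \<in> {\<one>\<^bsub>G Mod N\<^esub>} \<longleftrightarrow> cmt G g h \<in> N"
    if gh: "g \<in> carrier G" "h \<in> carrier G" for g h
    unfolding Mod_cmt[OF gh, symmetric] singleton_iff by (rule Mod_eq_one_iff[OF cmt_closed[OF gh]])
  have "center_mod (G Mod N) {\<one>\<^bsub>G Mod N\<^esub>} = (\<lambda>g. N #> g) ` center_mod G N"
  proof
    show "center_mod (G Mod N) {\<one>\<^bsub>G Mod N\<^esub>} \<subseteq> (\<lambda>g. N #> g) ` center_mod G N"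
    proof
      fix q assume q: "q \<in> center_mod (G Mod N) {\<one>\<^bsub>G Mod N\<^esub>}"
      then have "q \<in> (\<lambda>g. N #> g) ` carrier G"
        unfolding center_mod_def carrier_FactGroup by blast
      then obtain g where g: "q = N #> g" "g \<in> carrier G" by (rule imageE)
      have "cmt G g h \<in> N" if h: "h \<in> carrier G" for h
      proof -
        have "N #> h \<in> carrier (G Mod N)" unfolding carrier_FactGroup using h by (rule imageI)
        then have "cmt (G Mod N) (N #> g) (N #> h) \<in> {\<one>\<^bsub>G Mod N\<^esub>}"
          using q unfolding center_mod_def g(1) by blast
        then show ?thesis using iff[OF g(2) h] by blast
      qed
      then have "g \<in> center_mod G N" unfolding center_mod_def using g(2) by blast
      then show "q \<in> (\<lambda>g. N #> g) ` center_mod G N" unfolding g(1) by (rule imageI)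
    qed
    show "(\<lambda>g. N #> g) ` center_mod G N \<subseteq> center_mod (G Mod N) {\<one>\<^bsub>G Mod N\<^esub>}"
    proof
      fix q assume "q \<in> (\<lambda>g. N #> g) ` center_mod G N"
      then obtain g where g: "q = N #> g" "g \<in> center_mod G N" by (rule imageE)
      have gc: "g \<in> carrier G" and gN: "\<And>h. h \<in> carrier G \<Longrightarrow> cmt G g h \<in> N"
        using g(2) unfolding center_mod_def by blast+
      have "cmt (G Mod N) q x \<in> {\<one>\<^bsub>G Mod N\<^esub>}" if x: "x \<in> carrier (G Mod N)" for x
      proof -
        obtain h where h: "x = N #> h" "h \<in> carrier G"
          using x unfolding carrier_FactGroup by (rule imageE)
        show ?thesis unfolding h(1) g(1) using iff[OF gc h(2)] gN[OF h(2)] by blast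
      qed
      moreover have "q \<in> carrier (G Mod N)" unfolding carrier_FactGroup g(1) using gc by (rule imageI)
      ultimately show "q \<in> center_mod (G Mod N) {\<one>\<^bsub>G Mod N\<^esub>}" unfolding center_mod_def by blast
    qed
  qed
  then show ?thesis unfolding grp_center_eq_center_mod[OF factorgroup_is_group] .
qed

lemma derived_subgroup_Mod: "derived_subgroup (G Mod N) = (\<lambda>g. N #> g) ` derived_subgroup G"
proof -
  interpret \<pi>: group_hom G "G Mod N" "\<lambda>g. N #> g" by (rule Mod_group_hom)
  have "{cmt (G Mod N) a b | a b. a \<in> carrier (G Mod N) \<and> b \<in> carrier (G Mod N)} =
    (\<lambda>g. N #> g) ` {cmt G a b | a b. a \<in> carrier G \<and> b \<in> carrier G}" (is "?L = ?R")
  proof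
    show "?L \<subseteq> ?R"
    proof
      fix q assume "q \<in> ?L"
      then obtain a b where ab: "a \<in> carrier G" "b \<in> carrier G" "q = cmt (G Mod N) (N #> a) (N #> b)"
        unfolding carrier_FactGroup by blast
      then have "q = N #> cmt G a b" by (simp only: Mod_cmt)
      then show "q \<in> ?R" using ab by blast
    qed
    show "?R \<subseteq> ?L"
    proof
      fix q assume "q \<in> ?R"
      then obtain a b where ab: "a \<in> carrier G" "b \<in> carrier G" "q = N #> cmt G a b" by blast
      then have "q = cmt (G Mod N) (N #> a) (N #> b)" by (simp only: Mod_cmt)
      then show "q \<in> ?L" using ab unfolding carrier_FactGroup by blast
    qed
  qed
  then show ?thesis unfolding comm_subgroup_def
    using \<pi>.generate_img[of "{cmt G a b | a b. a \<in> carrier G \<and> b \<in> carrier G}"] by auto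
qed

lemma p_group_Mod:
  assumes p: "Factorial_Ring.prime p" and "p_group p G"
  shows "p_group p (G Mod N)"
proof -
  have fin: "finite (carrier G)" and ord: "\<exists>k. Coset.order G = p ^ k" using assms(2) by (auto simp: p_group_def)
  have "card (rcosets N) * card N = Coset.order G" by (rule lagrange[OF subgroup_axioms])
  then have "card (rcosets N) dvd Coset.order G" by (metis dvd_triv_left)
  then obtain i where "card (rcosets N) = p ^ i" using ord divides_primepow_nat[OF p] by auto
  then have "Coset.order (G Mod N) = p ^ i" by (simp add: Coset.order_def FactGroup_def)
  moreover have "finite (carrier (G Mod N))" unfolding carrier_FactGroup using fin by simp
  ultimately show ?thesis unfolding p_group_def using factorgroup_is_group by blast
qed

end

text \<open>A subgroup \<open>N\<close> of index \<open>p\<close> in the center does not contain the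
  derived subgroup, which equals the center. So \<open>sep\<close> keeps the center of the quotient
  by \<open>N\<close> from growing, and its order is \<open>p\<close>.\<close>

lemma semi_extraspecialI:
  assumes p: "Factorial_Ring.prime (p::nat)" and pg: "p_group p Q" and Z: "grp_center Q = derived_subgroup Q"
    and sep: "\<And>N. N \<lhd> Q \<Longrightarrow> \<not> derived_subgroup Q \<subseteq> N \<Longrightarrow> center_mod Q N \<subseteq> grp_center Q"
  shows "semi_extraspecial p Q"
  unfolding semi_extraspecial_def
proof (intro conjI allI impI pg)
  fix N assume N: "subgroup N Q \<and> N \<subseteq> grp_center Q \<and> card (grp_center Q) = p * card N"
  interpret group Q using pg by (simp add: p_group_def)
  have fin: "finite (carrier Q)" using pg by (simp add: p_group_def)
  interpret N: subgroup N Q using N by blast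
  have Zn: "grp_center Q \<lhd> Q" unfolding grp_center_eq_center_mod[OF group_axioms]
    by (rule center_mod_normal[OF one_is_normal])
  have finN: "finite N" using N.subset fin by (rule finite_subset)
  have cardN: "card N > 0" using finN N.one_closed unfolding card_gt_0_iff by blast
  have central: "cmt Q z g = \<one>\<^bsub>Q\<^esub>" if "z \<in> grp_center Q" "g \<in> carrier Q" for z g
    using that unfolding grp_center_eq_center_mod[OF group_axioms] by (simp add: center_mod_def)
  have Nn: "N \<lhd> Q"
  proof (rule normalI_cmt)
    fix x g assume xg: "x \<in> N" "g \<in> carrier Q"
    then have "cmt Q x g = \<one>\<^bsub>Q\<^esub>" using N central by blast
    then show "cmt Q x g \<in> N" using N.one_closed by (simp only:)
  qed (use N in blast)
  have "\<not> derived_subgroup Q \<subseteq> N"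
  proof
    assume "derived_subgroup Q \<subseteq> N"
    then have "card (grp_center Q) \<le> card N" using card_mono[OF finN] Z by simp
    then have "p * card N \<le> card N" using N by simp
    then show False using cardN prime_gt_1_nat[OF p] by simp
  qed
  from sep[OF Nn this] have c1: "center_mod Q N \<subseteq> grp_center Q" .
  have c2: "grp_center Q \<subseteq> center_mod Q N"
  proof
    fix z assume z: "z \<in> grp_center Q"
    then have "cmt Q z g \<in> N" if "g \<in> carrier Q" for g using central[OF z that] N.one_closed by simp
    then show "z \<in> center_mod Q N" using z by (simp add: center_mod_def grp_center_def)
  qed
  have ZQ: "grp_center (Q Mod N) = (\<lambda>g. N #>\<^bsub>Q\<^esub> g) ` grp_center Q"
    unfolding grp_center_Mod[OF Nn] using c1 c2 by blast
  show "extraspecial p (Q Mod N)"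
  proof (rule extraspecialI[OF p p_group_Mod[OF Nn p pg]])
    show "grp_center (Q Mod N) = derived_subgroup (Q Mod N)"
      unfolding ZQ Z derived_subgroup_Mod[OF Nn] ..
    have "card (grp_center Q) = card (grp_center Q \<inter> N) * card ((\<lambda>g. N #>\<^bsub>Q\<^esub> g) ` grp_center Q)"
      by (rule card_eq_card_kernel_image[OF group_axioms fin Nn normal_imp_subgroup[OF Zn]])
    moreover have "grp_center Q \<inter> N = N" using N by blast
    ultimately show "card (grp_center (Q Mod N)) = p"
      unfolding ZQ using N cardN by simp
  qed
qed

section \<open>Square indices, semi-extraspecial quotients and the upper bound\<close>

context chain_group
begin

abbreviation D where "D \<equiv> derived_subgroup G"
abbreviation L where "L \<equiv> comm_subgroup G (C 1) (carrier G)"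

lemma p_group: "p_group p G"
  unfolding p_group_def using fin card_G is_group by (auto simp: Coset.order_def)

lemma D_normal: "D \<lhd> G"
  by (rule comm_subgroup_normal(1)[OF normal_inv_iff[THEN iffD2]]) (auto intro: subgroup_self)

lemma D_subset_iff: "subgroup S G \<Longrightarrow> D \<subseteq> S \<longleftrightarrow> (\<forall>x\<in>carrier G. \<forall>y\<in>carrier G. cmt G x y \<in> S)"
  by (rule comm_subgroup_subset_iff) auto

lemma cmt_in_D: "x \<in> carrier G \<Longrightarrow> y \<in> carrier G \<Longrightarrow> cmt G x y \<in> D"
  by (rule cmt_in_comm_subgroup)

lemma C_subset_carrier: "i \<le> n \<Longrightarrow> C i \<subseteq> carrier G"
  using C_antimono[of 0 i] C0 by simp

lemma center_mod_subset_C1: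
  assumes "1 \<le> n" and N: "N \<lhd> G" "\<not> D \<subseteq> N"
  shows "center_mod G N \<subseteq> C 1"
proof -
  obtain x y where xy: "x \<in> carrier G" "y \<in> carrier G" "cmt G x y \<notin> N"
    using N D_subset_iff[OF normal_imp_subgroup[OF N(1)]] by blast
  show ?thesis using center_mod_subset_next[OF N(1), of 0 x y] xy C0 assms(1) by simp
qed

lemma D_subset_C1: "1 \<le> n \<Longrightarrow> D \<subseteq> C 1"
  using D_subset_iff[OF normal_imp_subgroup[OF C_normal]] cmt_in_next[of 0] C0 by simp

lemma L_normal: "1 \<le> n \<Longrightarrow> L \<lhd> G"
  by (rule comm_subgroup_normal(1)[OF C_normal])

lemma cmt_in_L: "x \<in> C 1 \<Longrightarrow> g \<in> carrier G \<Longrightarrow> cmt G x g \<in> L"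
  by (rule cmt_in_comm_subgroup)

lemma L_subset_iff: "1 \<le> n \<Longrightarrow> subgroup S G \<Longrightarrow> L \<subseteq> S \<longleftrightarrow> (\<forall>x\<in>C 1. \<forall>g\<in>carrier G. cmt G x g \<in> S)"
  by (rule comm_subgroup_subset_iff[OF C_subset_carrier]) auto

lemma L_subset_D: "1 \<le> n \<Longrightarrow> L \<subseteq> D"
  using L_subset_iff[OF _ normal_imp_subgroup[OF D_normal]] cmt_in_D C_subset_carrier by blast

lemma center_mod_eq_C1:
  assumes "1 \<le> n" "N \<lhd> G" "\<not> D \<subseteq> N" "L \<subseteq> N"
  shows "center_mod G N = C 1"
proof
  show "center_mod G N \<subseteq> C 1" by (rule center_mod_subset_C1[OF assms(1-3)])
  show "C 1 \<subseteq> center_mod G N"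
    using assms(4) cmt_in_L C_subset_carrier[OF assms(1)] by (auto simp: center_mod_def)
qed

lemma index_square:
  assumes j: "j \<le> n" and D: "D \<subseteq> C j"
  shows "is_square (sg_index (carrier G) (C j))"
proof -
  obtain K f where cc: "central_char G (C j) K f" using C_char[OF j] by blast
  have cm: "cmt G x y \<in> C j" if "x \<in> carrier G" "y \<in> carrier G" for x y
    using D cmt_in_D[OF that] by blast
  have ap: "alternating_pairing G (\<lambda>x y. f (cmt G x y))"
    by (rule central_char_alternating_pairing(1)[OF fin cc]) (rule cm)
  have rad: "alternating_pairing.radical G (\<lambda>x y. f (cmt G x y)) = C j"
    by (rule central_char_alternating_pairing(2)[OF fin cc]) (rule cm)
  show ?thesis
    using alternating_pairing.index_radical_square[OF ap] unfolding rad is_square_def sg_index_def .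
qed

lemma set_mult_subset:
  assumes M: "subgroup M G" "H \<subseteq> M" "K \<subseteq> M"
  shows "H <#> K \<subseteq> M"
proof
  interpret M: subgroup M G by (rule M(1))
  fix x assume "x \<in> H <#> K"
  then obtain h k where "h \<in> H" "k \<in> K" "x = h \<otimes> k" unfolding set_mult_def by blast
  then show "x \<in> M" using M(2,3) M.m_closed by blast
qed

lemma subset_set_mult:
  assumes "subgroup H G" "subgroup K G"
  shows "H \<subseteq> H <#> K" "K \<subseteq> H <#> K"
proof -
  interpret H: subgroup H G by (rule assms(1))
  interpret K: subgroup K G by (rule assms(2))
  show "H \<subseteq> H <#> K"
  proof
    fix h assume h: "h \<in> H"
    then have "h = h \<otimes> \<one>" by simp
    then show "h \<in> H <#> K" using h K.one_closed unfolding set_mult_def by blast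
  qed
  show "K \<subseteq> H <#> K"
  proof
    fix k assume k: "k \<in> K"
    then have "k = \<one> \<otimes> k" by simp
    then show "k \<in> H <#> K" using k H.one_closed unfolding set_mult_def by blast
  qed
qed

lemma normal_set_mult_subgroup:
  assumes N: "N \<lhd> G" and H: "subgroup H G"
  shows "subgroup (N <#> H) G"
proof (rule finite_subgroupI[OF fin])
  interpret N: normal N G by (rule N)
  interpret H: subgroup H G by (rule H)
  show "N <#> H \<subseteq> carrier G" unfolding set_mult_def by auto
  show "\<one> \<in> N <#> H" using subset_set_mult(2)[OF N.subgroup_axioms H] H.one_closed by blast
  fix x y assume "x \<in> N <#> H" "y \<in> N <#> H"
  then obtain a h b k where x: "a \<in> N" "h \<in> H" "x = a \<otimes> h" "b \<in> N" "k \<in> H" "y = b \<otimes> k"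
    unfolding set_mult_def by blast
  have c: "a \<in> carrier G" "h \<in> carrier G" "b \<in> carrier G" "k \<in> carrier G" using x by auto
  have "x \<otimes> y = (a \<otimes> (h \<otimes> b \<otimes> inv h)) \<otimes> (h \<otimes> k)" unfolding x(3,6) using c by (simp add: m_assoc)
  moreover have "a \<otimes> (h \<otimes> b \<otimes> inv h) \<in> N" using x(1) N.inv_op_closed2[OF c(2) x(4)] by (rule N.m_closed)
  moreover have "h \<otimes> k \<in> H" using x by simp
  ultimately show "x \<otimes> y \<in> N <#> H" unfolding set_mult_def by blast
qed

lemma image_Mod_set_mult:
  assumes N: "N \<lhd> G" and H: "subgroup H G"
  shows "(\<lambda>g. N #> g) ` (N <#> H) = (\<lambda>g. N #> g) ` H"
proof
  interpret N: normal N G by (rule N)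
  interpret H: subgroup H G by (rule H)
  show "(\<lambda>g. N #> g) ` H \<subseteq> (\<lambda>g. N #> g) ` (N <#> H)"
    using subset_set_mult(2)[OF N.subgroup_axioms H] by blast
  show "(\<lambda>g. N #> g) ` (N <#> H) \<subseteq> (\<lambda>g. N #> g) ` H"
  proof clarify
    fix x assume "x \<in> N <#> H"
    then obtain a h where x: "a \<in> N" "h \<in> H" "x = a \<otimes> h" unfolding set_mult_def by blast
    have c: "a \<in> carrier G" "h \<in> carrier G" using x by auto
    have "N #> x = (N #> a) #> h" unfolding x(3) using coset_mult_assoc[OF N.subset c] by simp
    then have "N #> x = N #> h" using N.rcos_const[OF is_group x(1)] by simp
    then show "N #> x \<in> (\<lambda>g. N #> g) ` H" using x(2) by blast
  qed
qed

text \<open>The image of \<open>C 1\<close> is both the center and the derived subgroup of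
  \<open>G / N\<close>. A normal subgroup of the quotient that does not contain the latter pulls
  back to some \<open>M\<close> not containing \<open>D\<close>, and elements central modulo
  \<open>M\<close> lie in \<open>C 1\<close>.\<close>

lemma semi_extraspecial_quotient:
  assumes n: "1 \<le> n" and N: "N \<lhd> G" "L \<subseteq> N" "N \<noteq> C 1" "N <#> D = C 1"
  shows "semi_extraspecial p (G Mod N)" "grp_center (G Mod N) = (\<lambda>g. N #> g) ` C 1"
proof -
  interpret N: normal N G by (rule N(1))
  have subD: "subgroup D G" by (rule normal_imp_subgroup[OF D_normal])
  have nD: "\<not> D \<subseteq> N"
  proof
    assume DN: "D \<subseteq> N"
    have "N <#> D \<subseteq> N" by (rule set_mult_subset[OF N.subgroup_axioms subset_refl DN])
    then show False using subset_set_mult(1)[OF N.subgroup_axioms subD] N(3,4) by blast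
  qed
  show center: "grp_center (G Mod N) = (\<lambda>g. N #> g) ` C 1"
    unfolding grp_center_Mod[OF N(1)] center_mod_eq_C1[OF n N(1) nD N(2)] ..
  have der: "derived_subgroup (G Mod N) = (\<lambda>g. N #> g) ` C 1"
    unfolding derived_subgroup_Mod[OF N(1)] N(4)[symmetric] image_Mod_set_mult[OF N(1) subD] ..
  show "semi_extraspecial p (G Mod N)"
  proof (rule semi_extraspecialI[OF p p_group_Mod[OF N(1) p p_group]])
    show "grp_center (G Mod N) = derived_subgroup (G Mod N)" unfolding center der ..
    fix N' assume N': "N' \<lhd> G Mod N" "\<not> derived_subgroup (G Mod N) \<subseteq> N'"
    interpret \<pi>: group_hom G "G Mod N" "\<lambda>g. N #> g" by (rule Mod_group_hom[OF N(1)])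
    interpret N': normal N' "G Mod N" by (rule N'(1))
    define M where "M = {g \<in> carrier G. N #> g \<in> N'}"
    have M: "M \<lhd> G"
    proof (rule normalI_cmt)
      show "subgroup M G"
      proof (rule finite_subgroupI[OF fin])
        show "\<one> \<in> M" unfolding M_def using N'.one_closed \<pi>.hom_one by simp
        fix x y assume "x \<in> M" "y \<in> M"
        then have xy: "x \<in> carrier G" "y \<in> carrier G" "N #> x \<in> N'" "N #> y \<in> N'" by (auto simp: M_def)
        have "(N #> x) \<otimes>\<^bsub>G Mod N\<^esub> (N #> y) \<in> N'" using xy(3,4) by (rule N'.m_closed)
        then have "N #> (x \<otimes> y) \<in> N'" using \<pi>.hom_mult[OF xy(1,2)] by (simp only:)
        then show "x \<otimes> y \<in> M" using xy by (simp add: M_def)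
      qed (simp add: M_def)
      fix x g assume "x \<in> M" and g: "g \<in> carrier G"
      then have x: "x \<in> carrier G" "N #> x \<in> N'" by (auto simp: M_def)
      have "cmt (G Mod N) (N #> x) (N #> g) \<in> N'"
        by (rule group.normal_cmt_mem(1)[OF \<pi>.H.is_group N'(1) x(2) \<pi>.hom_closed[OF g]])
      then show "cmt G x g \<in> M" unfolding M_def using Mod_cmt[OF N(1) x(1) g] x g by simp
    qed
    have "\<not> D \<subseteq> M"
    proof
      assume "D \<subseteq> M"
      then have "(\<lambda>g. N #> g) ` D \<subseteq> N'" by (auto simp: M_def)
      then show False using N'(2) unfolding derived_subgroup_Mod[OF N(1)] by blast
    qed
    from center_mod_subset_C1[OF n M this] have sub: "center_mod G M \<subseteq> C 1" .
    show "center_mod (G Mod N) N' \<subseteq> grp_center (G Mod N)"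
    proof
      fix q assume q: "q \<in> center_mod (G Mod N) N'"
      then obtain g where g: "g \<in> carrier G" "q = N #> g"
        unfolding center_mod_def carrier_FactGroup by blast
      have "cmt G g h \<in> M" if h: "h \<in> carrier G" for h
      proof -
        have "cmt (G Mod N) (N #> g) (N #> h) \<in> N'"
          using q g(2) \<pi>.hom_closed[OF h] unfolding center_mod_def by blast
        then show ?thesis unfolding M_def using Mod_cmt[OF N(1) g(1) h] g(1) h by simp
      qed
      then have "g \<in> center_mod G M" using g(1) by (simp add: center_mod_def)
      then show "q \<in> grp_center (G Mod N)" unfolding center g(2) using sub by blast
    qed
  qed
qed

text \<open>The centralizer \<open>R\<close> of \<open>Y = C 2 <#> D\<close> modulo the kernel of a character with center
  \<open>C 2\<close> is isotropic for the commutator pairing of a character with center \<open>C 1\<close>.\<close>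

lemma index_C1_le:
  assumes n: "2 \<le> n" and nD: "\<not> D \<subseteq> C 2"
  shows "card (carrier G) * (card (C 2))\<^sup>2 \<le> (card (C 2 <#> D))\<^sup>2 * card (C 1)"
proof -
  have n1: "1 \<le> n" using n by simp
  have C2: "C 2 \<lhd> G" using n by (rule C_normal)
  interpret C2: normal "C 2" G by (rule C2)
  have subD: "subgroup D G" by (rule normal_imp_subgroup[OF D_normal])
  define Y where "Y = C 2 <#> D"
  have subY: "subgroup Y G" unfolding Y_def by (rule normal_set_mult_subgroup[OF C2 subD])
  have YC1: "Y \<subseteq> C 1"
  proof -
    interpret C1: normal "C 1" G by (rule C_normal[OF n1])
    have "C 2 \<subseteq> C 1" by (rule C_antimono) (use n in auto)
    then show ?thesis unfolding Y_def by (rule set_mult_subset[OF C1.subgroup_axioms _ D_subset_C1[OF n1]])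
  qed
  have C2Y: "C 2 \<subseteq> Y" and DY: "D \<subseteq> Y"
    unfolding Y_def using subset_set_mult[OF C2.subgroup_axioms subD] by auto
  have cm12: "cmt G x g \<in> C 2" if "x \<in> C 1" "g \<in> carrier G" for x g
    using cmt_in_next[of 1 x g] that n by (simp add: numeral_2_eq_2)
  obtain K f where cc: "central_char G (C 2) K f" using C_char[OF n] by blast
  note cD = central_charD[OF cc]
  interpret K: normal K G by (rule cD(1))
  have cY: "cmt G y g \<in> C 2" if "y \<in> Y" "g \<in> carrier G" for y g using cm12 YC1 that by blast
  have Yc: "Y \<subseteq> carrier G" using subY by (rule subgroup.subset)
  \<comment> \<open>The right kernel of a pairing of \<open>Y\<close> with \<open>G\<close> whose
    left kernel is \<open>C 2\<close>, since \<open>C 2\<close> consists of the elements central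
    modulo \<open>K\<close>. Double counting turns this into
    \<open>|G : R| = |Y : C 2|\<close>.\<close>
  define R where "R = {g \<in> carrier G. \<forall>y\<in>Y. f (cmt G y g) = 1}"
  have RK: "g \<in> R \<longleftrightarrow> g \<in> carrier G \<and> (\<forall>y\<in>Y. cmt G y g \<in> K)" for g
    unfolding R_def using cD(7)[OF cY] by blast
  have "card Y * card R = card (carrier G) * card {y \<in> Y. \<forall>g\<in>carrier G. f (cmt G y g) = 1}"
    unfolding R_def
  proof (rule card_pairing_kernels[OF is_group subY subgroup_self])
    fix x y z assume "x \<in> Y" "y \<in> Y" "z \<in> carrier G"
    then show "f (cmt G (x \<otimes> y) z) = f (cmt G x z) * f (cmt G y z)"
      using Yc by (intro central_char_cmt_mult(1)[OF cc] cY) auto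
  next
    fix x y z assume "x \<in> Y" "y \<in> carrier G" "z \<in> carrier G"
    then show "f (cmt G x (y \<otimes> z)) = f (cmt G x y) * f (cmt G x z)"
      using Yc by (intro central_char_cmt_mult(2)[OF cc] cY) auto
  qed (use fin Yc finite_subset in auto)
  moreover have "{y \<in> Y. \<forall>g\<in>carrier G. f (cmt G y g) = 1} = C 2"
  proof -
    have "{y \<in> Y. \<forall>g\<in>carrier G. f (cmt G y g) = 1} = {y \<in> Y. y \<in> center_mod G K}"
      unfolding center_mod_def using cD(7)[OF cY] Yc by blast
    then show ?thesis using cD(2) C2Y by blast
  qed
  ultimately have YR: "card Y * card R = card (carrier G) * card (C 2)" by simp
  have subR: "subgroup R G"
  proof (rule finite_subgroupI[OF fin])
    show "R \<subseteq> carrier G" by (auto simp: R_def)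
    show "\<one> \<in> R" unfolding RK using cmt_one(1) Yc K.one_closed by (auto simp del: r_one r_inv)
    fix a b assume "a \<in> R" "b \<in> R"
    then have ab: "a \<in> carrier G" "b \<in> carrier G"
        "\<And>y. y \<in> Y \<Longrightarrow> f (cmt G y a) = 1" "\<And>y. y \<in> Y \<Longrightarrow> f (cmt G y b) = 1" by (auto simp: R_def)
    have "f (cmt G y (a \<otimes> b)) = 1" if y: "y \<in> Y" for y
    proof -
      have "y \<in> carrier G" using y Yc by blast
      then have "f (cmt G y (a \<otimes> b)) = f (cmt G y a) * f (cmt G y b)"
        using cY[OF y] ab by (intro central_char_cmt_mult(2)[OF cc]) auto
      then show ?thesis using ab(3,4)[OF y] by simp
    qed
    then show "a \<otimes> b \<in> R" unfolding R_def using ab(1,2) by simp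
  qed
  interpret R: subgroup R G by (rule subR)
  have RR: "cmt G x y \<in> C 2" if xy: "x \<in> R" "y \<in> R" for x y
  proof -
    have xc: "x \<in> carrier G" and yc: "y \<in> carrier G" using xy by auto
    have "cmt G (cmt G x y) z \<in> K" if z: "z \<in> carrier G" for z
    proof -
      \<comment> \<open>With \<open>w = inv y\<close>, the first factor of \<open>hall_witt\<close>
        is a conjugate of the wanted \<open>cmt G (cmt G x y) z\<close>. In each of the other two
        factors a commutator from \<open>D \<subseteq> Y\<close> meets \<open>x\<close> or
        \<open>w\<close> from \<open>R\<close>, so both factors lie in \<open>K\<close>.\<close>
      define w where "w = inv y"
      have wR: "w \<in> R" and wc: "w \<in> carrier G" using xy(2) yc by (auto simp: w_def)
      have iw: "inv w = y" using yc by (simp add: w_def)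
      define a where "a = cmt G (cmt G x (inv w)) z"
      define b where "b = cmt G (cmt G w (inv z)) x"
      define c where "c = cmt G (cmt G z (inv x)) w"
      have ac: "a \<in> carrier G" using xc wc z by (simp add: a_def)
      have bK: "b \<in> K" unfolding b_def using xy(1) RK DY cmt_in_D[of w "inv z"] wc z by auto
      have cK: "c \<in> K" unfolding c_def using wR RK DY cmt_in_D[of z "inv x"] xc z by auto
      have bc: "b \<in> carrier G" "c \<in> carrier G" using bK cK by auto
      define b' where "b' = inv z \<otimes> b \<otimes> z"
      define c' where "c' = inv x \<otimes> c \<otimes> x"
      have b'K: "b' \<in> K" unfolding b'_def by (rule K.inv_op_closed1[OF z bK])
      have c'K: "c' \<in> K" unfolding c'_def by (rule K.inv_op_closed1[OF xc cK])
      have bc': "b' \<in> carrier G" "c' \<in> carrier G" using b'K c'K by auto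
      have "(inv w \<otimes> a \<otimes> w) \<otimes> b' \<otimes> c' = \<one>"
        using hall_witt[OF xc wc z] unfolding a_def b_def c_def b'_def c'_def .
      then have "(inv w \<otimes> a \<otimes> w) \<otimes> (b' \<otimes> c') = \<one>" using ac wc bc' by (simp add: m_assoc)
      then have "inv (b' \<otimes> c') = inv w \<otimes> a \<otimes> w" using ac wc bc' by (intro inv_equality) auto
      moreover have "inv (b' \<otimes> c') \<in> K" using b'K c'K by simp
      ultimately have "inv w \<otimes> a \<otimes> w \<in> K" by simp
      then have "w \<otimes> (inv w \<otimes> a \<otimes> w) \<otimes> inv w \<in> K" by (rule K.inv_op_closed2[OF wc])
      moreover have "w \<otimes> (inv w \<otimes> a \<otimes> w) \<otimes> inv w = a" using ac wc by (simp add: m_assoc)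
      ultimately show ?thesis by (simp add: a_def iw)
    qed
    then have "cmt G x y \<in> center_mod G K" using cmt_closed[OF xc yc] by (simp add: center_mod_def)
    then show ?thesis using cD(2) by simp
  qed
  obtain x0 y0 where xy0: "x0 \<in> carrier G" "y0 \<in> carrier G" "cmt G x0 y0 \<notin> C 2"
    using nD D_subset_iff[OF C2.subgroup_axioms] by blast
  \<comment> \<open>A character that is trivial on \<open>C 2\<close> but not on \<open>D\<close>
    has center exactly \<open>C 1\<close>: since \<open>[C 1, G]\<close> lies in \<open>C 2\<close>,
    its center contains \<open>C 1\<close>, and it is not \<open>C 0\<close>, the whole
    group.\<close>
  obtain j K1 f1 where j: "j \<le> n" "central_char G (C j) K1 f1" "C 2 \<subseteq> K1" "cmt G x0 y0 \<notin> K1"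
    using separates[OF C2 cmt_closed[OF xy0(1,2)] xy0(3)] by blast
  note jD = central_charD[OF j(2)]
  have "C 1 \<subseteq> C j"
  proof
    fix x assume x: "x \<in> C 1"
    then have "x \<in> carrier G" using C_subset_carrier[OF n1] by blast
    then show "x \<in> C j" unfolding jD(2) center_mod_def using cm12[OF x] j(3) by blast
  qed
  moreover have "j \<noteq> 0"
  proof
    assume "j = 0"
    then have "x0 \<in> C j" using C0 xy0(1) by simp
    then show False using jD(8) xy0(2) j(4) by blast
  qed
  then have "C j \<subseteq> C 1" by (intro C_antimono j(1)) simp
  ultimately have cc1: "central_char G (C 1) K1 f1" using j(2) by (metis subset_antisym)
  note D1 = central_charD[OF cc1]
  have cm: "cmt G x y \<in> C 1" if "x \<in> carrier G" "y \<in> carrier G" for x y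
    using D_subset_C1[OF n1] cmt_in_D[OF that] by blast
  have ap: "alternating_pairing G (\<lambda>x y. f1 (cmt G x y))"
    by (rule central_char_alternating_pairing(1)[OF fin cc1]) (rule cm)
  have rad: "alternating_pairing.radical G (\<lambda>x y. f1 (cmt G x y)) = C 1"
    by (rule central_char_alternating_pairing(2)[OF fin cc1]) (rule cm)
  have iso: "f1 (cmt G x y) = 1" if "x \<in> R" "y \<in> R" for x y
    using RR[OF that] j(3) D1(7)[OF cm[OF R.mem_carrier[OF that(1)] R.mem_carrier[OF that(2)]]] by blast
  have R2: "card R * card R \<le> card (carrier G) * card (C 1)"
    unfolding rad[symmetric] by (rule alternating_pairing.card_isotropic_le[OF ap subR]) (rule iso)
  have pos: "card (carrier G) > 0" using fin by (auto simp: card_gt_0_iff)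
  \<comment> \<open>Substitutes \<open>|Y| |R| = |G| |C 2|\<close> into the isotropy bound for
    \<open>R\<close>. The additional factor \<open>|G|\<close> avoids division and is cancelled at
    the end.\<close>
  have "card (carrier G) * (card (carrier G) * (card (C 2))\<^sup>2) = (card (carrier G) * card (C 2))\<^sup>2"
    by (simp add: power2_eq_square)
  also have "\<dots> = (card Y)\<^sup>2 * (card R * card R)" unfolding YR[symmetric] by (simp add: power2_eq_square)
  also have "\<dots> \<le> (card Y)\<^sup>2 * (card (carrier G) * card (C 1))" using R2 by simp
  finally have "card (carrier G) * (card (carrier G) * (card (C 2))\<^sup>2) \<le> card (carrier G) * ((card Y)\<^sup>2 * card (C 1))"
    by (simp add: mult_ac)
  then show ?thesis unfolding Y_def[symmetric] using pos by simp
qed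

end

section \<open>The index of the first proper center\<close>

context chain_group
begin

text \<open>Since \<open>x [^] p\<close> lies in \<open>C 1\<close>, a character trivial on
  \<open>L\<close> satisfies \<open>f (cmt G x y) ^ p = f (cmt G (x [^] p) y) = 1\<close>. Hence its
  linear character has order dividing \<open>p\<close> on all of \<open>D\<close>, and such
  characters detect membership in \<open>L\<close>.\<close>

lemma D_pow:
  assumes n: "1 \<le> n" and w: "w \<in> D"
  shows "w [^] p \<in> L"
proof (rule ccontr)
  assume a: "w [^] p \<notin> L"
  interpret L: normal L G by (rule L_normal[OF n])
  interpret D: normal D G by (rule D_normal)
  have wc: "w \<in> carrier G" using w by (rule D.mem_carrier)
  obtain j K f where j: "j \<le> n" "central_char G (C j) K f" "L \<subseteq> K" "w [^] p \<notin> K"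
    using separates[OF L_normal[OF n] nat_pow_closed[OF wc] a] by blast
  note cc = j(2)
  note cD = central_charD[OF cc]
  interpret Z: normal "C j" G by (rule cD(3))
  have C1j: "C 1 \<subseteq> C j"
  proof
    fix x assume x: "x \<in> C 1"
    then have "x \<in> carrier G" using C_subset_carrier[OF n] by blast
    then show "x \<in> C j" unfolding cD(2) center_mod_def using cmt_in_L[OF x] j(3) by blast
  qed
  have cm: "cmt G x y \<in> C j" if "x \<in> carrier G" "y \<in> carrier G" for x y
    using D_subset_C1[OF n] C1j cmt_in_D[OF that] by blast
  define M where "M = {z \<in> C j. f z ^ p = 1}"
  have "subgroup M G"
  proof (rule finite_subgroupI[OF fin])
    show "M \<subseteq> carrier G" using cD(5) by (auto simp: M_def)
    show "\<one> \<in> M" using central_char_pow(2)[OF cc Z.one_closed, of 0] by (simp add: M_def)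
    fix x y assume "x \<in> M" "y \<in> M"
    then show "x \<otimes> y \<in> M" by (simp add: M_def cD(6) power_mult_distrib)
  qed
  moreover have "cmt G x y \<in> M" if xy: "x \<in> carrier G" "y \<in> carrier G" for x y
  proof -
    have "x [^] p \<in> C 1" using pow_in_next[of 0 x] n C0 xy(1) by simp
    then have "cmt G (x [^] p) y \<in> K" using cmt_in_L[OF _ xy(2)] j(3) by blast
    then have "f (cmt G (x [^] p) y) = 1" using cD(4) cD(7) by blast
    moreover have "f (cmt G (x [^] p) y) = f (cmt G x y) ^ p"
      by (rule central_char_cmt_pow[OF cc xy cm[OF nat_pow_closed[OF xy(1)] xy(2)]])
    ultimately show ?thesis using cm[OF xy] by (simp add: M_def)
  qed
  ultimately have "D \<subseteq> M" using D_subset_iff by blast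
  then have wM: "w \<in> C j" "f w ^ p = 1" using w by (auto simp: M_def)
  then have "f (w [^] p) = 1" using central_char_pow(2)[OF cc wM(1)] by simp
  then have "w [^] p \<in> K" using cD(7)[OF central_char_pow(1)[OF cc wM(1)]] by blast
  then show False using j(4) by blast
qed

text \<open>The commutator map \<open>G / C 1 \<times> G / C 1 \<rightarrow> D / L\<close> becomes, in coordinates, a linear
  pencil of alternating forms all of whose nonzero members are nondegenerate.\<close>

lemma derived_index_le:
  assumes n: "1 \<le> n"
  shows "\<exists>s t. card D = p ^ s * card L \<and> card (carrier G) = p ^ t * card (C 1) \<and> 2 * s \<le> t"
proof -
  interpret L: normal L G by (rule L_normal[OF n])
  interpret D: normal D G by (rule D_normal)
  interpret C1: normal "C 1" G by (rule C_normal[OF n])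
  have DC1: "D \<subseteq> C 1" by (rule D_subset_C1[OF n])
  have LD: "L \<subseteq> D" by (rule L_subset_D[OF n])
  have "\<exists>s w c. section_basis G p D L s w c"
  proof (rule ex_section_basis[OF p fin L_normal[OF n] D.subgroup_axioms LD])
    fix x y assume "x \<in> D" "y \<in> D"
    then show "cmt G x y \<in> L" using DC1 D.mem_carrier by (intro cmt_in_L) blast+
  qed (rule D_pow[OF n])
  then obtain s w c where W: "section_basis G p D L s w c" by blast
  have "\<exists>t e x. section_basis G p (carrier G) (C 1) t e x"
  proof (rule ex_section_basis[OF p fin C_normal[OF n] subgroup_self C1.subset])
    fix x y assume "x \<in> carrier G" "y \<in> carrier G"
    then show "cmt G x y \<in> C 1" using DC1 cmt_in_D by blast
  next
    fix x assume "x \<in> carrier G"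
    then show "x [^] p \<in> C 1" using pow_in_next[of 0 x] n C0 by simp
  qed
  then obtain t b x where V: "section_basis G p (carrier G) (C 1) t b x" by blast
  have cardD: "card D = p ^ s * card L"
    and wD: "\<And>k. k < s \<Longrightarrow> w k \<in> D"
    and c_add: "\<And>k u v. k < s \<Longrightarrow> u \<in> D \<Longrightarrow> v \<in> D \<Longrightarrow> [c k (u \<otimes> v) = c k u + c k v] (mod int p)"
    and c_L: "\<And>k u. k < s \<Longrightarrow> u \<in> L \<Longrightarrow> int p dvd c k u"
    and c_w: "\<And>k j. k < s \<Longrightarrow> j < s \<Longrightarrow> [c k (w j) = (if k = j then 1 else 0)] (mod int p)"
    using W unfolding section_basis_def by blast+
  have cardG: "card (carrier G) = p ^ t * card (C 1)"
    and bG: "\<And>k. k < t \<Longrightarrow> b k \<in> carrier G"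
    and x_add: "\<And>k u v. k < t \<Longrightarrow> u \<in> carrier G \<Longrightarrow> v \<in> carrier G \<Longrightarrow> [x k (u \<otimes> v) = x k u + x k v] (mod int p)"
    and x_C1: "\<And>k u. k < t \<Longrightarrow> u \<in> C 1 \<Longrightarrow> int p dvd x k u"
    and x_b: "\<And>k j. k < t \<Longrightarrow> j < t \<Longrightarrow> [x k (b j) = (if k = j then 1 else 0)] (mod int p)"
    using V unfolding section_basis_def by blast+
  have c_cmt_left: "[c k (cmt G (g \<otimes> g') h) = c k (cmt G g h) + c k (cmt G g' h)] (mod int p)"
    if k: "k < s" and g: "g \<in> carrier G" "g' \<in> carrier G" "h \<in> carrier G" for k g g' h
  proof -
    have d: "cmt G g h \<in> D" "cmt G g' h \<in> D" using cmt_in_D g by auto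
    have l: "cmt G (cmt G g h) g' \<in> L" using d(1) DC1 g(2) by (intro cmt_in_L) auto
    have dl: "cmt G g h \<otimes> cmt G (cmt G g h) g' \<in> D" by (rule D.m_closed[OF d(1) subsetD[OF LD l]])
    have "[c k (cmt G g h \<otimes> cmt G (cmt G g h) g') = c k (cmt G g h) + c k (cmt G (cmt G g h) g')] (mod int p)"
      using l LD by (intro c_add[OF k d(1)]) auto
    also have "[c k (cmt G g h) + c k (cmt G (cmt G g h) g') = c k (cmt G g h) + 0] (mod int p)"
      using c_L[OF k l] by (intro cong_add cong_refl) (simp add: cong_0_iff)
    finally have 1: "[c k (cmt G g h \<otimes> cmt G (cmt G g h) g') = c k (cmt G g h)] (mod int p)" by simp
    show ?thesis unfolding cmt_mult_left[OF g]
      by (rule cong_trans[OF c_add[OF k dl d(2)] cong_add[OF 1 cong_refl]])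
  qed
  have c_cmt_right: "[c k (cmt G h (g \<otimes> g')) = c k (cmt G h g) + c k (cmt G h g')] (mod int p)"
    if k: "k < s" and g: "h \<in> carrier G" "g \<in> carrier G" "g' \<in> carrier G" for k g g' h
  proof -
    have d: "cmt G h g \<in> D" "cmt G h g' \<in> D" using cmt_in_D g by auto
    have l: "cmt G (cmt G h g) g' \<in> L" using d(1) DC1 g(3) by (intro cmt_in_L) auto
    have dl: "cmt G h g \<otimes> cmt G (cmt G h g) g' \<in> D" by (rule D.m_closed[OF d(1) subsetD[OF LD l]])
    have "[c k (cmt G h g \<otimes> cmt G (cmt G h g) g') = c k (cmt G h g) + c k (cmt G (cmt G h g) g')] (mod int p)"
      using l LD by (intro c_add[OF k d(1)]) auto
    also have "[c k (cmt G h g) + c k (cmt G (cmt G h g) g') = c k (cmt G h g) + 0] (mod int p)"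
      using c_L[OF k l] by (intro cong_add cong_refl) (simp add: cong_0_iff)
    finally have 1: "[c k (cmt G h g \<otimes> cmt G (cmt G h g) g') = c k (cmt G h g)] (mod int p)" by simp
    have "[c k (cmt G h g' \<otimes> (cmt G h g \<otimes> cmt G (cmt G h g) g')) = c k (cmt G h g') + c k (cmt G h g)] (mod int p)"
      by (rule cong_trans[OF c_add[OF k d(2) dl] cong_add[OF cong_refl 1]])
    then show ?thesis unfolding cmt_mult_right[OF g] by (simp only: add.commute)
  qed
  have c_one: "int p dvd c k \<one>" if "k < s" for k by (rule c_L[OF that L.one_closed])
  have c_swap: "[c k (cmt G h g) = - c k (cmt G g h)] (mod int p)"
    if k: "k < s" and g: "g \<in> carrier G" "h \<in> carrier G" for k g h
  proof -
    have "cmt G h g \<otimes> cmt G g h = \<one>" using inv_cmt[OF g] g by (metis cmt_closed l_inv)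
    moreover have "[c k (cmt G h g \<otimes> cmt G g h) = c k (cmt G h g) + c k (cmt G g h)] (mod int p)"
      by (rule c_add[OF k cmt_in_D[OF g(2,1)] cmt_in_D[OF g]])
    ultimately have "int p dvd c k (cmt G h g) + c k (cmt G g h)"
      using c_one[OF k] by (simp only: cong_dvd_iff)
    then show ?thesis by (simp add: cong_iff_dvd_diff)
  qed
  \<comment> \<open>The member of the pencil with coefficients \<open>l\<close>, as a function of
    group elements; it is additive in each argument modulo \<open>p\<close>.\<close>
  define \<psi> where "\<psi> l g h = (\<Sum>k<s. l k * c k (cmt G g h))" for l :: "nat \<Rightarrow> int" and g h
  have \<psi>_left: "[\<psi> l (g \<otimes> g') h = \<psi> l g h + \<psi> l g' h] (mod int p)"
    if "g \<in> carrier G" "g' \<in> carrier G" "h \<in> carrier G" for l g g' h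
    unfolding \<psi>_def sum.distrib[symmetric] distrib_left[symmetric]
    by (intro cong_sum cong_mult cong_refl c_cmt_left that) simp
  have \<psi>_right: "[\<psi> l h (g \<otimes> g') = \<psi> l h g + \<psi> l h g'] (mod int p)"
    if "h \<in> carrier G" "g \<in> carrier G" "g' \<in> carrier G" for l g g' h
    unfolding \<psi>_def sum.distrib[symmetric] distrib_left[symmetric]
    by (intro cong_sum cong_mult cong_refl c_cmt_right that) simp
  have \<psi>_L: "int p dvd \<psi> l g h" if "cmt G g h \<in> L" for l g h
    unfolding \<psi>_def by (intro dvd_sum dvd_mult c_L that) simp
  have C1L: "cmt G g h \<in> L" "cmt G h g \<in> L" if "g \<in> C 1" "h \<in> carrier G" for g h
  proof -
    show 1: "cmt G g h \<in> L" by (rule cmt_in_L[OF that])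
    have "inv (cmt G g h) \<in> L" using 1 by (rule L.m_inv_closed)
    then show "cmt G h g \<in> L" using inv_cmt[OF C1.mem_carrier[OF that(1)] that(2)] by (simp only:)
  qed
  \<comment> \<open>Defined by cases because \<open>nondegenerate_pencil_bound\<close> asks for
    antisymmetry as an identity of integers, while \<open>c k (cmt G (b i) (b j))\<close> has it
    only modulo \<open>p\<close>.\<close>
  define cc where "cc k i j = (if i < j then c k (cmt G (b i) (b j)) else if j < i then - c k (cmt G (b j) (b i)) else 0)" for k i j
  have cc: "[cc k j i = - c k (cmt G (b i) (b j))] (mod int p)" if "k < s" "i < t" "j < t" for k i j
  proof -
    consider "i < j" | "j < i" | "i = j" by linarith
    then show ?thesis
    proof cases
      case 1
      then show ?thesis by (simp add: cc_def)
    next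
      case 2
      then show ?thesis using c_swap[OF that(1) bG[OF that(2)] bG[OF that(3)]] by (simp add: cc_def)
    next
      case 3
      have "int p dvd c k (cmt G (b i) (b i))" unfolding cmt_self[OF bG[OF that(2)]] by (rule c_one[OF that(1)])
      then show ?thesis unfolding 3[symmetric] by (simp add: cc_def cong_iff_dvd_diff)
    qed
  qed
  have "2 * s \<le> t"
  proof (rule nondegenerate_pencil_bound[OF p])
    show "0 < t"
    proof (rule ccontr)
      assume "\<not> 0 < t"
      then have "card (carrier G) = card (C 1)" using cardG by simp
      then have "C 1 = carrier G" by (intro card_subset_eq[OF fin C1.subset]) simp
      then show False using C_less[of 0] C0 n by auto
    qed
    show "cc k i j = - cc k j i" for k i j by (simp add: cc_def)
  next
    fix l y assume l: "\<exists>k<s. \<not> int p dvd l k" and y: "\<exists>i<t. \<not> int p dvd y i"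
    \<comment> \<open>The kernel of the functional on \<open>D / L\<close> with coefficients
      \<open>l\<close>. The functional is nonzero at some \<open>w k0\<close>, so \<open>N\<close>
      does not contain \<open>D\<close>, and only elements of \<open>C 1\<close> are central modulo
      \<open>N\<close>. This is the source of nondegeneracy.\<close>
    define N where "N = {z \<in> D. int p dvd (\<Sum>k<s. l k * c k z)}"
    have LN: "L \<subseteq> N"
    proof
      fix z assume z: "z \<in> L"
      have "int p dvd (\<Sum>k<s. l k * c k z)" by (intro dvd_sum dvd_mult c_L z) simp
      then show "z \<in> N" using z LD by (auto simp: N_def)
    qed
    have N: "N \<lhd> G"
    proof (rule normalI_cmt)
      show "subgroup N G"
      proof (rule finite_subgroupI[OF fin])
        show "N \<subseteq> carrier G" using D.subset by (auto simp: N_def)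
        show "\<one> \<in> N" using LN L.one_closed by blast
        fix u v assume "u \<in> N" "v \<in> N"
        then have uv: "u \<in> D" "v \<in> D" "int p dvd (\<Sum>k<s. l k * c k u)" "int p dvd (\<Sum>k<s. l k * c k v)"
          by (auto simp: N_def)
        have "[(\<Sum>k<s. l k * c k (u \<otimes> v)) = (\<Sum>k<s. l k * c k u) + (\<Sum>k<s. l k * c k v)] (mod int p)"
          unfolding sum.distrib[symmetric] distrib_left[symmetric]
          by (intro cong_sum cong_mult cong_refl c_add uv) simp
        moreover have "int p dvd (\<Sum>k<s. l k * c k u) + (\<Sum>k<s. l k * c k v)" using uv(3,4) by (rule dvd_add)
        ultimately have "int p dvd (\<Sum>k<s. l k * c k (u \<otimes> v))" by (simp only: cong_dvd_iff)
        then show "u \<otimes> v \<in> N" using uv by (simp add: N_def)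
      qed
      fix z g assume "z \<in> N" "g \<in> carrier G"
      then have "cmt G z g \<in> L" using DC1 by (intro cmt_in_L) (auto simp: N_def)
      then show "cmt G z g \<in> N" using LN by blast
    qed
    obtain k0 where k0: "k0 < s" "\<not> int p dvd l k0" using l by blast
    have "\<not> D \<subseteq> N"
    proof
      assume "D \<subseteq> N"
      then have "int p dvd (\<Sum>k<s. l k * c k (w k0))" using wD[OF k0(1)] by (auto simp: N_def)
      moreover have "[(\<Sum>k<s. l k * c k (w k0)) = (\<Sum>k<s. l k * (if k = k0 then 1 else 0))] (mod int p)"
        by (intro cong_sum cong_mult cong_refl c_w k0(1)) simp
      moreover have "(\<Sum>k<s. l k * (if k = k0 then 1 else 0)) = (\<Sum>k<s. if k = k0 then l k else 0)"
        by (rule sum.cong) auto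
      moreover have "(\<Sum>k<s. if k = k0 then l k else 0) = l k0" using k0(1) by simp
      ultimately have "int p dvd l k0" by (simp only: cong_dvd_iff)
      then show False using k0(2) by blast
    qed
    from center_mod_subset_C1[OF n N this] have cN: "center_mod G N \<subseteq> C 1" .
    \<comment> \<open>The vector \<open>y\<close> realized by a group element; as \<open>y\<close>
      is nonzero modulo \<open>p\<close>, this element is outside \<open>C 1\<close>.\<close>
    obtain g where g: "g \<in> carrier G" "\<And>i. i < t \<Longrightarrow> [x i g = y i] (mod int p)"
      using section_basis_generates[OF p V subgroup_self C1.subset subgroup_self subset_refl bG, of y] by blast
    have "g \<notin> C 1"
    proof
      assume "g \<in> C 1"
      then have "int p dvd y i" if "i < t" for i
        using x_C1[OF that] g(2)[OF that] by (simp only: cong_dvd_iff[symmetric])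
      then show False using y by blast
    qed
    have "\<exists>j<t. \<not> int p dvd \<psi> l g (b j)"
    proof (rule ccontr)
      assume neg: "\<not> ?thesis"
      \<comment> \<open>If \<open>g\<close> were orthogonal to every basis element, it would be
        orthogonal to the subgroup they generate with \<open>C 1\<close>, which is \<open>G\<close>.
        Then \<open>g\<close> would be central modulo \<open>N\<close>.\<close>
      define H where "H = {h \<in> carrier G. int p dvd \<psi> l g h}"
      have C1H: "C 1 \<subseteq> H" using C1L(2)[OF _ g(1)] \<psi>_L C1.subset by (auto simp: H_def)
      have "subgroup H G"
      proof (rule finite_subgroupI[OF fin])
        show "\<one> \<in> H" using C1H C1.one_closed by blast
        fix u v assume "u \<in> H" "v \<in> H"
        then have uv: "u \<in> carrier G" "v \<in> carrier G" "int p dvd \<psi> l g u + \<psi> l g v" by (auto simp: H_def)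
        then have "int p dvd \<psi> l g (u \<otimes> v)"
          using \<psi>_right[OF g(1) uv(1,2), of l] by (simp only: cong_dvd_iff)
        then show "u \<otimes> v \<in> H" using uv by (simp add: H_def)
      qed (simp add: H_def)
      moreover have "b j \<in> H" if "j < t" for j using neg bG that by (auto simp: H_def)
      ultimately have GH: "carrier G \<subseteq> H"
        using section_basis_generates[OF p V subgroup_self C1H] by (simp add: H_def)
      have "cmt G g h \<in> N" if h: "h \<in> carrier G" for h
        using GH h cmt_in_D[OF g(1) h] by (auto simp: H_def N_def \<psi>_def)
      then have "g \<in> center_mod G N" using g(1) by (simp add: center_mod_def)
      then show False using cN \<open>g \<notin> C 1\<close> by blast
    qed
    then obtain j where j: "j < t" "\<not> int p dvd \<psi> l g (b j)" by blast
    define h where "h = b j"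
    have h: "h \<in> carrier G" unfolding h_def by (rule bG[OF j(1)])
    \<comment> \<open>The form expanded in the coordinates of its first argument. Both sides are
      additive modulo \<open>p\<close>, so agreement on \<open>C 1\<close> and on the basis gives
      agreement at \<open>g\<close>, where the expansion is, up to sign, row \<open>j\<close> of the
      matrix applied to \<open>y\<close>.\<close>
    define \<theta> where "\<theta> u = (\<Sum>i<t. x i u * \<psi> l (b i) h)" for u
    have \<theta>_add: "[\<theta> (u \<otimes> v) = \<theta> u + \<theta> v] (mod int p)" if "u \<in> carrier G" "v \<in> carrier G" for u v
      unfolding \<theta>_def sum.distrib[symmetric] distrib_right[symmetric]
      by (intro cong_sum cong_mult cong_refl x_add that) simp
    define H where "H = {u \<in> carrier G. [\<psi> l u h = \<theta> u] (mod int p)}"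
    have C1H: "C 1 \<subseteq> H"
    proof
      fix u assume u: "u \<in> C 1"
      have "int p dvd \<psi> l u h" by (rule \<psi>_L[OF C1L(1)[OF u h]])
      moreover have "int p dvd \<theta> u" unfolding \<theta>_def by (intro dvd_sum dvd_mult2 x_C1 u) simp
      ultimately have "[\<psi> l u h = \<theta> u] (mod int p)" by (simp add: cong_iff_dvd_diff dvd_diff)
      then show "u \<in> H" using u C1.subset by (auto simp: H_def)
    qed
    have "subgroup H G"
    proof (rule finite_subgroupI[OF fin])
      show "\<one> \<in> H" using C1H C1.one_closed by blast
      fix u v assume "u \<in> H" "v \<in> H"
      then have uv: "u \<in> carrier G" "v \<in> carrier G" "[\<psi> l u h = \<theta> u] (mod int p)" "[\<psi> l v h = \<theta> v] (mod int p)"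
        by (auto simp: H_def)
      have "[\<psi> l (u \<otimes> v) h = \<theta> (u \<otimes> v)] (mod int p)"
        by (rule cong_trans[OF \<psi>_left[OF uv(1,2) h] cong_trans[OF cong_add[OF uv(3,4)] cong_sym[OF \<theta>_add[OF uv(1,2)]]]])
      then show "u \<otimes> v \<in> H" using uv by (simp add: H_def)
    qed (simp add: H_def)
    moreover have "b m \<in> H" if m: "m < t" for m
    proof -
      have "[\<theta> (b m) = (\<Sum>i<t. (if i = m then 1 else 0) * \<psi> l (b i) h)] (mod int p)"
        unfolding \<theta>_def by (intro cong_sum cong_mult cong_refl x_b m) simp
      moreover have "(\<Sum>i<t. (if i = m then 1 else 0) * \<psi> l (b i) h) = (\<Sum>i<t. if i = m then \<psi> l (b i) h else 0)"
        by (rule sum.cong) auto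
      moreover have "(\<Sum>i<t. if i = m then \<psi> l (b i) h else 0) = \<psi> l (b m) h" using m by simp
      ultimately have "[\<theta> (b m) = \<psi> l (b m) h] (mod int p)" by (simp only:)
      then show ?thesis using bG[OF m] by (simp add: H_def cong_sym)
    qed
    ultimately have "carrier G \<subseteq> H"
      using section_basis_generates[OF p V subgroup_self C1H] by (simp add: H_def)
    then have "[\<psi> l g h = \<theta> g] (mod int p)" using g(1) by (auto simp: H_def)
    also have "[\<theta> g = (\<Sum>i<t. y i * \<psi> l (b i) h)] (mod int p)"
      unfolding \<theta>_def by (intro cong_sum cong_mult cong_refl g(2)) simp
    finally have gy: "[\<psi> l g h = (\<Sum>i<t. y i * \<psi> l (b i) h)] (mod int p)" .
    have "[(\<Sum>k<s. l k * cc k j i) = - \<psi> l (b i) h] (mod int p)" if i: "i < t" for i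
    proof -
      have "[(\<Sum>k<s. l k * cc k j i) = (\<Sum>k<s. l k * - c k (cmt G (b i) (b j)))] (mod int p)"
        by (intro cong_sum cong_mult cong_refl cc i j(1)) simp
      then show ?thesis unfolding \<psi>_def h_def by (simp add: sum_negf)
    qed
    then have "[(\<Sum>i<t. y i * (\<Sum>k<s. l k * cc k j i)) = (\<Sum>i<t. y i * - \<psi> l (b i) h)] (mod int p)"
      by (intro cong_sum cong_mult cong_refl) simp
    also have "(\<Sum>i<t. y i * - \<psi> l (b i) h) = - (\<Sum>i<t. y i * \<psi> l (b i) h)" by (simp add: sum_negf)
    finally have "int p dvd (\<Sum>i<t. y i * (\<Sum>k<s. l k * cc k j i)) \<longleftrightarrow> int p dvd - (\<Sum>i<t. y i * \<psi> l (b i) h)"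
      by (rule cong_dvd_iff)
    then have "int p dvd (\<Sum>i<t. y i * (\<Sum>k<s. l k * cc k j i)) \<longleftrightarrow> int p dvd \<psi> l g h"
      unfolding dvd_minus_iff cong_dvd_iff[OF gy] .
    then show "\<exists>j<t. \<not> int p dvd (\<Sum>i<t. y i * (\<Sum>k<s. l k * cc k j i))"
      using j unfolding h_def by blast
  qed
  then show ?thesis using cardD cardG by blast
qed


text \<open>Take \<open>A\<close> maximal with \<open>A \<inter> Y = C 2\<close>; it is normal
  because \<open>[C 1, G]\<close> lies in \<open>C 2\<close>. Adjoining to \<open>A\<close> an
  element \<open>x\<close> of \<open>C 1\<close> outside \<open>A Y\<close> would not enlarge the
  intersection with \<open>Y\<close>, so no such \<open>x\<close> exists.\<close>

lemma ex_complement: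
  assumes n: "2 \<le> n" and Y: "subgroup Y G" "C 2 \<subseteq> Y" "Y \<subseteq> C 1"
  shows "\<exists>A. A \<lhd> G \<and> C 2 \<subseteq> A \<and> A \<subseteq> C 1 \<and> A \<inter> Y = C 2 \<and> A <#> Y = C 1"
proof -
  have n1: "1 \<le> n" using n by simp
  interpret C1: normal "C 1" G by (rule C_normal[OF n1])
  interpret C2: normal "C 2" G by (rule C_normal[OF n])
  interpret Y: subgroup Y G by (rule Y(1))
  have cm12: "cmt G x g \<in> C 2" if "x \<in> C 1" "g \<in> carrier G" for x g
    using cmt_in_next[of 1 x g] that n by (simp add: numeral_2_eq_2)
  have pow12: "x [^] p \<in> C 2" if "x \<in> C 1" for x
    using pow_in_next[of 1 x] that n by (simp add: numeral_2_eq_2)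
  define P where "P A \<longleftrightarrow> subgroup A G \<and> C 2 \<subseteq> A \<and> A \<subseteq> C 1 \<and> A \<inter> Y = C 2" for A
  have "C 2 \<inter> Y = C 2" using Y(2) by blast
  moreover have "C 2 \<subseteq> C 1" using Y by blast
  ultimately have "P (C 2)" unfolding P_def using C2.subgroup_axioms by blast
  moreover have "finite {A. P A}"
  proof (rule finite_subset)
    show "{A. P A} \<subseteq> Pow (carrier G)" using subgroup.subset unfolding P_def by blast
    show "finite (Pow (carrier G))" using fin by simp
  qed
  ultimately obtain A where A: "P A" "\<And>T. P T \<Longrightarrow> A \<subseteq> T \<Longrightarrow> T = A"
    using finite_has_maximal2[of "{A. P A}" "C 2"] by (metis mem_Collect_eq)
  have A': "subgroup A G" "C 2 \<subseteq> A" "A \<subseteq> C 1" "A \<inter> Y = C 2" using A(1) unfolding P_def by blast+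
  interpret A: subgroup A G by (rule A'(1))
  have An: "A \<lhd> G"
  proof (rule normalI_cmt[OF A'(1)])
    fix x g assume "x \<in> A" "g \<in> carrier G"
    then have "cmt G x g \<in> C 2" using A'(3) by (intro cm12) blast+
    then show "cmt G x g \<in> A" using A'(2) by blast
  qed
  interpret A: normal A G by (rule An)
  define B where "B = A <#> Y"
  have subB: "subgroup B G" unfolding B_def by (rule normal_set_mult_subgroup[OF An Y(1)])
  have AB: "A \<subseteq> B" "Y \<subseteq> B" unfolding B_def by (rule subset_set_mult[OF A'(1) Y(1)])+
  interpret B: subgroup B G by (rule subB)
  have "B \<subseteq> C 1" unfolding B_def by (rule set_mult_subset[OF C1.subgroup_axioms A'(3) Y(3)])
  moreover have "C 1 \<subseteq> B"
  proof
    fix x assume x: "x \<in> C 1"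
    then have xc: "x \<in> carrier G" by (rule C1.mem_carrier)
    show "x \<in> B"
    proof (rule ccontr)
      assume xB: "x \<notin> B"
      have xpow: "x [^] (j::nat) \<in> C 1" for j
        by (induction j) (use x C1.one_closed C1.m_closed in simp_all)
      define T where "T = {a \<otimes> x [^] (j::nat) | a j. a \<in> A}"
      have AT: "A \<subseteq> T"
      proof
        fix a assume a: "a \<in> A"
        then have "a = a \<otimes> x [^] (0::nat)" by simp
        then show "a \<in> T" using a unfolding T_def by blast
      qed
      have "x = \<one> \<otimes> x [^] (1::nat)" using xc by simp
      then have xT: "x \<in> T" unfolding T_def using A.one_closed by blast
      have TC1: "T \<subseteq> C 1" unfolding T_def using A'(3) xpow C1.m_closed by blast
      have subT: "subgroup T G"
      proof (rule finite_subgroupI[OF fin])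
        show "T \<subseteq> carrier G" using TC1 C1.subset by blast
        show "\<one> \<in> T" using AT A.one_closed by blast
        fix u v assume "u \<in> T" "v \<in> T"
        then obtain a i b j where uv: "u = a \<otimes> x [^] (i::nat)" "a \<in> A" "v = b \<otimes> x [^] (j::nat)" "b \<in> A"
          unfolding T_def by blast
        have c: "a \<in> carrier G" "b \<in> carrier G" "x [^] i \<in> carrier G" using uv xc by auto
        have "u \<otimes> v = (a \<otimes> (x [^] i \<otimes> b \<otimes> inv (x [^] i))) \<otimes> x [^] (i + j)"
          unfolding uv(1,3) using c xc by (simp add: m_assoc nat_pow_mult[symmetric])
        moreover have "a \<otimes> (x [^] i \<otimes> b \<otimes> inv (x [^] i)) \<in> A"
          using uv(2) A.inv_op_closed2[OF c(3) uv(4)] by (rule A.m_closed)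
        ultimately show "u \<otimes> v \<in> T" unfolding T_def by blast
      qed
      have "T \<noteq> A" using xT xB AB(1) by blast
      then have "\<not> P T" using A(2)[OF _ AT] by blast
      moreover have "C 2 \<subseteq> T" using A'(2) AT by blast
      ultimately have "T \<inter> Y \<noteq> C 2" using subT TC1 unfolding P_def by blast
      then obtain y where y: "y \<in> T" "y \<in> Y" "y \<notin> C 2" using \<open>C 2 \<subseteq> T\<close> Y(2) by blast
      then obtain a j where aj: "y = a \<otimes> x [^] (j::nat)" "a \<in> A" unfolding T_def by blast
      have ac: "a \<in> carrier G" using aj(2) by simp
      have xj: "x [^] j = inv a \<otimes> y" unfolding aj(1) using ac xc by simp
      have "inv a \<in> B" "y \<in> B" using aj(2) AB y(2) by auto
      then have xjB: "x [^] j \<in> B" unfolding xj by (rule B.m_closed)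
      have xpB: "x [^] p \<in> B" using pow12[OF x] A'(2) AB(1) by blast
      \<comment> \<open>From \<open>y = a \<otimes> x [^] j\<close> the power \<open>x [^] j\<close>
        lies in \<open>A Y\<close>, while \<open>x\<close> does not. As \<open>p\<close> divides
        \<open>j\<close>, that power already lies in \<open>C 2\<close>, which puts \<open>y\<close>
        into \<open>A \<inter> Y\<close>.\<close>
      have "p dvd j" by (rule prime_pow_mem[OF p subB xc xpB xjB xB])
      then obtain m where m: "j = p * m" ..
      have "x [^] j = (x [^] p) [^] m" unfolding m using xc by (simp add: nat_pow_pow)
      moreover have "(x [^] p) [^] m \<in> C 2" by (induction m) (use pow12[OF x] in auto)
      ultimately have "x [^] j \<in> A" using A'(2) by auto
      then have "y \<in> A" unfolding aj(1) using aj(2) by (intro A.m_closed)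
      then show False using y A'(4) by blast
    qed
  qed
  ultimately have "A <#> Y = C 1" unfolding B_def by blast
  then show ?thesis using An A' by blast
qed

text \<open>Three inequalities close a circle: \<open>q \<le> p ^ s\<close> as
  \<open>L \<subseteq> D \<inter> C 2\<close>, \<open>p ^ t \<le> q ^ 2\<close> by
  \<open>index_C1_le\<close>, and \<open>2 * s \<le> t\<close> by \<open>derived_index_le\<close>,
  where \<open>q = |Y : C 2|\<close>. Equality throughout yields the index formulas and the
  intersection.\<close>

lemma index_and_ultraspecial_quotient:
  assumes n: "2 \<le> n" and lt: "C 2 \<subset> C 2 <#> D"
  shows "sg_index (carrier G) (C 1) = (sg_index (C 2 <#> D) (C 2))\<^sup>2"
    and "(sg_index (C 2 <#> D) (C 2))\<^sup>2 = (sg_index D L)\<^sup>2"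
    and "C 2 \<inter> D = L"
    and "\<exists>A. A \<lhd> G \<and> C 2 \<subseteq> A \<and> A \<subset> C 1 \<and> ultraspecial p (G Mod A)"
proof -
  have n1: "1 \<le> n" using n by simp
  interpret C1: normal "C 1" G by (rule C_normal[OF n1])
  interpret C2: normal "C 2" G by (rule C_normal[OF n])
  interpret D: normal D G by (rule D_normal)
  interpret L: normal L G by (rule L_normal[OF n1])
  note subD = D.subgroup_axioms
  have nD: "\<not> D \<subseteq> C 2"
  proof
    assume "D \<subseteq> C 2"
    then have "C 2 <#> D \<subseteq> C 2" by (rule set_mult_subset[OF C2.subgroup_axioms subset_refl])
    then show False using lt by blast
  qed
  have cm12: "cmt G x g \<in> C 2" if "x \<in> C 1" "g \<in> carrier G" for x g
    using cmt_in_next[of 1 x g] that n by (simp add: numeral_2_eq_2)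
  have LC2: "L \<subseteq> C 2" using L_subset_iff[OF n1 C2.subgroup_axioms] cm12 by blast
  have C21: "C 2 \<subseteq> C 1" by (rule C_antimono) (use n in auto)
  define Y where "Y = C 2 <#> D"
  have subY: "subgroup Y G" unfolding Y_def by (rule normal_set_mult_subgroup[OF C2.normal_axioms subD])
  have C2Y: "C 2 \<subseteq> Y" and DY: "D \<subseteq> Y"
    unfolding Y_def by (rule subset_set_mult[OF C2.subgroup_axioms subD])+
  have YC1: "Y \<subseteq> C 1" unfolding Y_def by (rule set_mult_subset[OF C1.subgroup_axioms C21 D_subset_C1[OF n1]])
  have fs: "finite S" if "S \<subseteq> carrier G" for S using that fin by (rule finite_subset)
  have pos: "card S > 0" if "subgroup S G" for S
    using subgroup.one_closed[OF that] fs[OF subgroup.subset[OF that]] by (auto simp: card_gt_0_iff)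
  \<comment> \<open>The order of the common image of \<open>D\<close> and \<open>Y\<close> modulo
    \<open>C 2\<close>, hence equal to both \<open>|D : D \<inter> C 2|\<close> and
    \<open>|Y : C 2|\<close>.\<close>
  define q where "q = card ((\<lambda>g. C 2 #> g) ` D)"
  have DI: "card D = card (D \<inter> C 2) * q"
    unfolding q_def by (rule card_eq_card_kernel_image[OF is_group fin C2.normal_axioms subD])
  have "card Y = card (Y \<inter> C 2) * card ((\<lambda>g. C 2 #> g) ` Y)"
    by (rule card_eq_card_kernel_image[OF is_group fin C2.normal_axioms subY])
  moreover have "Y \<inter> C 2 = C 2" using C2Y by blast
  moreover have "(\<lambda>g. C 2 #> g) ` Y = (\<lambda>g. C 2 #> g) ` D"
    unfolding Y_def by (rule image_Mod_set_mult[OF C2.normal_axioms subD])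
  ultimately have YI: "card Y = card (C 2) * q" unfolding q_def by (simp only:)
  obtain s t where st: "card D = p ^ s * card L" "card (carrier G) = p ^ t * card (C 1)" "2 * s \<le> t"
    using derived_index_le[OF n1] by blast
  have LD: "L \<subseteq> D \<inter> C 2" using L_subset_D[OF n1] LC2 by blast
  have finDC: "finite (D \<inter> C 2)" by (rule fs) (use D.subset in blast)
  have cL: "card L \<le> card (D \<inter> C 2)" by (rule card_mono[OF finDC LD])
  have Lpos: "card L > 0" by (rule pos[OF L.subgroup_axioms])
  have C1pos: "card (C 1) > 0" by (rule pos[OF C1.subgroup_axioms])
  have C2pos: "card (C 2) > 0" by (rule pos[OF C2.subgroup_axioms])
  have p0: "p \<ge> 1" using prime_gt_0_nat[OF p] by simp
  have "card L * q \<le> card (D \<inter> C 2) * q" using cL by simp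
  also have DI': "\<dots> = card L * p ^ s" unfolding DI[symmetric] st(1) by (rule mult.commute)
  finally have q1: "q \<le> p ^ s" using Lpos by simp
  have "(card (C 2))\<^sup>2 * card (C 1) * p ^ t = card (carrier G) * (card (C 2))\<^sup>2" using st(2) by simp
  also have "\<dots> \<le> (card Y)\<^sup>2 * card (C 1)"
    unfolding Y_def by (rule index_C1_le[OF n nD])
  also have "\<dots> = (card (C 2))\<^sup>2 * card (C 1) * q\<^sup>2" unfolding YI by (simp add: power_mult_distrib)
  finally have q2: "p ^ t \<le> q\<^sup>2" using C1pos C2pos by simp
  have q3: "(p ^ s)\<^sup>2 \<le> p ^ t" unfolding power_mult[symmetric] using st(3) p0 by (intro power_increasing) auto
  have "(p ^ s)\<^sup>2 \<le> q\<^sup>2" using q3 q2 by (rule le_trans)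
  then have "p ^ s \<le> q" by (rule power2_le_imp_le) simp
  then have qs: "q = p ^ s" using q1 by simp
  have qt: "p ^ t = q\<^sup>2" using q2 q3 qs by simp
  have qpos: "q > 0" using qs p0 by simp
  have iG: "sg_index (carrier G) (C 1) = q\<^sup>2"
    unfolding sg_index_def st(2) qt using C1pos by simp
  have iY: "sg_index (C 2 <#> D) (C 2) = q"
    unfolding sg_index_def Y_def[symmetric] YI using C2pos by simp
  have iD: "sg_index D L = q" unfolding sg_index_def st(1) qs using Lpos by simp
  show "sg_index (carrier G) (C 1) = (sg_index (C 2 <#> D) (C 2))\<^sup>2" unfolding iG iY ..
  show "(sg_index (C 2 <#> D) (C 2))\<^sup>2 = (sg_index D L)\<^sup>2" unfolding iY iD ..
  \<comment> \<open>Equality \<open>q = p ^ s\<close> means that \<open>L\<close> and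
    \<open>D \<inter> C 2\<close> have the same index in \<open>D\<close>.\<close>
  have "card (D \<inter> C 2) * q = card L * q" using DI' qs by simp
  then have "card L = card (D \<inter> C 2)" using qpos by simp
  then have "L = D \<inter> C 2" by (rule card_subset_eq[OF finDC LD])
  then show "C 2 \<inter> D = L" by blast
  obtain A where A: "A \<lhd> G" "C 2 \<subseteq> A" "A \<subseteq> C 1" "A \<inter> Y = C 2" "A <#> Y = C 1"
    using ex_complement[OF n subY C2Y YC1] by blast
  interpret A: normal A G by (rule A(1))
  have "A \<noteq> C 1"
  proof
    assume "A = C 1"
    then have "Y = C 2" using A(4) YC1 by blast
    then show False using DY nD by blast
  qed
  \<comment> \<open>\<open>A Y = A (C 2) D\<close>, and the factor \<open>C 2\<close> is absorbed by
    \<open>A\<close>.\<close>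
  have AD: "A <#> D = C 1"
  proof
    show "A <#> D \<subseteq> C 1" by (rule set_mult_subset[OF C1.subgroup_axioms A(3) D_subset_C1[OF n1]])
    show "C 1 \<subseteq> A <#> D"
    proof
      fix x assume "x \<in> C 1"
      then obtain a y where x: "a \<in> A" "y \<in> Y" "x = a \<otimes> y" unfolding A(5)[symmetric] set_mult_def by blast
      obtain c d where y: "c \<in> C 2" "d \<in> D" "y = c \<otimes> d" using x(2) unfolding Y_def set_mult_def by blast
      have "x = (a \<otimes> c) \<otimes> d" unfolding x(3) y(3) using x(1) y(1,2) by (simp add: m_assoc)
      moreover have "a \<otimes> c \<in> A" using x(1) y(1) A(2) by auto
      ultimately show "x \<in> A <#> D" unfolding set_mult_def using y(2) by blast
    qed
  qed
  have LA: "L \<subseteq> A" using LC2 A(2) by blast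
  note ses = semi_extraspecial_quotient[OF n1 A(1) LA \<open>A \<noteq> C 1\<close> AD]
  have "card Y = card (Y \<inter> A) * card ((\<lambda>g. A #> g) ` Y)"
    by (rule card_eq_card_kernel_image[OF is_group fin A(1) subY])
  moreover have "Y \<inter> A = C 2" using A(4) by blast
  ultimately have "card Y = card (C 2) * card ((\<lambda>g. A #> g) ` Y)" by (simp only:)
  then have "card (C 2) * card ((\<lambda>g. A #> g) ` Y) = card (C 2) * q" unfolding YI by (rule sym)
  then have cY: "card ((\<lambda>g. A #> g) ` Y) = q" using C2pos by simp
  have im: "(\<lambda>g. A #> g) ` C 1 = (\<lambda>g. A #> g) ` Y"
    unfolding A(5)[symmetric] by (rule image_Mod_set_mult[OF A(1) subY])
  have cZ: "card (grp_center (G Mod A)) = q" unfolding ses(2) im by (rule cY)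
  have "card (C 1) = card (C 1 \<inter> A) * card ((\<lambda>g. A #> g) ` C 1)"
    by (rule card_eq_card_kernel_image[OF is_group fin A(1) C1.subgroup_axioms])
  moreover have "C 1 \<inter> A = A" using A(3) by blast
  ultimately have c1: "card (C 1) = card A * q" unfolding im cY by simp
  have "card (carrier G) = card (carrier G \<inter> A) * card ((\<lambda>g. A #> g) ` carrier G)"
    by (rule card_eq_card_kernel_image[OF is_group fin A(1) subgroup_self])
  moreover have "carrier G \<inter> A = A" using A.subset by blast
  ultimately have "card (carrier G) = card A * card (carrier (G Mod A))"
    unfolding carrier_FactGroup by (simp only:)
  \<comment> \<open>From \<open>|G : C 1| = q ^ 2\<close> and \<open>|C 1 : A| = q\<close>, the
    quotient has order \<open>q ^ 3\<close> and its center has order \<open>q\<close>, the numerical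
    condition for an ultraspecial group.\<close>
  moreover have "card (carrier G) = card A * (q\<^sup>2 * q)" using st(2) qt c1 by simp
  ultimately have "card A * card (carrier (G Mod A)) = card A * (q\<^sup>2 * q)" by (simp only:)
  moreover have "card A > 0" by (rule pos[OF A.subgroup_axioms])
  ultimately have "card (carrier (G Mod A)) = q\<^sup>2 * q" by simp
  then have "card (carrier (G Mod A)) div card (grp_center (G Mod A)) = (card (grp_center (G Mod A)))\<^sup>2"
    unfolding cZ using qpos by simp
  then have "ultraspecial p (G Mod A)" unfolding ultraspecial_def using ses(1) by blast
  then show "\<exists>A. A \<lhd> G \<and> C 2 \<subseteq> A \<and> A \<subset> C 1 \<and> ultraspecial p (G Mod A)"
    using A(1-3) \<open>A \<noteq> C 1\<close> by blast
qed

end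

theorem theorem1p5:
  fixes G :: "('a, 'b) monoid_scheme" and p n :: nat and Xc :: "nat \<Rightarrow> 'a set"
  assumes "Factorial_Ring.prime p"
    and "p_group p G"
    and "\<not> comm_group G"
    and "nested G"
    and "chain_of_centers G Xc n"
  shows "is_square (sg_index (carrier G) (Xc 1))
    \<and> (\<forall>i. 1 \<le> i \<and> i \<le> n \<and> derived_subgroup G \<subseteq> Xc i \<longrightarrow>
           (\<forall>j. 1 \<le> j \<and> j \<le> i \<longrightarrow> is_square (sg_index (carrier G) (Xc j))))
    \<and> (\<forall>N. N \<lhd> G \<and> comm_subgroup G (Xc 1) (carrier G) \<subseteq> N \<and>
           N \<subset> N <#>\<^bsub>G\<^esub> derived_subgroup G \<and> N <#>\<^bsub>G\<^esub> derived_subgroup G = Xc 1 \<longrightarrow>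
           semi_extraspecial p (G Mod N))
    \<and> (2 \<le> n \<and> Xc 2 \<subset> Xc 2 <#>\<^bsub>G\<^esub> derived_subgroup G \<longrightarrow>
           sg_index (carrier G) (Xc 1) = (sg_index (Xc 2 <#>\<^bsub>G\<^esub> derived_subgroup G) (Xc 2))\<^sup>2 \<and>
           (sg_index (Xc 2 <#>\<^bsub>G\<^esub> derived_subgroup G) (Xc 2))\<^sup>2 =
             (sg_index (derived_subgroup G) (comm_subgroup G (Xc 1) (carrier G)))\<^sup>2 \<and>
           Xc 2 \<inter> derived_subgroup G = comm_subgroup G (Xc 1) (carrier G) \<and>
           (\<exists>A. A \<lhd> G \<and> Xc 2 \<subseteq> A \<and> A \<subset> Xc 1 \<and> ultraspecial p (G Mod A)))"
proof -
  obtain e where G: "group G" "finite (carrier G)" "card (carrier G) = p ^ e"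
    using assms(2) by (auto simp: p_group_def Coset.order_def)
  interpret group G by (rule G(1))
  have chain: "Xc 0 = carrier G" "\<And>i. i < n \<Longrightarrow> Xc (Suc i) \<subset> Xc i" "Xc ` {..n} = char_center G ` Irr G"
    using assms(5) by (auto simp: chain_of_centers_def)
  interpret chain_group G p e n Xc
  proof (intro chain_group.intro chain_group_axioms.intro G assms(1) chain(1,2))
    fix i assume "i \<le> n"
    then have "Xc i \<in> Xc ` {..n}" by simp
    then obtain \<chi> where "\<chi> \<in> Irr G" "Xc i = char_center G \<chi>" unfolding chain(3) by (rule imageE) blast
    then show "\<exists>K f. central_char G (Xc i) K f" using Irr_central_char[OF G(1,2)] by metis
  next
    fix N g assume "N \<lhd> G" "g \<in> carrier G" "g \<notin> N"
    then obtain \<chi> K f where \<chi>: "\<chi> \<in> Irr G" "central_char G (char_center G \<chi>) K f" "N \<subseteq> K" "g \<notin> K"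
      using Irr_separates[OF G(1,2)] by metis
    have "char_center G \<chi> \<in> Xc ` {..n}" unfolding chain(3) using \<chi>(1) by (rule imageI)
    then obtain i where "i \<le> n" "char_center G \<chi> = Xc i" by (elim imageE) simp
    then show "\<exists>i\<le>n. \<exists>K f. central_char G (Xc i) K f \<and> N \<subseteq> K \<and> g \<notin> K" using \<chi>(2-4) by metis
  qed
  \<comment> \<open>A character that is nontrivial on some commutator has a proper center, so the
    chain has a member besides \<open>Xc 0\<close>.\<close>
  have n1: "1 \<le> n"
  proof -
    obtain x y where xy: "x \<in> carrier G" "y \<in> carrier G" "x \<otimes>\<^bsub>G\<^esub> y \<noteq> y \<otimes>\<^bsub>G\<^esub> x"
      using assms(3) group_comm_groupI by blast
    then have ne: "cmt G x y \<notin> {\<one>\<^bsub>G\<^esub>}" using cmt_eq_one_iff[OF xy(1,2)] by simp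
    obtain j K f where j: "j \<le> n" "central_char G (Xc j) K f" "cmt G x y \<notin> K"
      using separates[OF one_is_normal cmt_closed[OF xy(1,2)] ne] by blast
    have "j \<noteq> 0"
    proof
      assume "j = 0"
      then have "x \<in> Xc j" using xy(1) C0 by simp
      then show False using central_charD(8)[OF j(2) _ xy(2)] j(3) by blast
    qed
    then show ?thesis using j(1) by simp
  qed
  have 1: "is_square (sg_index (carrier G) (Xc 1))"
    by (rule index_square[OF n1 D_subset_C1[OF n1]])
  have 2: "\<forall>i. 1 \<le> i \<and> i \<le> n \<and> derived_subgroup G \<subseteq> Xc i \<longrightarrow>
           (\<forall>j. 1 \<le> j \<and> j \<le> i \<longrightarrow> is_square (sg_index (carrier G) (Xc j)))"
  proof (intro allI impI, elim conjE)
    fix i j assume ij: "i \<le> n" "derived_subgroup G \<subseteq> Xc i" "j \<le> i"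
    then have "derived_subgroup G \<subseteq> Xc j" using C_antimono[OF ij(3,1)] by blast
    then show "is_square (sg_index (carrier G) (Xc j))" using ij by (intro index_square) auto
  qed
  have 3: "\<forall>N. N \<lhd> G \<and> comm_subgroup G (Xc 1) (carrier G) \<subseteq> N \<and>
           N \<subset> N <#>\<^bsub>G\<^esub> derived_subgroup G \<and> N <#>\<^bsub>G\<^esub> derived_subgroup G = Xc 1 \<longrightarrow>
           semi_extraspecial p (G Mod N)"
  proof (intro allI impI, elim conjE)
    fix N assume N: "N \<lhd> G" "comm_subgroup G (Xc 1) (carrier G) \<subseteq> N"
      "N \<subset> N <#>\<^bsub>G\<^esub> derived_subgroup G" "N <#>\<^bsub>G\<^esub> derived_subgroup G = Xc 1"
    have "N \<noteq> Xc 1" using N(3,4) by blast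
    then show "semi_extraspecial p (G Mod N)" by (rule semi_extraspecial_quotient(1)[OF n1 N(1,2) _ N(4)])
  qed
  have 4: "2 \<le> n \<and> Xc 2 \<subset> Xc 2 <#>\<^bsub>G\<^esub> derived_subgroup G \<longrightarrow>
           sg_index (carrier G) (Xc 1) = (sg_index (Xc 2 <#>\<^bsub>G\<^esub> derived_subgroup G) (Xc 2))\<^sup>2 \<and>
           (sg_index (Xc 2 <#>\<^bsub>G\<^esub> derived_subgroup G) (Xc 2))\<^sup>2 =
             (sg_index (derived_subgroup G) (comm_subgroup G (Xc 1) (carrier G)))\<^sup>2 \<and>
           Xc 2 \<inter> derived_subgroup G = comm_subgroup G (Xc 1) (carrier G) \<and>
           (\<exists>A. A \<lhd> G \<and> Xc 2 \<subseteq> A \<and> A \<subset> Xc 1 \<and> ultraspecial p (G Mod A))"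
  proof (intro impI, elim conjE)
    assume a: "2 \<le> n" "Xc 2 \<subset> Xc 2 <#>\<^bsub>G\<^esub> derived_subgroup G"
    note index_and_ultraspecial_quotient = index_and_ultraspecial_quotient[OF a]
    show "sg_index (carrier G) (Xc 1) = (sg_index (Xc 2 <#>\<^bsub>G\<^esub> derived_subgroup G) (Xc 2))\<^sup>2 \<and>
           (sg_index (Xc 2 <#>\<^bsub>G\<^esub> derived_subgroup G) (Xc 2))\<^sup>2 =
             (sg_index (derived_subgroup G) (comm_subgroup G (Xc 1) (carrier G)))\<^sup>2 \<and>
           Xc 2 \<inter> derived_subgroup G = comm_subgroup G (Xc 1) (carrier G) \<and>
           (\<exists>A. A \<lhd> G \<and> Xc 2 \<subseteq> A \<and> A \<subset> Xc 1 \<and> ultraspecial p (G Mod A))"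
      by (intro conjI index_and_ultraspecial_quotient)
  qed
  show ?thesis by (rule conjI[OF 1 conjI[OF 2 conjI[OF 3 4]]])
qed

end
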